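(* Let $k\ge2$ be an integer and let $\mathbb T_n^{\rm sf}$ be the scale-free random tree with parameter $\alpha=0$ (the standard preferential attachment tree). Then its $k$-cut number satisfies $$2^{-1/k}\,n^{-1}(\ln n)^{1/k}\,\mathcal K(\mathbb T_n^{\rm sf})\xrightarrow{d}(k!)^{1/k}\,\Gamma\Big(1+\frac1k\Big)\quad\text{as } n\to\infty,$$ i.e. convergence in distribution to a constant.
   Context: The $k$-cut number $\mathcal K(T)$ of a finite rooted tree $T$ is the random total number of cuts made in the following procedure. Step 1: choose a vertex uniformly at random from the component that currently contains the root and cut it once. Step 2: if this vertex has now been cut $k$ times, remove it together with the edges attached to it. Step 3: if the root has been removed, stop; otherwise go to Step 1. When the tree is random, the tree is sampled first and the procedure is then run on it. Scale-free tree with $\alpha=0$: $\mathbb T_1^{\rm sf}$ consists of a single edge connecting the vertices labelled $1$ and $2$, and the tree is rooted at vertex $1$. Given $\mathbb T_n^{\rm sf}$, which has vertices $1,\dots,n+1$ with degrees $\deg_n(1),\dots,\deg_n(n+1)$, the tree $\mathbb T_{n+1}^{\rm sf}$ is obtained by adding an edge between a new vertex $n+2$ and a random vertex $v_n$ of $\mathbb T_n^{\rm sf}$ with $\mathbb P(v_n=i\mid\mathbb T_n^{\rm sf})=\deg_n(i)/(2n)$ for $i\in\{1,\dots,n+1\}$. $\Gamma(\cdot)$ is the gamma function. *)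

theory Defs
  imports "HOL-Probability.Probability"
begin

text \<open>
  Rooted trees are finite simple graphs with a distinguished vertex; an edge is the set of its
  two endpoints. The record also accommodates the forests that arise when vertices are removed.
\<close>

record 'v rooted_graph =
  verts :: "'v set"
  edges :: "'v set set"
  root_vertex :: 'v

definition degree :: "'v rooted_graph \<Rightarrow> 'v \<Rightarrow> nat" where
  "degree G v = card {e \<in> edges G. v \<in> e}"

definition root_component :: "'v rooted_graph \<Rightarrow> 'v set" where
  "root_component G =
    {v \<in> verts G. (root_vertex G, v) \<in> {(x, y). {x, y} \<in> edges G}\<^sup>*}"

definition remove_vertex :: "'v \<Rightarrow> 'v rooted_graph \<Rightarrow> 'v rooted_graph" where
  "remove_vertex v G = G\<lparr>verts := verts G - {v}, edges := {e \<in> edges G. v \<notin> e}\<rparr>"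

text \<open>
  \<open>k_cuts_from k G c\<close> is the distribution of the number of cuts still to be made when \<open>G\<close> is
  what is left of the tree and each vertex \<open>v\<close> has been cut \<open>c v\<close> times so far. Starting from
  \<open>c = (\<lambda>_. 0)\<close>, the test \<open>k \<le> c' v\<close> is first met with equality, at the \<open>k\<close>-th cut of \<open>v\<close>.
  Infinite graphs are excluded only to make the recursion terminate.
\<close>

function k_cuts_from :: "nat \<Rightarrow> 'v rooted_graph \<Rightarrow> ('v \<Rightarrow> nat) \<Rightarrow> nat pmf" where
  "k_cuts_from k G c =
    (if finite (verts G) \<and> root_vertex G \<in> verts G then
       do {
         v \<leftarrow> pmf_of_set (root_component G);
         let c' = c(v := c v + 1);
         let G' = (if k \<le> c' v then remove_vertex v G else G);
         m \<leftarrow> k_cuts_from k G' c';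
         return_pmf (m + 1)
       }
     else return_pmf 0)"
  by auto

termination
proof (relation "Wellfounded.measure (\<lambda>(k, G, c). \<Sum>v\<in>verts G. Suc (k - c v))",
    goal_cases)
  case 1
  then show ?case by simp
next
  case (2 k G c v c' G')
  have fin: "finite (verts G)" and r: "root_vertex G \<in> verts G"
    using 2 by auto
  have "root_vertex G \<in> root_component G"
    using r by (simp add: root_component_def)
  moreover have "finite (root_component G)"
    using fin by (simp add: root_component_def)
  ultimately have "v \<in> root_component G"
    using 2 by (metis empty_iff set_pmf_of_set)
  then have v: "v \<in> verts G"
    by (simp add: root_component_def)
  have c': "c' = c(v := c v + 1)" and
    G': "G' = (if k \<le> c' v then remove_vertex v G else G)"
    using 2 by simp_all
  have eq: "(\<Sum>u\<in>verts G - {v}. Suc (k - c' u)) = (\<Sum>u\<in>verts G - {v}. Suc (k - c u))"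
    by (rule sum.cong) (auto simp: c')
  have split: "(\<Sum>u\<in>verts G. Suc (k - f u)) =
      Suc (k - f v) + (\<Sum>u\<in>verts G - {v}. Suc (k - f u))" for f :: "_ \<Rightarrow> nat"
    by (rule sum.remove[OF fin v])
  have "(\<Sum>u\<in>verts G'. Suc (k - c' u)) < (\<Sum>u\<in>verts G. Suc (k - c u))"
  proof (cases "k \<le> c' v")
    case True
    then have "verts G' = verts G - {v}"
      by (simp add: G' remove_vertex_def)
    then show ?thesis
      using eq split[of c] by simp
  next
    case False
    then have "G' = G" and "Suc (k - c' v) < Suc (k - c v)"
      by (auto simp: G' c')
    then show ?thesis
      using eq split[of c] split[of c'] by simp
  qed
  then show ?case by simp
qed

declare k_cuts_from.simps [simp del]

definition k_cut_number :: "nat \<Rightarrow> 'v rooted_graph \<Rightarrow> nat pmf" where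
  "k_cut_number k T = k_cuts_from k T (\<lambda>_. 0)"

definition attachment_pmf :: "nat \<Rightarrow> nat rooted_graph \<Rightarrow> nat pmf" where
  "attachment_pmf n T =
    embed_pmf (\<lambda>i. if i \<in> {1..n+1} then real (degree T i) / (2 * real n) else 0)"

definition add_leaf :: "'v \<Rightarrow> 'v \<Rightarrow> 'v rooted_graph \<Rightarrow> 'v rooted_graph" where
  "add_leaf w v T = T\<lparr>verts := insert w (verts T), edges := insert {v, w} (edges T)\<rparr>"

text \<open>
  The scale-free tree with \<open>n\<close> edges, for \<open>n \<ge> 1\<close>; the value at \<open>0\<close> is an arbitrary choice.
\<close>

fun scale_free_tree :: "nat \<Rightarrow> nat rooted_graph pmf" where
  "scale_free_tree 0 = return_pmf \<lparr>verts = {1}, edges = {}, root_vertex = 1\<rparr>"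
| "scale_free_tree (Suc 0) = return_pmf \<lparr>verts = {1, 2}, edges = {{1, 2}}, root_vertex = 1\<rparr>"
| "scale_free_tree (Suc (Suc m)) =
    (let n = Suc m in
     do {
       T \<leftarrow> scale_free_tree n;
       v \<leftarrow> attachment_pmf n T;
       return_pmf (add_leaf (n + 2) v T)
     })"

definition k_cut_number_scale_free :: "nat \<Rightarrow> nat \<Rightarrow> nat pmf" where
  "k_cut_number_scale_free k n = do { T \<leftarrow> scale_free_tree n; k_cut_number k T }"

text \<open>
  The weights in \<open>attachment_pmf\<close> do form a probability mass function on every tree that
  \<open>scale_free_tree\<close> can produce.
\<close>

lemma pmf_attachment_pmf_if_well_formed:
  fixes T :: "nat rooted_graph"
  assumes n: "n \<ge> 1" and V: "verts T = {1..n+1}" and fin: "finite (edges T)"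
    and card: "card (edges T) = n" and sub: "\<And>e. e \<in> edges T \<Longrightarrow> e \<subseteq> verts T \<and> card e = 2"
  shows "pmf (attachment_pmf n T) i = (if i \<in> {1..n+1} then real (degree T i) / (2 * real n) else 0)"
proof -
  define f where
    "f = (\<lambda>i. if i \<in> {1..n+1} then real (degree T i) / (2 * real n) else (0::real))"
  have "(\<Sum>i\<in>{1..n+1}. degree T i) = (\<Sum>i\<in>{1..n+1}. \<Sum>e\<in>edges T. if i \<in> e then 1 else 0)"
    using fin by (intro sum.cong) (auto simp: degree_def sum.If_cases Int_def)
  also have "\<dots> = (\<Sum>e\<in>edges T. \<Sum>i\<in>{1..n+1}. if i \<in> e then 1 else 0)"
    by (rule sum.swap)
  also have "\<dots> = (\<Sum>e\<in>edges T. 2)"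
  proof (rule sum.cong)
    fix e assume e: "e \<in> edges T"
    then have "{1..n+1} \<inter> {i. i \<in> e} = e"
      using sub V by auto
    then show "(\<Sum>i\<in>{1..n+1}. if i \<in> e then 1 else 0) = (2::nat)"
      using sub[OF e] by (subst sum.If_cases) (auto simp del: Int_atLeastAtMost)
  qed simp
  finally have deg: "(\<Sum>i\<in>{1..n+1}. degree T i) = 2 * n"
    using card by simp
  have "(\<Sum>i\<in>{1..n+1}. f i) = (\<Sum>i\<in>{1..n+1}. real (degree T i) / (2 * real n))"
    by (rule sum.cong) (auto simp: f_def)
  also have "\<dots> = real (\<Sum>i\<in>{1..n+1}. degree T i) / (2 * real n)"
    by (simp only: sum_divide_distrib of_nat_sum)
  also have "\<dots> = 1"
    unfolding deg using n by simp
  finally have sum_f: "(\<Sum>i\<in>{1..n+1}. f i) = 1" .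
  have "(\<integral>\<^sup>+ i. ennreal (f i) \<partial>count_space UNIV)
      = (\<Sum>i\<in>{1..n+1}. ennreal (f i))"
    by (rule nn_integral_count_space') (auto simp: f_def)
  also have "\<dots> = ennreal (\<Sum>i\<in>{1..n+1}. f i)"
    by (rule sum_ennreal) (simp add: f_def)
  also have "\<dots> = 1"
    by (simp only: sum_f ennreal_1)
  finally have "pmf (embed_pmf f) i = f i"
    by (intro pmf_embed_pmf) (auto simp: f_def)
  then show ?thesis
    by (simp add: attachment_pmf_def f_def)
qed

lemma scale_free_tree_well_formed:
  assumes "n \<ge> 1" and "T \<in> set_pmf (scale_free_tree n)"
  shows "verts T = {1..n+1} \<and> finite (edges T) \<and> card (edges T) = n \<and>
    (\<forall>e\<in>edges T. e \<subseteq> verts T \<and> card e = 2)"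
  using assms
proof (induction n arbitrary: T rule: scale_free_tree.induct)
  case 1
  then show ?case by simp
next
  case 2
  then show ?case by (auto simp: card_insert_if)
next
  case (3 m)
  define n where "n = Suc m"
  obtain S v where S: "S \<in> set_pmf (scale_free_tree n)" and v: "v \<in> set_pmf (attachment_pmf n S)"
    and T: "T = add_leaf (n + 2) v S"
    using 3 by (auto simp: n_def Let_def)
  have IH: "verts S = {1..n+1}" "finite (edges S)" "card (edges S) = n"
    "\<And>e. e \<in> edges S \<Longrightarrow> e \<subseteq> verts S \<and> card e = 2"
    using 3(1)[of n S] S by (auto simp: n_def)
  have "pmf (attachment_pmf n S) v \<noteq> 0"
    using v by (simp add: set_pmf_iff)
  then have vin: "v \<in> {1..n+1}"
    using pmf_attachment_pmf_if_well_formed[of n S v] IH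
    by (auto simp: n_def split: if_splits)
  have "{v, n + 2} \<notin> edges S"
    using IH(1) IH(4)[of "{v, n + 2}"] by auto
  moreover have "card {v, n + 2} = 2"
    using vin by auto
  ultimately show ?case
    using IH vin unfolding T add_leaf_def by (auto simp: n_def)
qed

lemma pmf_attachment_pmf:
  assumes "n \<ge> 1" and "T \<in> set_pmf (scale_free_tree n)"
  shows "pmf (attachment_pmf n T) i = (if i \<in> {1..n+1} then real (degree T i) / (2 * real n) else 0)"
  using scale_free_tree_well_formed[OF assms] assms(1)
  by (intro pmf_attachment_pmf_if_well_formed) auto

end

theory Submission
  imports Defs
begin

text \<open>
  Let every vertex carry an independent rate-one Poisson clock which cuts it. A vertex is still
  attached to the root at time \<open>t\<close> iff each of its ancestors, itself included, has rung fewer than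
  \<open>k\<close> times, so with \<open>S(t) = P(Poisson(t) < k)\<close> the root component has expected size
  \<open>\<Sum>v. S(t) ^ (depth v + 1)\<close>. Cuts happen at a rate equal to the size of the root component, hence the
  mean of the \<open>k\<close>-cut number \<open>K\<close> is the integral of this sum over all \<open>t \<ge> 0\<close>. In the scale-free tree a
  typical depth is \<open>ln n / 2\<close> and \<open>1 - S(t)\<close> is about \<open>t ^ k / k!\<close>, so the mean is close to
  \<open>n\<close> times the integral of \<open>exp (- (ln n) t ^ k / (2 k!))\<close>, which is
  \<open>n (2 k! / ln n) powr (1 / k) * Gamma (1 + 1 / k)\<close>. Two vertices typically have only a bounded number of
  common ancestors, so the second moment is asymptotically the square of the mean, and Chebyshev's
  inequality gives convergence to a constant.

  The continuous-time process never has to be constructed. The derivative of the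
  Poisson probability \<open>surv j\<close> is \<open>surv (j - 1) - surv j\<close>, which says that the claimed integrals obey the
  one-step recursion of the cutting procedure (\<open>surv_sum_generator\<close>); induction over the
  cuts that remain then proves \<open>k_cuts_mean\<close> and \<open>k_cuts_second_moment\<close>. The second identity
  is about \<open>K (K + 1)\<close> because the integrated size of the root component is a sum of \<open>K\<close>
  independent standard exponential variables, independent of \<open>K\<close>, and has second moment
  \<open>E (K (K + 1))\<close>. It is the integral over two times of the expected product of the two component sizes.

  It remains to average over the tree. The generating function of the depths has an exact
  product formula (\<open>expectation_depth_gf\<close>). For pairs of vertices the analogous recursion is only an
  inequality (\<open>expectation_pair_gf_le\<close>), but with the right leading constant. Both products are
  compared with powers of \<open>n\<close>. All estimates depend on a cut-off \<open>tau\<close> for the time variable; \<open>n\<close> tends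
  to infinity first and \<open>tau\<close> to zero afterwards
  (\<open>mean_square_deviation_tendsto_0\<close>).
\<close>

section \<open>Ancestors and root components\<close>

definition delete_vertices :: "'v set \<Rightarrow> 'v rooted_graph \<Rightarrow> 'v rooted_graph" where
  "delete_vertices D G = G\<lparr>verts := verts G - D, edges := {e \<in> edges G. e \<inter> D = {}}\<rparr>"

text \<open>
  The vertices that separate \<open>v\<close> from the root. Both \<open>v\<close> and the root are among them, so on a tree there is
  one more ancestor than the depth of \<open>v\<close>. Separation, rather than a path, is what
  the removal of vertices is about.
\<close>

definition ancestors :: "'v rooted_graph \<Rightarrow> 'v \<Rightarrow> 'v set" where
  "ancestors T v = {u \<in> verts T. v \<notin> root_component (remove_vertex u T)}"

text \<open>
  Building trees leaf by leaf provides the induction that fits the scale-free tree.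
\<close>

inductive grown_tree :: "'v rooted_graph \<Rightarrow> bool" where
  single: "grown_tree \<lparr>verts = {r}, edges = {}, root_vertex = r\<rparr>"
| leaf: "grown_tree T \<Longrightarrow> v \<in> verts T \<Longrightarrow> w \<notin> verts T \<Longrightarrow> grown_tree (add_leaf w v T)"

lemma remove_vertex_conv_delete: "remove_vertex v G = delete_vertices {v} G"
  by (auto simp: remove_vertex_def delete_vertices_def)

lemma delete_vertices_simps [simp]:
  "verts (delete_vertices D G) = verts G - D"
  "edges (delete_vertices D G) = {e \<in> edges G. e \<inter> D = {}}"
  "root_vertex (delete_vertices D G) = root_vertex G"
  by (simp_all add: delete_vertices_def)

lemma delete_vertices_empty [simp]: "delete_vertices {} G = G"
  by (simp add: delete_vertices_def)

lemma delete_vertices_insert: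
  "remove_vertex v (delete_vertices D G) = delete_vertices (insert v D) G"
proof -
  have "verts G - D - {v} = verts G - insert v D"
    and "{e \<in> {e \<in> edges G. e \<inter> D = {}}. v \<notin> e} = {e \<in> edges G. e \<inter> insert v D = {}}"
    by auto
  then show ?thesis
    by (simp add: remove_vertex_def delete_vertices_def)
qed

lemma add_leaf_simps [simp]:
  "verts (add_leaf w v T) = insert w (verts T)"
  "edges (add_leaf w v T) = insert {v, w} (edges T)"
  "root_vertex (add_leaf w v T) = root_vertex T"
  by (simp_all add: add_leaf_def)

lemma grown_tree_basic:
  assumes "grown_tree T"
  shows "finite (verts T)" "finite (edges T)" "root_vertex T \<in> verts T"
    "e \<in> edges T \<Longrightarrow> e \<subseteq> verts T"
  using assms by (induction arbitrary: e) auto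

text \<open>
  A new leaf lies on no path between old vertices, so its edge matters for the leaf alone.
\<close>

lemma root_component_add_leaf:
  assumes sub: "\<And>e. e \<in> edges T \<Longrightarrow> e \<subseteq> verts T"
    and r: "root_vertex T \<in> verts T" and v: "v \<in> verts T" and w: "w \<notin> verts T"
  shows "root_component (delete_vertices D (add_leaf w v T)) =
    (let R = root_component (delete_vertices D T) in if v \<in> R \<and> w \<notin> D then insert w R else R)"
proof -
  define E where "E = {(x, y). {x, y} \<in> edges T \<and> {x, y} \<inter> D = {}}"
  define E' where "E' = {(x, y). {x, y} \<in> edges (add_leaf w v T) \<and> {x, y} \<inter> D = {}}"
  let ?r = "root_vertex T"
  have R: "root_component (delete_vertices D T) = {x \<in> verts T - D. (?r, x) \<in> E\<^sup>*}"
    by (simp add: root_component_def E_def)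
  have R': "root_component (delete_vertices D (add_leaf w v T)) =
      {x \<in> insert w (verts T) - D. (?r, x) \<in> E'\<^sup>*}"
    by (simp add: root_component_def E'_def)
  have inE: "x \<in> verts T" if "(?r, x) \<in> E\<^sup>*" for x
    using that by (induction rule: rtrancl_induct) (use r sub in \<open>auto simp: E_def\<close>)
  have sub': "E \<subseteq> E'"
    by (auto simp: E_def E'_def)
  have mono: "(?r, x) \<in> E'\<^sup>*" if "(?r, x) \<in> E\<^sup>*" for x
    using that rtrancl_mono[OF sub'] by auto
  have bwd: "(x \<noteq> w \<and> (?r, x) \<in> E\<^sup>*) \<or> (x = w \<and> (?r, v) \<in> E\<^sup>* \<and> v \<notin> D \<and> w \<notin> D)"
    if "(?r, x) \<in> E'\<^sup>*" for x
    using that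
  proof (induction rule: rtrancl_induct)
    case base
    then show ?case using r w by auto
  next
    case (step y z)
    consider "(y, z) \<in> E" | "y = v" "z = w" "v \<notin> D" "w \<notin> D" | "y = w" "z = v"
      using step(2) by (auto simp: E_def E'_def doubleton_eq_iff)
    then show ?case
    proof cases
      case 1
      then have "y \<noteq> w" "z \<noteq> w"
        using sub w by (auto simp: E_def)
      then show ?thesis using step(3) 1 by (auto intro: rtrancl_into_rtrancl)
    next
      case 2
      then show ?thesis using step(3) v w by auto
    next
      case 3
      then show ?thesis using step(3) v w by auto
    qed
  qed
  have leaf: "(?r, w) \<in> E'\<^sup>*" if "(?r, v) \<in> E\<^sup>*" "v \<notin> D" "w \<notin> D"
  proof -
    have "(v, w) \<in> E'" using that by (auto simp: E'_def)
    then show ?thesis using mono[OF that(1)] by (rule rtrancl_into_rtrancl[rotated])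
  qed
  show ?thesis
  proof (rule set_eqI)
    fix x
    show "x \<in> root_component (delete_vertices D (add_leaf w v T)) \<longleftrightarrow>
        x \<in> (let R = root_component (delete_vertices D T) in
          if v \<in> R \<and> w \<notin> D then insert w R else R)"
    proof (cases "x = w")
      case True
      then show ?thesis
        unfolding R R' Let_def using bwd[of w] leaf w v by auto
    next
      case False
      then show ?thesis
        unfolding R R' Let_def using bwd[of x] mono[of x] w by auto
    qed
  qed
qed

lemma root_component_grown_tree: "grown_tree T \<Longrightarrow> root_component T = verts T"
proof (induction rule: grown_tree.induct)
  case (single r)
  then show ?case by (auto simp: root_component_def)
next
  case (leaf T v w)
  then show ?case
    using root_component_add_leaf[of T v w "{}"] grown_tree_basic[OF leaf(1)]
    by simp
qed

lemma ancestors_add_leaf: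
  assumes T: "grown_tree T" and v: "v \<in> verts T" and w: "w \<notin> verts T"
  shows "ancestors (add_leaf w v T) w = insert w (ancestors T v)"
    and "u \<in> verts T \<Longrightarrow> ancestors (add_leaf w v T) u = ancestors T u"
proof -
  note basic = grown_tree_basic[OF T]
  note rc = root_component_add_leaf[OF basic(4) basic(3) v w]
  have "verts T - {w} = verts T" "{e \<in> edges T. e \<inter> {w} = {}} = edges T"
    using basic(4) w by auto
  then have *: "delete_vertices {w} T = T"
    unfolding delete_vertices_def by simp
  have notin: "w \<notin> root_component (delete_vertices {x} T)" for x
    using w by (auto simp: root_component_def)
  show "ancestors (add_leaf w v T) w = insert w (ancestors T v)"
    using notin v w
    by (auto simp: ancestors_def remove_vertex_conv_delete rc Let_def)
  show "ancestors (add_leaf w v T) u = ancestors T u" if u: "u \<in> verts T"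
  proof -
    have "u \<in> root_component (delete_vertices {x} (add_leaf w v T)) \<longleftrightarrow>
        u \<in> root_component (delete_vertices {x} T)" for x
      using u w by (auto simp: rc Let_def)
    moreover have "u \<in> root_component (delete_vertices {w} T)"
      using u root_component_grown_tree[OF T] * by simp
    ultimately show ?thesis
      by (auto simp: ancestors_def remove_vertex_conv_delete)
  qed
qed

lemma ancestors_single: "ancestors \<lparr>verts = {r}, edges = {}, root_vertex = r\<rparr> v = {r}"
  by (auto simp: ancestors_def remove_vertex_def root_component_def)

lemma ancestors_subset: "ancestors T v \<subseteq> verts T"
  by (auto simp: ancestors_def)

lemma self_in_ancestors: "v \<in> verts T \<Longrightarrow> v \<in> ancestors T v"
  by (auto simp: ancestors_def remove_vertex_def root_component_def)

lemma finite_ancestors: "grown_tree T \<Longrightarrow> finite (ancestors T v)"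
  by (rule finite_subset[OF ancestors_subset grown_tree_basic(1)])

lemma root_ancestor:
  assumes "grown_tree T" "v \<in> verts T"
  shows "root_vertex T \<in> ancestors T v"
  using assms
proof (induction arbitrary: v)
  case (single r)
  then show ?case by (simp add: ancestors_single)
next
  case (leaf T u w)
  then show ?case by (auto simp: ancestors_add_leaf)
qed

lemma ancestors_root: "grown_tree T \<Longrightarrow> ancestors T (root_vertex T) = {root_vertex T}"
proof (induction rule: grown_tree.induct)
  case (single r)
  then show ?case by (simp add: ancestors_single)
next
  case (leaf T u w)
  then show ?case by (simp add: ancestors_add_leaf grown_tree_basic)
qed

lemma ancestors_trans:
  assumes "grown_tree T" "v \<in> verts T" "u \<in> ancestors T v"
  shows "ancestors T u \<subseteq> ancestors T v"
  using assms
proof (induction arbitrary: u v)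
  case (single r)
  then show ?case by (simp add: ancestors_single)
next
  case (leaf T x w)
  show ?case
  proof (cases "u = w")
    case True
    then have "v = w"
      using leaf ancestors_subset[of T v] by (auto simp: ancestors_add_leaf)
    then show ?thesis using True by simp
  next
    case False
    show ?thesis
    proof (cases "v = w")
      case True
      then have "u \<in> ancestors T x" using leaf False by (auto simp: ancestors_add_leaf)
      moreover have "u \<in> verts T" using calculation ancestors_subset by fast
      ultimately show ?thesis using leaf True by (auto simp: ancestors_add_leaf)
    next
      case False
      then have "v \<in> verts T" "u \<in> ancestors T v" using leaf by (auto simp: ancestors_add_leaf)
      moreover have "u \<in> verts T" using calculation ancestors_subset by fast
      ultimately show ?thesis using leaf by (simp add: ancestors_add_leaf)
    qed
  qed
qed

text \<open>
  This is where the graph is a tree: a set of vertices cuts \<open>v\<close> off only if one of its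
  elements does so alone.
\<close>

lemma root_component_delete_vertices:
  assumes "grown_tree T"
  shows "root_component (delete_vertices D T) = {v \<in> verts T. ancestors T v \<inter> D = {}}"
  using assms
proof induction
  case (single r)
  then show ?case
    by (auto simp: root_component_def ancestors_single)
next
  case (leaf T v w)
  note basic = grown_tree_basic[OF leaf(1)]
  show ?case
    using leaf by (auto simp: root_component_add_leaf[OF basic(4) basic(3) leaf(2,3)] Let_def
        ancestors_add_leaf)
qed

text \<open>
  Every edge joins a non-root vertex to its parent. This turns sums weighted by degree, as they
  arise from preferential attachment, into sums over parent-child pairs.
\<close>

lemma degree_sum_by_parent:
  fixes T :: "'v rooted_graph"
  assumes "grown_tree T"
  shows "\<exists>par. (\<forall>c \<in> verts T - {root_vertex T}.
       par c \<in> verts T \<and> c \<notin> ancestors T (par c) \<and> ancestors T c = insert c (ancestors T (par c)))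
     \<and> (\<forall>g :: 'v \<Rightarrow> real. (\<Sum>x\<in>verts T. real (degree T x) * g x) =
       (\<Sum>c\<in>verts T - {root_vertex T}. g c + g (par c)))"
  using assms
proof induction
  case (single r)
  then show ?case by (auto simp: degree_def)
next
  case (leaf T v w)
  note basic = grown_tree_basic[OF leaf(1)]
  let ?T' = "add_leaf w v T" and ?r = "root_vertex T"
  obtain par where par: "\<And>c. c \<in> verts T - {?r} \<Longrightarrow>
     par c \<in> verts T \<and> c \<notin> ancestors T (par c) \<and> ancestors T c = insert c (ancestors T (par c))"
    and deg: "\<And>g :: 'v \<Rightarrow> real. (\<Sum>x\<in>verts T. real (degree T x) * g x) =
     (\<Sum>c\<in>verts T - {?r}. g c + g (par c))"
    using leaf.IH by blast
  have new: "{v, w} \<notin> edges T"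
    using basic(4) leaf(3) by auto
  have degw: "degree ?T' w = 1"
  proof -
    have "{e \<in> edges ?T'. w \<in> e} = {{v, w}}"
      using basic(4) leaf(3) by auto
    then show ?thesis by (simp add: degree_def)
  qed
  have degx: "degree ?T' x = degree T x + (if x = v then 1 else 0)" if "x \<in> verts T" for x
  proof -
    have "{e \<in> edges ?T'. x \<in> e} = (if x = v then insert {v, w} {e \<in> edges T. x \<in> e}
        else {e \<in> edges T. x \<in> e})"
      using that leaf(3) by auto
    then show ?thesis using new basic(2) by (simp add: degree_def)
  qed
  \<comment> \<open>The parent of an old vertex does not change.\<close>
  define par' where "par' = par(w := v)"
  have root: "?r \<noteq> w" using basic(3) leaf(3) by auto
  have 1: "par' c \<in> verts ?T' \<and> c \<notin> ancestors ?T' (par' c) \<and>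
      ancestors ?T' c = insert c (ancestors ?T' (par' c))"
    if "c \<in> verts ?T' - {?r}" for c
  proof (cases "c = w")
    case True
    then show ?thesis
      using leaf(1-3) ancestors_subset[of T v] by (auto simp: par'_def ancestors_add_leaf)
  next
    case False
    then show ?thesis
      using that par[of c] leaf(1-3) by (auto simp: par'_def ancestors_add_leaf)
  qed
  have 2: "(\<Sum>x\<in>verts ?T'. real (degree ?T' x) * g x) =
      (\<Sum>c\<in>verts ?T' - {?r}. g c + g (par' c))" for g :: "'v \<Rightarrow> real"
  proof -
    have "(\<Sum>x\<in>verts ?T'. real (degree ?T' x) * g x) =
        g w + (\<Sum>x\<in>verts T. real (degree ?T' x) * g x)"
      using basic(1) leaf(3) degw by simp
    also have "(\<Sum>x\<in>verts T. real (degree ?T' x) * g x) =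
        (\<Sum>x\<in>verts T. real (degree T x) * g x + (if x = v then g x else 0))"
      by (rule sum.cong) (auto simp: degx algebra_simps)
    also have "\<dots> = (\<Sum>c\<in>verts T - {?r}. g c + g (par c)) + g v"
      using basic(1) leaf(2) by (simp add: sum.distrib deg sum.delta)
    also have "(\<Sum>c\<in>verts T - {?r}. g c + g (par c)) = (\<Sum>c\<in>verts T - {?r}. g c + g (par' c))"
      using leaf(3) by (intro sum.cong) (auto simp: par'_def)
    also have "g w + (\<dots> + g v) = (\<Sum>c\<in>insert w (verts T - {?r}). g c + g (par' c))"
      using basic(1) leaf(3) by (simp add: par'_def)
    also have "insert w (verts T - {?r}) = verts ?T' - {?r}"
      using root by auto
    finally show ?thesis .
  qed
  show ?case
    using 1 2 by (intro exI[of _ par']) auto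
qed

section \<open>Poisson probabilities\<close>

text \<open>
  The probability that a rate-one Poisson clock rings fewer than \<open>j\<close> times up to time \<open>t\<close>.
\<close>

definition surv :: "nat \<Rightarrow> real \<Rightarrow> real" where
  "surv j t = exp (- t) * (\<Sum>i<j. t ^ i / fact i)"

lemma surv_0 [simp]: "surv 0 t = 0"
  by (simp add: surv_def)

lemma surv_Suc: "surv (Suc j) t = surv j t + exp (- t) * (t ^ j / fact j)"
  by (simp add: surv_def algebra_simps)

lemma surv_at_0: "surv j 0 = (if j = 0 then 0 else 1)"
  by (induction j) (auto simp: surv_Suc)

lemma surv_nonneg: "0 \<le> t \<Longrightarrow> 0 \<le> surv j t"
  by (simp add: surv_def sum_nonneg)

lemma surv_pos: "0 \<le> t \<Longrightarrow> 0 < j \<Longrightarrow> exp (- t) \<le> surv j t"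
proof (induction j)
  case (Suc j)
  then show ?case
    by (cases "j = 0") (auto simp: surv_Suc intro!: add_increasing2)
qed simp

lemma surv_le_1: "0 \<le> t \<Longrightarrow> surv j t \<le> 1"
proof -
  assume t: "0 \<le> t"
  have "(\<Sum>i<j. t ^ i / fact i) \<le> (\<Sum>i. t ^ i / fact i)"
    using summable_exp_generic[of t] t
    by (intro sum_le_suminf) (auto simp: divide_inverse_commute scaleR_conv_of_real)
  also have "\<dots> = exp t"
    by (simp add: exp_def divide_inverse_commute scaleR_conv_of_real)
  finally have "exp (- t) * (\<Sum>i<j. t ^ i / fact i) \<le> exp (- t) * exp t"
    by (intro mult_left_mono) auto
  then show ?thesis
    by (simp add: surv_def flip: exp_add)
qed

lemma surv_mono: "0 \<le> t \<Longrightarrow> i \<le> j \<Longrightarrow> surv i t \<le> surv j t"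
  unfolding surv_def by (intro mult_left_mono sum_mono2) auto

lemma power_div_fact_has_derivative:
  "((\<lambda>x::real. x ^ Suc j / fact (Suc j)) has_real_derivative (x ^ j / fact j)) (at x)"
proof -
  have "((\<lambda>x::real. x ^ Suc j / fact (Suc j)) has_real_derivative
      (real (Suc j) * x ^ j / fact (Suc j))) (at x)"
    using DERIV_pow[of "Suc j" x] by (intro DERIV_cdivide) simp
  then show ?thesis
    by (simp add: fact_Suc del: of_nat_Suc)
qed

text \<open>
  The backward equation of the Poisson process. With truncated subtraction it also
  holds for \<open>j = 0\<close>, the state of a removed vertex, where both sides vanish.
\<close>

lemma surv_has_derivative:
  "(surv j has_real_derivative (surv (j - 1) t - surv j t)) (at t)"
proof (induction j)
  case 0
  have "surv 0 = (\<lambda>_. 0)" by (simp add: fun_eq_iff)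
  then show ?case by simp
next
  case (Suc j)
  show ?case
  proof (cases j)
    case 0
    have "surv (Suc 0) = (\<lambda>t. exp (- t))" by (simp add: fun_eq_iff surv_Suc)
    then show ?thesis using 0 by (auto intro!: derivative_eq_intros)
  next
    case (Suc m)
    have "((\<lambda>t. t ^ j / fact j) has_real_derivative t ^ m / fact m) (at t)"
      using power_div_fact_has_derivative Suc by simp
    note [derivative_intros] = DERIV_mult[OF _ this]
    have "surv (Suc j) = (\<lambda>t. surv j t + exp (- t) * (t ^ j / fact j))"
      by (simp add: fun_eq_iff surv_Suc)
    moreover have "((\<lambda>t. surv j t + exp (- t) * (t ^ j / fact j)) has_real_derivative
        (surv (j - 1) t - surv j t) + (exp (- t) * (t ^ m / fact m) - exp (- t) * (t ^ j / fact j))) (at t)"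
      by (rule derivative_eq_intros Suc.IH refl)+ (simp add: algebra_simps)
    ultimately show ?thesis
      by (simp add: Suc surv_Suc)
  qed
qed

lemma continuous_surv [continuous_intros]:
  "continuous_on A f \<Longrightarrow> continuous_on A (\<lambda>x. surv j (f x))"
  unfolding surv_def by (intro continuous_intros) auto

lemma surv_antimono: "0 \<le> s \<Longrightarrow> s \<le> t \<Longrightarrow> surv j t \<le> surv j s"
  by (rule DERIV_nonpos_imp_nonincreasing)
    (use surv_mono[of _ "j - 1" j] surv_has_derivative in \<open>force+\<close>)

text \<open>
  Replacing \<open>t\<close> by \<open>t / 2\<close> in the polynomial costs at most \<open>2 ^ k\<close>, and then half of the
  exponential factor makes it a Poisson probability. Only integrability over \<open>s\<close> and \<open>r\<close> of \<open>surv k (s + r)\<close> is needed, so the constant is immaterial.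
\<close>

lemma surv_exp_bound: "0 \<le> t \<Longrightarrow> surv k t \<le> 2 ^ k * exp (- (t / 2))"
proof -
  assume t: "0 \<le> t"
  have "(\<Sum>i<k. t ^ i / fact i) \<le> (\<Sum>i<k. 2 ^ k * ((t / 2) ^ i / fact i))"
  proof (rule sum_mono)
    fix i assume "i \<in> {..<k}"
    then have "(2::real) ^ i \<le> 2 ^ k" by (intro power_increasing) auto
    then have "2 ^ i * ((t / 2) ^ i / fact i) \<le> 2 ^ k * ((t / 2) ^ i / fact i)"
      using t by (intro mult_right_mono) auto
    then show "t ^ i / fact i \<le> 2 ^ k * ((t / 2) ^ i / fact i)"
      by (simp add: power_divide)
  qed
  also have "\<dots> = 2 ^ k * (\<Sum>i<k. (t / 2) ^ i / fact i)"
    by (simp add: sum_distrib_left)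
  finally have "surv k t \<le> exp (- t) * (2 ^ k * (\<Sum>i<k. (t / 2) ^ i / fact i))"
    unfolding surv_def by (intro mult_left_mono) auto
  also have "exp (- t) = exp (- (t / 2)) * exp (- (t / 2))"
    by (simp flip: exp_add)
  also have "\<dots> * (2 ^ k * (\<Sum>i<k. (t / 2) ^ i / fact i)) = 2 ^ k * exp (- (t / 2)) * surv k (t / 2)"
    by (simp add: surv_def)
  also have "\<dots> \<le> 2 ^ k * exp (- (t / 2)) * 1"
    using surv_le_1[of "t / 2" k] t by (intro mult_left_mono) auto
  finally show ?thesis by simp
qed

lemma surv_tendsto_0: "(surv k \<longlongrightarrow> 0) at_top"
proof (rule real_tendsto_sandwich[of "\<lambda>_. 0" _ _ "\<lambda>t. 2 ^ k * exp (- (t / 2))"])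
  show "\<forall>\<^sub>F t in at_top. 0 \<le> surv k t"
    using eventually_ge_at_top[of 0] by eventually_elim (simp add: surv_nonneg)
  show "\<forall>\<^sub>F t in at_top. surv k t \<le> 2 ^ k * exp (- (t / 2))"
    using eventually_ge_at_top[of 0] by eventually_elim (simp add: surv_exp_bound)
  have "((\<lambda>t::real. exp (- (t / 2))) \<longlongrightarrow> 0) at_top"
    by real_asymp
  then show "((\<lambda>t. 2 ^ k * exp (- (t / 2))) \<longlongrightarrow> (0::real)) at_top"
    using tendsto_mult_right_zero by blast
qed auto

text \<open>
  The difference of the two sides vanishes at \<open>0\<close> and has derivative
  \<open>(1 - exp (- t)) * t ^ (k - 1) / (k - 1)!\<close>.
\<close>

lemma one_minus_surv_le: "0 \<le> t \<Longrightarrow> 1 - surv k t \<le> t ^ k / fact k"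
proof (cases k)
  case (Suc j)
  assume t: "0 \<le> t"
  let ?f = "\<lambda>t. t ^ k / fact k - 1 + surv k t"
  have "?f 0 \<le> ?f t"
  proof (rule DERIV_nonneg_imp_nondecreasing[OF t])
    fix x :: real assume x: "0 \<le> x"
    have "(?f has_real_derivative x ^ j / fact j + (surv (k - 1) x - surv k x)) (at x)"
      using DERIV_add[OF DERIV_diff[OF power_div_fact_has_derivative[of j x] DERIV_const[of 1]]
          surv_has_derivative[of k x]]
      by (simp add: Suc)
    moreover have "x ^ j / fact j + (surv (k - 1) x - surv k x) = (1 - exp (- x)) * (x ^ j / fact j)"
      by (simp add: Suc surv_Suc algebra_simps diff_divide_distrib)
    moreover have "0 \<le> (1 - exp (- x)) * (x ^ j / fact j)"
      using x by (intro mult_nonneg_nonneg) auto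
    ultimately show "\<exists>y. (?f has_real_derivative y) (at x) \<and> 0 \<le> y" by auto
  qed
  then show ?thesis by (simp add: surv_at_0 Suc)
qed simp

text \<open>
  The left-hand side is the probability of exactly \<open>k\<close> rings.
\<close>

lemma one_minus_surv_ge: "0 \<le> t \<Longrightarrow> exp (- t) * (t ^ k / fact k) \<le> 1 - surv k t"
  using surv_le_1[of t "Suc k"] by (simp add: surv_Suc)

section \<open>Exact moments for a fixed tree\<close>

lemma prod_surv_eq_0:
  "finite A \<Longrightarrow> u \<in> A \<Longrightarrow> k \<le> c u \<Longrightarrow> (\<Prod>w\<in>A. surv (k - c w) (f w)) = 0"
  by (rule prod_zero) (auto intro!: bexI[of _ u])

text \<open>
  Integration of \<open>g' = h - N g\<close> over the half-line. Stated without subtraction, it holds in the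
  extended non-negative reals and asks for no integrability.
\<close>

lemma nn_integral_linear_ode:
  fixes g h :: "real \<Rightarrow> real"
  assumes contg: "continuous_on {0..} g" and conth: "continuous_on {0..} h"
    and g0: "\<And>t. 0 \<le> t \<Longrightarrow> 0 \<le> g t" and h0: "\<And>t. 0 \<le> t \<Longrightarrow> 0 \<le> h t" and N: "0 \<le> N"
    and deriv: "\<And>t. 0 \<le> t \<Longrightarrow> (g has_real_derivative h t - N * g t) (at t)"
    and lim: "(g \<longlongrightarrow> 0) at_top"
  shows "ennreal N * (\<integral>\<^sup>+t\<in>{0..}. ennreal (g t) \<partial>lborel) =
    ennreal (g 0) + (\<integral>\<^sup>+t\<in>{0..}. ennreal (h t) \<partial>lborel)"
proof -
  have meas: "(\<lambda>t. ennreal (f t) * indicator {0..b} t) \<in> borel_measurable lborel"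
    if "continuous_on {0..} f" for f :: "real \<Rightarrow> real" and b
  proof -
    have "(\<lambda>t. indicator {0..b} t *\<^sub>R f t) \<in> borel_measurable borel"
      using continuous_on_subset[OF that, of "{0..b}"]
      by (intro borel_measurable_continuous_on_indicator) auto
    then have "(\<lambda>t. ennreal (indicator {0..b} t *\<^sub>R f t)) \<in> borel_measurable borel"
      by measurable
    moreover have "(\<lambda>t. ennreal (indicator {0..b} t *\<^sub>R f t)) = (\<lambda>t. ennreal (f t) * indicator {0..b} t)"
      by (auto simp: fun_eq_iff indicator_def)
    ultimately show ?thesis by simp
  qed
  have conv: "(\<lambda>n. \<integral>\<^sup>+t\<in>{0..real n}. ennreal (f t) \<partial>lborel) \<longlonglongrightarrow> (\<integral>\<^sup>+t\<in>{0..}. ennreal (f t) \<partial>lborel)"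
    if "continuous_on {0..} f" for f :: "real \<Rightarrow> real"
  proof (rule nn_integral_LIMSEQ)
    show "(\<lambda>t. ennreal (f t) * indicator {0..real n} t) \<in> borel_measurable lborel" for n
      by (rule meas[OF that])
    show "incseq (\<lambda>n t. ennreal (f t) * indicator {0..real n} t)"
      by (auto simp: incseq_def le_fun_def split: split_indicator)
    show "(\<lambda>n. ennreal (f t) * indicator {0..real n} t) \<longlonglongrightarrow> ennreal (f t) * indicator {0..} t" for t
    proof (rule tendsto_eventually)
      show "\<forall>\<^sub>F n in sequentially. ennreal (f t) * indicator {0..real n} t = ennreal (f t) * indicator {0..} t"
        using eventually_ge_at_top[of "nat \<lceil>t\<rceil>"]
        by eventually_elim (auto split: split_indicator simp: nat_ceiling_le_eq)
    qed
  qed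
  have fin: "ennreal N * (\<integral>\<^sup>+t\<in>{0..real n}. ennreal (g t) \<partial>lborel) + ennreal (g (real n)) =
      ennreal (g 0) + (\<integral>\<^sup>+t\<in>{0..real n}. ennreal (h t) \<partial>lborel)" for n
  proof -
    let ?I = "{0..real n}"
    have cg: "continuous_on ?I g" and ch: "continuous_on ?I h"
      using contg conth by (auto intro: continuous_on_subset)
    have ig: "(g has_integral integral ?I g) ?I" and ih: "(h has_integral integral ?I h) ?I"
      using cg ch by (auto intro!: integrable_integral integrable_continuous_interval)
    have "((\<lambda>t. h t - N * g t) has_integral (g (real n) - g 0)) ?I"
      by (rule fundamental_theorem_of_calculus)
        (auto intro!: has_field_derivative_at_within deriv simp flip: has_real_derivative_iff_has_vector_derivative)
    moreover have "((\<lambda>t. h t - N * g t) has_integral (integral ?I h - N * integral ?I g)) ?I"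
      by (intro has_integral_diff ih has_integral_mult_right ig)
    ultimately have "g (real n) - g 0 = integral ?I h - N * integral ?I g"
      by (rule has_integral_unique)
    then have eq: "N * integral ?I g + g (real n) = g 0 + integral ?I h"
      by simp
    have pos: "0 \<le> integral ?I g" "0 \<le> integral ?I h"
      using has_integral_nonneg[OF ig] has_integral_nonneg[OF ih] g0 h0 by auto
    have "(\<integral>\<^sup>+t\<in>?I. ennreal (g t) \<partial>lborel) = ennreal (integral ?I g)"
      "(\<integral>\<^sup>+t\<in>?I. ennreal (h t) \<partial>lborel) = ennreal (integral ?I h)"
      using nn_integral_has_integral_lebesgue'[OF _ ig] nn_integral_has_integral_lebesgue'[OF _ ih]
        g0 h0 by auto
    then show ?thesis
      using eq pos N g0[of 0] g0[of "real n"] by (simp flip: ennreal_mult ennreal_plus)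
  qed
  have "(\<lambda>n. ennreal (g (real n))) \<longlonglongrightarrow> ennreal 0"
    by (intro tendsto_ennrealI filterlim_compose[OF lim filterlim_real_sequentially])
  then have "(\<lambda>n. ennreal N * (\<integral>\<^sup>+t\<in>{0..real n}. ennreal (g t) \<partial>lborel) + ennreal (g (real n)))
      \<longlonglongrightarrow> ennreal N * (\<integral>\<^sup>+t\<in>{0..}. ennreal (g t) \<partial>lborel) + ennreal 0"
    by (intro tendsto_add ennreal_tendsto_cmult conv contg) auto
  moreover have "(\<lambda>n. ennreal (g 0) + (\<integral>\<^sup>+t\<in>{0..real n}. ennreal (h t) \<partial>lborel))
      \<longlonglongrightarrow> ennreal (g 0) + (\<integral>\<^sup>+t\<in>{0..}. ennreal (h t) \<partial>lborel)"
    by (intro tendsto_add tendsto_const conv conth)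
  ultimately show ?thesis
    unfolding fin using LIMSEQ_unique by fastforce
qed

text \<open>
  The root component once each vertex \<open>v\<close> has been cut \<open>c v\<close> times, see \<open>k_cuts_from_delete\<close>.
\<close>

definition survivors :: "nat \<Rightarrow> 'v rooted_graph \<Rightarrow> ('v \<Rightarrow> nat) \<Rightarrow> 'v set" where
  "survivors k T c = {v \<in> verts T. \<forall>u\<in>ancestors T v. c u < k}"

text \<open>
  The common form of the expectations below. Vertex \<open>w\<close> belongs to the \<open>i\<close>-th event if it must survive,
  and the delay \<open>d i w\<close> lets different vertices be inspected at different times.
\<close>

definition surv_sum :: "nat \<Rightarrow> 'i set \<Rightarrow> ('i \<Rightarrow> 'v set) \<Rightarrow> ('i \<Rightarrow> 'v \<Rightarrow> real) \<Rightarrow> ('v \<Rightarrow> nat) \<Rightarrow> real \<Rightarrow> real" where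
  "surv_sum k I A d c s = (\<Sum>i\<in>I. \<Prod>w\<in>A i. surv (k - c w) (s + d i w))"

text \<open>
  By the backward equation and the product rule, the time derivative of \<open>surv_sum\<close> is the sum, over
  all vertices \<open>w\<close>, of the change caused by cutting \<open>w\<close> once. A vertex \<open>w\<close> outside the root component
  changes nothing: every \<open>A i\<close> that contains \<open>w\<close> also contains a dead ancestor of \<open>w\<close>, so
  that product is zero before and after. Integrating over time gives the first-step recursion for a uniform
  choice from the root component. The root lies in every \<open>A i\<close>, which makes everything decay.
\<close>

lemma surv_sum_generator:
  fixes T :: "'v rooted_graph"
  assumes T: "grown_tree T" and I: "finite I"
    and A: "\<And>i. i \<in> I \<Longrightarrow> A i \<subseteq> verts T" "\<And>i. i \<in> I \<Longrightarrow> root_vertex T \<in> A i"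
      "\<And>i w. i \<in> I \<Longrightarrow> w \<in> A i \<Longrightarrow> ancestors T w \<subseteq> A i"
    and d: "\<And>i w. i \<in> I \<Longrightarrow> 0 \<le> d i w"
  shows "of_nat (card (survivors k T c)) * (\<integral>\<^sup>+s\<in>{0..}. ennreal (surv_sum k I A d c s) \<partial>lborel) =
    ennreal (surv_sum k I A d c 0) +
    (\<Sum>w\<in>survivors k T c. \<integral>\<^sup>+s\<in>{0..}. ennreal (surv_sum k I A d (c(w := c w + 1)) s) \<partial>lborel)"
proof -
  let ?C = "survivors k T c" and ?H = "surv_sum k I A d"
  let ?c = "\<lambda>w. c(w := c w + 1)"
  have finV: "finite (verts T)" using grown_tree_basic(1)[OF T] .
  have finC: "finite ?C" using finV by (simp add: survivors_def)
  have finA: "finite (A i)" if "i \<in> I" for i using A(1)[OF that] finV finite_subset by blast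
  have H0: "0 \<le> ?H c s" if "0 \<le> s" for c s
    unfolding surv_sum_def using that d by (intro sum_nonneg prod_nonneg) (auto intro!: surv_nonneg)
  have cont: "continuous_on {0..} (?H c)" for c
    unfolding surv_sum_def by (intro continuous_intros)
  have deriv: "(?H c has_real_derivative (\<Sum>w\<in>?C. ?H (?c w) s) - real (card ?C) * ?H c s) (at s)" for s
  proof -
    let ?p = "\<lambda>i c. \<Prod>w\<in>A i. surv (k - c w) (s + d i w)"
    have term_deriv: "((\<lambda>s. \<Prod>w\<in>A i. surv (k - c w) (s + d i w)) has_real_derivative
        (\<Sum>w\<in>?C. ?p i (?c w) - ?p i c)) (at s)" if i: "i \<in> I" for i
    proof -
      have single: "((\<lambda>s. surv (k - c w) (s + d i w)) has_real_derivative
          (surv (k - c w - 1) (s + d i w) - surv (k - c w) (s + d i w))) (at s)" for w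
        using surv_has_derivative[of "k - c w" "s + d i w"] by (simp add: DERIV_shift)
      have "((\<lambda>s. \<Prod>w\<in>A i. surv (k - c w) (s + d i w)) has_real_derivative
          (\<Sum>w\<in>A i. (surv (k - c w - 1) (s + d i w) - surv (k - c w) (s + d i w)) *
             (\<Prod>u\<in>A i - {w}. surv (k - c u) (s + d i u)))) (at s)"
        by (intro has_field_derivative_prod single)
      also have "(\<Sum>w\<in>A i. (surv (k - c w - 1) (s + d i w) - surv (k - c w) (s + d i w)) *
             (\<Prod>u\<in>A i - {w}. surv (k - c u) (s + d i u))) = (\<Sum>w\<in>A i. ?p i (?c w) - ?p i c)"
      proof (rule sum.cong[OF refl])
        fix w assume w: "w \<in> A i"
        have "?p i f = surv (k - f w) (s + d i w) * (\<Prod>u\<in>A i - {w}. surv (k - f u) (s + d i u))" for f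
          using finA[OF i] w by (rule prod.remove)
        moreover have "(\<Prod>u\<in>A i - {w}. surv (k - ?c w u) (s + d i u)) =
            (\<Prod>u\<in>A i - {w}. surv (k - c u) (s + d i u))"
          by (rule prod.cong) auto
        ultimately show "(surv (k - c w - 1) (s + d i w) - surv (k - c w) (s + d i w)) *
             (\<Prod>u\<in>A i - {w}. surv (k - c u) (s + d i u)) = ?p i (?c w) - ?p i c"
          by (simp add: algebra_simps)
      qed
      also have "\<dots> = (\<Sum>w\<in>verts T. ?p i (?c w) - ?p i c)"
      proof (rule sum.mono_neutral_left[OF finV A(1)[OF i]], intro ballI)
        fix w assume w: "w \<in> verts T - A i"
        have "?p i (?c w) = ?p i c"
          using w by (intro prod.cong) auto
        then show "?p i (?c w) - ?p i c = 0" by simp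
      qed
      also have "\<dots> = (\<Sum>w\<in>?C. ?p i (?c w) - ?p i c)"
      proof (rule sum.mono_neutral_right[OF finV], force simp: survivors_def, intro ballI)
        fix w assume w: "w \<in> verts T - ?C"
        then obtain u where u: "u \<in> ancestors T w" "k \<le> c u"
          by (auto simp: survivors_def not_less)
        show "?p i (?c w) - ?p i c = 0"
        proof (cases "w \<in> A i")
          case True
          then have "u \<in> A i" using A(3)[OF i] u by auto
          moreover have "k \<le> ?c w u" "k \<le> c u"
            using u by auto
          ultimately have "?p i (?c w) = 0" "?p i c = 0"
            by (auto intro!: prod_surv_eq_0 finA[OF i])
          then show ?thesis by simp
        next
          case False
          then have "?p i (?c w) = ?p i c"
            by (intro prod.cong) auto
          then show ?thesis by simp
        qed
      qed
      finally show ?thesis .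
    qed
    have "(?H c has_real_derivative (\<Sum>i\<in>I. \<Sum>w\<in>?C. ?p i (?c w) - ?p i c)) (at s)"
      unfolding surv_sum_def by (rule DERIV_sum) (rule term_deriv)
    also have "(\<Sum>i\<in>I. \<Sum>w\<in>?C. ?p i (?c w) - ?p i c) = (\<Sum>w\<in>?C. ?H (?c w) s - ?H c s)"
      unfolding surv_sum_def by (subst sum.swap) (simp add: sum_subtractf)
    finally show ?thesis
      by (simp add: sum_subtractf)
  qed
  have bound: "?H c s \<le> real (card I) * surv k s" if s: "0 \<le> s" for s
  proof -
    have "(\<Prod>w\<in>A i. surv (k - c w) (s + d i w)) \<le> surv k s" if i: "i \<in> I" for i
    proof -
      let ?r = "root_vertex T"
      have "(\<Prod>w\<in>A i. surv (k - c w) (s + d i w)) =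
          surv (k - c ?r) (s + d i ?r) * (\<Prod>w\<in>A i - {?r}. surv (k - c w) (s + d i w))"
        using finA[OF i] A(2)[OF i] by (rule prod.remove)
      also have "\<dots> \<le> surv (k - c ?r) (s + d i ?r) * 1"
        using s d[OF i] by (intro mult_left_mono prod_le_1) (auto intro!: surv_nonneg surv_le_1)
      also have "\<dots> \<le> surv k (s + d i ?r)"
        using s d[OF i, of ?r] by (auto intro!: surv_mono)
      also have "\<dots> \<le> surv k s"
        using s d[OF i, of ?r] by (auto intro!: surv_antimono)
      finally show ?thesis .
    qed
    then have "?H c s \<le> (\<Sum>i\<in>I. surv k s)"
      unfolding surv_sum_def by (rule sum_mono)
    then show ?thesis by simp
  qed
  have lim: "(?H c \<longlongrightarrow> 0) at_top"
  proof (rule real_tendsto_sandwich[of "\<lambda>_. 0" _ _ "\<lambda>s. real (card I) * surv k s"])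
    show "\<forall>\<^sub>F t in at_top. 0 \<le> ?H c t"
      using eventually_ge_at_top[of 0] by eventually_elim (rule H0)
    show "\<forall>\<^sub>F t in at_top. ?H c t \<le> real (card I) * surv k t"
      using eventually_ge_at_top[of 0] by eventually_elim (rule bound)
    show "((\<lambda>s. real (card I) * surv k s) \<longlongrightarrow> 0) at_top"
      using surv_tendsto_0 tendsto_mult_right_zero by blast
  qed auto
  have "ennreal (real (card ?C)) * (\<integral>\<^sup>+s\<in>{0..}. ennreal (?H c s) \<partial>lborel) =
      ennreal (?H c 0) + (\<integral>\<^sup>+s\<in>{0..}. ennreal (\<Sum>w\<in>?C. ?H (?c w) s) \<partial>lborel)"
    by (rule nn_integral_linear_ode)
      (auto intro!: cont lim deriv[simplified] H0 sum_nonneg continuous_on_sum)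
  also have "(\<integral>\<^sup>+s\<in>{0..}. ennreal (\<Sum>w\<in>?C. ?H (?c w) s) \<partial>lborel) =
      (\<integral>\<^sup>+s. (\<Sum>w\<in>?C. ennreal (?H (?c w) s) * indicator {0..} s) \<partial>lborel)"
    by (rule nn_integral_cong)
      (auto simp: sum_ennreal H0 simp flip: sum_distrib_right split: split_indicator)
  also have "\<dots> = (\<Sum>w\<in>?C. \<integral>\<^sup>+s\<in>{0..}. ennreal (?H (?c w) s) \<partial>lborel)"
  proof (rule nn_integral_sum)
    fix w
    have "continuous_on UNIV (?H (?c w))"
      unfolding surv_sum_def by (intro continuous_intros)
    then have "?H (?c w) \<in> borel_measurable borel"
      by (rule borel_measurable_continuous_onI)
    then show "(\<lambda>s. ennreal (?H (?c w) s) * indicator {0..} s) \<in> borel_measurable lborel"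
      by measurable
  qed
  finally show ?thesis
    by (simp add: ennreal_of_nat_eq_real_of_nat)
qed

text \<open>
  The cut counts alone determine what is left of the tree, so they can serve as the state of the procedure.
\<close>

lemma k_cuts_from_delete:
  fixes T :: "'v rooted_graph" and k :: nat
  assumes T: "grown_tree T"
  defines "G \<equiv> \<lambda>c. delete_vertices {u \<in> verts T. k \<le> c u} T"
  shows "k_cuts_from k (G c) c =
    (if survivors k T c = {} then return_pmf 0
     else pmf_of_set (survivors k T c) \<bind> (\<lambda>v. map_pmf Suc (k_cuts_from k (G (c(v := c v + 1))) (c(v := c v + 1)))))"
proof -
  note basic = grown_tree_basic[OF T]
  let ?r = "root_vertex T"
  have rc: "root_component (G c) = survivors k T c"
    using ancestors_subset[of T]
    by (auto simp: G_def root_component_delete_vertices[OF T] survivors_def not_le[symmetric])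
  have root: "?r \<in> verts (G c) \<longleftrightarrow> survivors k T c \<noteq> {}"
  proof
    assume "?r \<in> verts (G c)"
    then have "?r \<in> survivors k T c"
      by (auto simp: G_def survivors_def ancestors_root[OF T])
    then show "survivors k T c \<noteq> {}" by auto
  next
    assume "survivors k T c \<noteq> {}"
    then show "?r \<in> verts (G c)"
      using root_ancestor[OF T] basic(3) by (force simp: G_def survivors_def)
  qed
  have fin: "finite (verts (G c))" "finite (survivors k T c)"
    using basic(1) by (auto simp: G_def survivors_def)
  have rv: "root_vertex (G c) = ?r" by (simp add: G_def)
  show ?thesis
  proof (cases "survivors k T c = {}")
    case True
    then show ?thesis
      using root rv by (subst k_cuts_from.simps) simp
  next
    case False
    have "k_cuts_from k (G c) c = pmf_of_set (survivors k T c) \<bind> (\<lambda>v.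
        let c' = c(v := c v + 1); G' = (if k \<le> c' v then remove_vertex v (G c) else G c)
        in k_cuts_from k G' c' \<bind> (\<lambda>m. return_pmf (m + 1)))"
      using False fin root rc rv by (subst k_cuts_from.simps) simp
    also have "\<dots> = pmf_of_set (survivors k T c) \<bind> (\<lambda>v. map_pmf Suc (k_cuts_from k (G (c(v := c v + 1))) (c(v := c v + 1))))"
    proof (rule bind_pmf_cong[OF refl])
      fix v assume "v \<in> set_pmf (pmf_of_set (survivors k T c))"
      then have v: "v \<in> verts T" "c v < k"
        using False fin self_in_ancestors[of v T] by (auto simp: survivors_def)
      let ?c = "c(v := c v + 1)"
      have "(if k \<le> ?c v then remove_vertex v (G c) else G c) = G ?c"
      proof (cases "k \<le> ?c v")
        case True
        then have "insert v {u \<in> verts T. k \<le> c u} = {u \<in> verts T. k \<le> ?c u}"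
          using v by auto
        then show ?thesis
          using True by (simp add: G_def delete_vertices_insert)
      next
        case False
        then have "{u \<in> verts T. k \<le> c u} = {u \<in> verts T. k \<le> ?c u}"
          using v by auto
        then show ?thesis
          using False by (simp add: G_def)
      qed
      then show "(let c' = c(v := c v + 1); G' = (if k \<le> c' v then remove_vertex v (G c) else G c)
        in k_cuts_from k G' c' \<bind> (\<lambda>m. return_pmf (m + 1))) =
        map_pmf Suc (k_cuts_from k (G ?c) ?c)"
        by (simp add: Let_def map_pmf_def)
    qed
    finally show ?thesis using False by simp
  qed
qed

text \<open>
  A survivor has been cut fewer than \<open>k\<close> times, so each cut uses up one of finitely many.
\<close>

lemma cuts_induct [consumes 1, case_names step]:
  fixes c :: "'v \<Rightarrow> nat"
  assumes "grown_tree T"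
    and "\<And>c. (\<And>w. w \<in> survivors k T c \<Longrightarrow> P (c(w := c w + 1))) \<Longrightarrow> P c"
  shows "P c"
proof (induction "\<Sum>v\<in>verts T. k - c v" arbitrary: c rule: less_induct)
  case less
  show ?case
  proof (rule assms(2), rule less)
    fix w assume "w \<in> survivors k T c"
    then have w: "w \<in> verts T" "c w < k"
      using self_in_ancestors[of w T] by (auto simp: survivors_def)
    show "(\<Sum>v\<in>verts T. k - (c(w := c w + 1)) v) < (\<Sum>v\<in>verts T. k - c v)"
      using grown_tree_basic(1)[OF assms(1)] w
      by (intro sum_strict_mono_ex1) auto
  qed
qed

lemma card_survivors:
  assumes T: "grown_tree T"
  shows "(\<Sum>v\<in>verts T. \<Prod>u\<in>ancestors T v. surv (k - c u) 0) = real (card (survivors k T c))"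
proof -
  have "(\<Prod>u\<in>ancestors T v. surv (k - c u) 0) = (if v \<in> survivors k T c then 1 else 0)"
    if v: "v \<in> verts T" for v
  proof (cases "v \<in> survivors k T c")
    case True
    then have "(\<Prod>u\<in>ancestors T v. surv (k - c u) 0) = (\<Prod>u\<in>ancestors T v. 1)"
      by (intro prod.cong) (auto simp: survivors_def surv_at_0 not_less)
    then show ?thesis using True by simp
  next
    case False
    then show ?thesis
      using v finite_ancestors[OF T, of v] by (auto simp: survivors_def surv_at_0 not_less)
  qed
  then have "(\<Sum>v\<in>verts T. \<Prod>u\<in>ancestors T v. surv (k - c u) 0) =
      (\<Sum>v\<in>verts T. if v \<in> survivors k T c then 1 else 0)"
    by (intro sum.cong) auto
  also have "\<dots> = real (card (survivors k T c))"
    using grown_tree_basic(1)[OF T] by (simp add: sum.If_cases survivors_def Int_def)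
  finally show ?thesis .
qed

text \<open>
  First-step analysis for the number of cuts, cleared of the denominator \<open>card C\<close>.
\<close>

lemma nn_integral_Suc_sum_pmf_of_set:
  fixes M :: "'v \<Rightarrow> nat pmf" and f g :: "nat \<Rightarrow> ennreal"
  assumes C: "finite C" "C \<noteq> {}" and fg: "\<And>m. f (Suc m) = f m + g m"
    and J: "of_nat (card C) * J = (\<Sum>w\<in>C. \<integral>\<^sup>+m. g m \<partial>M w) + (\<Sum>w\<in>C. \<integral>\<^sup>+m. f m \<partial>M w)"
  shows "(\<integral>\<^sup>+m. f m \<partial>measure_pmf (pmf_of_set C \<bind> (\<lambda>v. map_pmf Suc (M v)))) = J"
proof -
  have "(\<integral>\<^sup>+m. f m \<partial>measure_pmf (pmf_of_set C \<bind> (\<lambda>v. map_pmf Suc (M v)))) =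
      (\<Sum>w\<in>C. \<integral>\<^sup>+m. f (Suc m) \<partial>M w) / of_nat (card C)"
    using C by (simp add: nn_integral_pmf_of_set ennreal_of_nat_eq_real_of_nat)
  also have "(\<Sum>w\<in>C. \<integral>\<^sup>+m. f (Suc m) \<partial>M w) = J * of_nat (card C)"
    using J by (simp add: fg nn_integral_add sum.distrib ac_simps)
  also have "J * of_nat (card C) / of_nat (card C) = J"
    using C by (intro ennreal_mult_divide_eq) (auto simp: ennreal_of_nat_eq_real_of_nat)
  finally show ?thesis .
qed

text \<open>
  The expected size of the root component after time \<open>t\<close>, started from the cut counts \<open>c\<close>.
\<close>

definition survival_mass :: "nat \<Rightarrow> 'v rooted_graph \<Rightarrow> ('v \<Rightarrow> nat) \<Rightarrow> real \<Rightarrow> real" where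
  "survival_mass k T c t = (\<Sum>v\<in>verts T. \<Prod>u\<in>ancestors T v. surv (k - c u) t)"

text \<open>
  For \<open>s \<le> t\<close>, the expected product of the sizes of the root component at times \<open>s\<close> and \<open>t\<close>: common
  ancestors of \<open>u\<close> and \<open>v\<close> have to survive up to the later time.
\<close>

definition pair_survival_mass ::
    "nat \<Rightarrow> 'v rooted_graph \<Rightarrow> ('v \<Rightarrow> nat) \<Rightarrow> real \<Rightarrow> real \<Rightarrow> real" where
  "pair_survival_mass k T c s t = (\<Sum>(u, v)\<in>verts T \<times> verts T.
     (\<Prod>w\<in>ancestors T v. surv (k - c w) t) * (\<Prod>w\<in>ancestors T u - ancestors T v. surv (k - c w) s))"

lemma survivors_empty_mass:
  assumes T: "grown_tree T" and "survivors k T c = {}"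
  shows "survival_mass k T c t = 0" "pair_survival_mass k T c s t = 0"
proof -
  have *: "(\<Prod>u\<in>ancestors T v. surv (k - c u) t) = 0" if v: "v \<in> verts T" for v t
  proof -
    obtain u where "u \<in> ancestors T v" "k \<le> c u"
      using v assms(2) by (auto simp: survivors_def not_less)
    then show ?thesis
      by (intro prod_surv_eq_0 finite_ancestors[OF T])
  qed
  then show "survival_mass k T c t = 0" "pair_survival_mass k T c s t = 0"
    by (auto simp: survival_mass_def pair_survival_mass_def intro!: sum.neutral)
qed

text \<open>
  Cuts occur at a rate equal to the size of the root component.
\<close>

theorem k_cuts_mean:
  assumes T: "grown_tree T"
  shows "(\<integral>\<^sup>+m. of_nat m \<partial>k_cuts_from k (delete_vertices {u \<in> verts T. k \<le> c u} T) c) =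
    (\<integral>\<^sup>+t\<in>{0..}. ennreal (survival_mass k T c t) \<partial>lborel)"
  using T
proof (induction c rule: cuts_induct[where k = k])
  case (step c)
  let ?C = "survivors k T c" and ?c = "\<lambda>w. c(w := c w + 1)"
  let ?M = "\<lambda>c. k_cuts_from k (delete_vertices {u \<in> verts T. k \<le> c u} T) c"
  have fin: "finite ?C" using grown_tree_basic(1)[OF T] by (simp add: survivors_def)
  have mass: "survival_mass k T c = surv_sum k (verts T) (ancestors T) (\<lambda>_ _. 0) c" for c
    by (simp add: survival_mass_def surv_sum_def fun_eq_iff)
  show ?case
  proof (cases "?C = {}")
    case True
    then show ?thesis
      using survivors_empty_mass(1)[OF T True]
      by (subst k_cuts_from_delete[OF T]) simp
  next
    case False
    have "of_nat (card ?C) * (\<integral>\<^sup>+t\<in>{0..}. ennreal (survival_mass k T c t) \<partial>lborel) =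
        ennreal (survival_mass k T c 0) +
        (\<Sum>w\<in>?C. \<integral>\<^sup>+t\<in>{0..}. ennreal (survival_mass k T (?c w) t) \<partial>lborel)"
      unfolding mass
      by (rule surv_sum_generator[OF T])
        (use grown_tree_basic[OF T] ancestors_subset[of T] ancestors_trans[OF T] root_ancestor[OF T] in auto)
    also have "survival_mass k T c 0 = real (card ?C)"
      unfolding survival_mass_def by (rule card_survivors[OF T])
    also have "(\<Sum>w\<in>?C. \<integral>\<^sup>+t\<in>{0..}. ennreal (survival_mass k T (?c w) t) \<partial>lborel) =
        (\<Sum>w\<in>?C. \<integral>\<^sup>+m. of_nat m \<partial>?M (?c w))"
      by (rule sum.cong[OF refl]) (rule step[symmetric])
    finally have J: "of_nat (card ?C) * (\<integral>\<^sup>+t\<in>{0..}. ennreal (survival_mass k T c t) \<partial>lborel) =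
        (\<Sum>w\<in>?C. \<integral>\<^sup>+m. 1 \<partial>?M (?c w)) + (\<Sum>w\<in>?C. \<integral>\<^sup>+m. of_nat m \<partial>?M (?c w))"
      by (simp add: ennreal_of_nat_eq_real_of_nat measure_pmf.emeasure_space_1)
    have "(\<integral>\<^sup>+m. of_nat m \<partial>measure_pmf (pmf_of_set ?C \<bind> (\<lambda>v. map_pmf Suc (?M (?c v))))) =
        (\<integral>\<^sup>+t\<in>{0..}. ennreal (survival_mass k T c t) \<partial>lborel)"
      by (rule nn_integral_Suc_sum_pmf_of_set[OF fin False _ J]) simp
    then show ?thesis
      using False by (subst k_cuts_from_delete[OF T]) simp
  qed
qed

text \<open>
  For a fixed lag \<open>r\<close> between the two times, the ancestors of \<open>v\<close> are inspected with delay \<open>r\<close> and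
  the others without.
\<close>

lemma pair_survival_mass_conv_surv_sum:
  assumes T: "grown_tree T"
  shows "pair_survival_mass k T c s (s + r) =
    surv_sum k (verts T \<times> verts T) (\<lambda>(u, v). ancestors T v \<union> ancestors T u)
      (\<lambda>(u, v) w. if w \<in> ancestors T v then r else 0) c s"
  unfolding pair_survival_mass_def surv_sum_def
proof (rule sum.cong[OF refl], clarsimp)
  fix u v
  have fin: "finite (ancestors T v)" "finite (ancestors T u - ancestors T v)"
    using finite_ancestors[OF T] by auto
  have "ancestors T v \<union> ancestors T u = ancestors T v \<union> (ancestors T u - ancestors T v)"
    by auto
  also have "(\<Prod>w\<in>\<dots>. surv (k - c w) (s + (if w \<in> ancestors T v then r else 0))) =
      (\<Prod>w\<in>ancestors T v. surv (k - c w) (s + (if w \<in> ancestors T v then r else 0))) *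
      (\<Prod>w\<in>ancestors T u - ancestors T v. surv (k - c w) (s + (if w \<in> ancestors T v then r else 0)))"
    using fin by (intro prod.union_disjoint) auto
  also have "\<dots> = (\<Prod>w\<in>ancestors T v. surv (k - c w) (s + r)) *
      (\<Prod>w\<in>ancestors T u - ancestors T v. surv (k - c w) s)"
    by (intro arg_cong2[of _ _ _ _ times] prod.cong) auto
  finally show "(\<Prod>w\<in>ancestors T v. surv (k - c w) (s + r)) *
      (\<Prod>w\<in>ancestors T u - ancestors T v. surv (k - c w) s) =
      (\<Prod>w\<in>ancestors T v \<union> ancestors T u. surv (k - c w) (s + (if w \<in> ancestors T v then r else 0)))"
    by simp
qed

text \<open>
  At time \<open>0\<close> the size of the root component is known.
\<close>

lemma pair_survival_mass_0:
  assumes T: "grown_tree T"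
  shows "pair_survival_mass k T c 0 r = real (card (survivors k T c)) * survival_mass k T c r"
proof -
  have "pair_survival_mass k T c 0 r =
      (\<Sum>(u, v)\<in>verts T \<times> verts T. (\<Prod>w\<in>ancestors T u. surv (k - c w) 0) * (\<Prod>w\<in>ancestors T v. surv (k - c w) r))"
    unfolding pair_survival_mass_def
  proof (rule sum.cong[OF refl], simp only: split_paired_all prod.case)
    fix u v
    let ?p = "\<lambda>A. \<Prod>w\<in>A. surv (k - c w) 0"
    have fin: "finite (ancestors T x)" for x
      using finite_ancestors[OF T] .
    show "(\<Prod>w\<in>ancestors T v. surv (k - c w) r) * ?p (ancestors T u - ancestors T v) =
        ?p (ancestors T u) * (\<Prod>w\<in>ancestors T v. surv (k - c w) r)"
    proof (cases "\<exists>w\<in>ancestors T v. k \<le> c w")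
      case True
      then have "(\<Prod>w\<in>ancestors T v. surv (k - c w) r) = 0"
        by (auto intro!: prod_surv_eq_0 fin)
      then show ?thesis by simp
    next
      case False
      have "?p (ancestors T u) = ?p (ancestors T u - ancestors T v) * ?p (ancestors T u \<inter> ancestors T v)"
        using prod.union_disjoint[of "ancestors T u - ancestors T v" "ancestors T u \<inter> ancestors T v"] fin
        by (metis (no_types, lifting) Int_Diff_disjoint Int_commute Un_Diff_Int finite_Diff finite_Int)
      also have "?p (ancestors T u \<inter> ancestors T v) = 1"
        using False by (intro prod.neutral) (auto simp: surv_at_0)
      finally show ?thesis by simp
    qed
  qed
  also have "\<dots> = (\<Sum>u\<in>verts T. \<Prod>w\<in>ancestors T u. surv (k - c w) 0) * survival_mass k T c r"
    by (simp add: survival_mass_def sum_product sum.cartesian_product)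
  finally show ?thesis
    by (simp add: card_survivors[OF T])
qed

lemma continuous_pair_survival_mass:
  "continuous_on A f \<Longrightarrow> continuous_on A g \<Longrightarrow> continuous_on A (\<lambda>x. pair_survival_mass k T c (f x) (g x))"
  unfolding pair_survival_mass_def split_def by (intro continuous_intros)

lemma measurable_pair_survival_mass [measurable]:
  "(\<lambda>(r, s). pair_survival_mass k T c s (s + r)) \<in> borel_measurable (lborel \<Otimes>\<^sub>M lborel)"
proof -
  have "(\<lambda>(r, s). pair_survival_mass k T c s (s + r)) \<in> borel_measurable (borel :: (real \<times> real) measure)"
    unfolding split_def
    by (intro borel_measurable_continuous_onI continuous_pair_survival_mass continuous_intros)
  then show ?thesis by (simp add: lborel_prod)
qed

text \<open>
  For each lag \<open>r\<close> the inner integral obeys the recursion \<open>surv_sum_generator\<close> with inhomogeneity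
  \<open>pair_survival_mass k T c 0 r\<close>. Integrated over \<open>r\<close>, the inhomogeneity becomes the first moment, in
  accordance with \<open>(m + 1) (m + 2) = m (m + 1) + 2 (m + 1)\<close>. The factor two accounts for
  the two orders of the times.
\<close>

theorem k_cuts_second_moment:
  assumes T: "grown_tree T"
  shows "(\<integral>\<^sup>+m. of_nat (m * Suc m) \<partial>k_cuts_from k (delete_vertices {u \<in> verts T. k \<le> c u} T) c) =
    2 * (\<integral>\<^sup>+r\<in>{0..}. (\<integral>\<^sup>+s\<in>{0..}. ennreal (pair_survival_mass k T c s (s + r)) \<partial>lborel) \<partial>lborel)"
  using T
proof (induction c rule: cuts_induct[where k = k])
  case (step c)
  let ?C = "survivors k T c" and ?c = "\<lambda>w. c(w := c w + 1)"
  let ?M = "\<lambda>c. k_cuts_from k (delete_vertices {u \<in> verts T. k \<le> c u} T) c"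
  let ?q = "\<lambda>c r. \<integral>\<^sup>+s\<in>{0..}. ennreal (pair_survival_mass k T c s (s + r)) \<partial>lborel"
  have fin: "finite ?C" using grown_tree_basic(1)[OF T] by (simp add: survivors_def)
  have meas [measurable]: "?q c \<in> borel_measurable lborel" for c
    by measurable
  show ?case
  proof (cases "?C = {}")
    case True
    then show ?thesis
      using survivors_empty_mass(2)[OF T True]
      by (subst k_cuts_from_delete[OF T]) simp
  next
    case False
    have gen: "of_nat (card ?C) * ?q c r =
        of_nat (card ?C) * ennreal (survival_mass k T c r) + (\<Sum>w\<in>?C. ?q (?c w) r)" if r: "0 \<le> r" for r
    proof -
      let ?A = "\<lambda>(u, v). ancestors T v \<union> ancestors T u"
      let ?d = "\<lambda>(u, v) w. if w \<in> ancestors T v then r else 0"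
      have "of_nat (card ?C) * ?q c r = ennreal (pair_survival_mass k T c 0 (0 + r)) + (\<Sum>w\<in>?C. ?q (?c w) r)"
        unfolding pair_survival_mass_conv_surv_sum[OF T]
      proof (rule surv_sum_generator[OF T])
        show "finite (verts T \<times> verts T)" using grown_tree_basic(1)[OF T] by simp
        fix i assume i: "i \<in> verts T \<times> verts T"
        show "?A i \<subseteq> verts T" using ancestors_subset[of T] by auto
        show "root_vertex T \<in> ?A i" using i root_ancestor[OF T] by auto
        show "0 \<le> ?d i w" for w using r by (auto simp: split_def)
        show "ancestors T w \<subseteq> ?A i" if "w \<in> ?A i" for w
          using that i ancestors_trans[OF T, of "fst i" w] ancestors_trans[OF T, of "snd i" w]
          by (auto simp: split_def)
      qed
      also have "ennreal (pair_survival_mass k T c 0 (0 + r)) = of_nat (card ?C) * ennreal (survival_mass k T c r)"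
        by (simp add: pair_survival_mass_0[OF T] ennreal_mult' ennreal_of_nat_eq_real_of_nat)
      finally show ?thesis .
    qed
    have [measurable]: "survival_mass k T c \<in> borel_measurable borel"
      unfolding survival_mass_def by (intro borel_measurable_continuous_onI continuous_intros)
    have "of_nat (card ?C) * (\<integral>\<^sup>+r\<in>{0..}. ?q c r \<partial>lborel) =
        (\<integral>\<^sup>+r\<in>{0..}. of_nat (card ?C) * ?q c r \<partial>lborel)"
      by (subst nn_integral_cmult[symmetric]) (auto simp: mult.assoc)
    also have "\<dots> = (\<integral>\<^sup>+r. of_nat (card ?C) * (ennreal (survival_mass k T c r) * indicator {0..} r) +
        (\<Sum>w\<in>?C. ?q (?c w) r * indicator {0..} r) \<partial>lborel)"
      by (rule nn_integral_cong) (auto simp: gen split: split_indicator)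
    also have "\<dots> = of_nat (card ?C) * (\<integral>\<^sup>+r\<in>{0..}. ennreal (survival_mass k T c r) \<partial>lborel) +
        (\<Sum>w\<in>?C. \<integral>\<^sup>+r\<in>{0..}. ?q (?c w) r \<partial>lborel)"
      by (simp add: nn_integral_add nn_integral_cmult nn_integral_sum)
    also have "(\<integral>\<^sup>+r\<in>{0..}. ennreal (survival_mass k T c r) \<partial>lborel) = (\<integral>\<^sup>+m. of_nat m \<partial>?M c)"
      by (rule k_cuts_mean[OF T, symmetric])
    also have "of_nat (card ?C) * \<dots> = (\<Sum>w\<in>?C. \<integral>\<^sup>+m. of_nat (Suc m) \<partial>?M (?c w))"
    proof -
      let ?S = "\<Sum>w\<in>?C. \<integral>\<^sup>+m. of_nat (Suc m) \<partial>?M (?c w)"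
      have "(\<integral>\<^sup>+m. of_nat m \<partial>?M c) = ?S / of_nat (card ?C)"
        using False fin
        by (subst k_cuts_from_delete[OF T])
          (simp add: nn_integral_pmf_of_set ennreal_of_nat_eq_real_of_nat)
      then have "of_nat (card ?C) * (\<integral>\<^sup>+m. of_nat m \<partial>?M c) = ?S * of_nat (card ?C) / of_nat (card ?C)"
        by (simp add: ennreal_times_divide mult.commute)
      also have "\<dots> = ?S"
        using False fin by (intro ennreal_mult_divide_eq) (auto simp: ennreal_of_nat_eq_real_of_nat)
      finally show ?thesis .
    qed
    finally have *: "of_nat (card ?C) * (\<integral>\<^sup>+r\<in>{0..}. ?q c r \<partial>lborel) =
        (\<Sum>w\<in>?C. \<integral>\<^sup>+m. of_nat (Suc m) \<partial>?M (?c w)) + (\<Sum>w\<in>?C. \<integral>\<^sup>+r\<in>{0..}. ?q (?c w) r \<partial>lborel)" .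
    have "of_nat (card ?C) * (2 * (\<integral>\<^sup>+r\<in>{0..}. ?q c r \<partial>lborel)) =
        2 * (of_nat (card ?C) * (\<integral>\<^sup>+r\<in>{0..}. ?q c r \<partial>lborel))"
      by (simp add: ac_simps)
    also have "\<dots> = (\<Sum>w\<in>?C. \<integral>\<^sup>+m. 2 * of_nat (Suc m) \<partial>?M (?c w)) +
        (\<Sum>w\<in>?C. 2 * (\<integral>\<^sup>+r\<in>{0..}. ?q (?c w) r \<partial>lborel))"
      unfolding * by (simp add: nn_integral_cmult distrib_left sum_distrib_left del: of_nat_Suc)
    also have "(\<Sum>w\<in>?C. 2 * (\<integral>\<^sup>+r\<in>{0..}. ?q (?c w) r \<partial>lborel)) =
        (\<Sum>w\<in>?C. \<integral>\<^sup>+m. of_nat (m * Suc m) \<partial>?M (?c w))"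
      by (rule sum.cong[OF refl]) (rule step[symmetric])
    finally have J: "of_nat (card ?C) * (2 * (\<integral>\<^sup>+r\<in>{0..}. ?q c r \<partial>lborel)) =
        (\<Sum>w\<in>?C. \<integral>\<^sup>+m. 2 * of_nat (Suc m) \<partial>?M (?c w)) +
        (\<Sum>w\<in>?C. \<integral>\<^sup>+m. of_nat (m * Suc m) \<partial>?M (?c w))" .
    have "(\<integral>\<^sup>+m. of_nat (m * Suc m) \<partial>measure_pmf (pmf_of_set ?C \<bind> (\<lambda>v. map_pmf Suc (?M (?c v))))) =
        2 * (\<integral>\<^sup>+r\<in>{0..}. ?q c r \<partial>lborel)"
    proof (rule nn_integral_Suc_sum_pmf_of_set[OF fin False _ J])
      fix m :: nat
      have "Suc m * Suc (Suc m) = m * Suc m + 2 * Suc m"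
        by simp
      then show "(of_nat (Suc m * Suc (Suc m)) :: ennreal) = of_nat (m * Suc m) + 2 * of_nat (Suc m)"
        by (metis of_nat_add of_nat_mult of_nat_numeral)
    qed
    then show ?thesis
      using False by (subst k_cuts_from_delete[OF T]) simp
  qed
qed

section \<open>Generating functions of the scale-free tree\<close>

abbreviation nonroots :: "'v rooted_graph \<Rightarrow> 'v set" where
  "nonroots T \<equiv> verts T - {root_vertex T}"

text \<open>
  The root is left out because only then is the degree-weighted average of the increment a multiple of the
  generating function itself (\<open>depth_gf_degree_average\<close>).
\<close>

definition depth_gf :: "real \<Rightarrow> 'v rooted_graph \<Rightarrow> real" where
  "depth_gf z T = (\<Sum>v\<in>nonroots T. z ^ card (ancestors T v))"

text \<open>
  The weights \<open>z\<close> and \<open>y\<close> play the parts of \<open>surv k t\<close> and \<open>surv k s\<close> in \<open>pair_survival_mass\<close>.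
\<close>

definition pair_gf :: "real \<Rightarrow> real \<Rightarrow> 'v rooted_graph \<Rightarrow> real" where
  "pair_gf y z T = (\<Sum>u\<in>nonroots T. \<Sum>v\<in>nonroots T.
     y ^ card (ancestors T u - ancestors T v) * z ^ card (ancestors T v))"

lemma nonroots_add_leaf:
  assumes "grown_tree T" "w \<notin> verts T"
  shows "nonroots (add_leaf w v T) = insert w (nonroots T)"
  using grown_tree_basic(3)[OF assms(1)] assms(2) by auto

lemma depth_gf_add_leaf:
  assumes T: "grown_tree T" and v: "v \<in> verts T" and w: "w \<notin> verts T"
  shows "depth_gf z (add_leaf w v T) = depth_gf z T + z * z ^ card (ancestors T v)"
proof -
  have "card (insert w (ancestors T v)) = Suc (card (ancestors T v))"
    using finite_ancestors[OF T] ancestors_subset[of T v] w by (subst card_insert_disjoint) auto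
  moreover have "(\<Sum>u\<in>nonroots T. z ^ card (ancestors (add_leaf w v T) u)) = depth_gf z T"
    unfolding depth_gf_def by (rule sum.cong) (auto simp: ancestors_add_leaf(2)[OF T v w])
  ultimately show ?thesis
    using grown_tree_basic(1)[OF T] w
    by (simp add: depth_gf_def[of z "add_leaf w v T"] nonroots_add_leaf[OF T w] ancestors_add_leaf(1)[OF T v w]
        del: add_leaf_simps)
qed

lemma pair_gf_add_leaf:
  assumes T: "grown_tree T" and v: "v \<in> verts T" and w: "w \<notin> verts T"
  shows "pair_gf y z (add_leaf w v T) = pair_gf y z T
    + y * (\<Sum>x\<in>nonroots T. y ^ card (ancestors T v - ancestors T x) * z ^ card (ancestors T x))
    + z * (\<Sum>x\<in>nonroots T. y ^ card (ancestors T x - ancestors T v) * z ^ card (ancestors T v))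
    + z * z ^ card (ancestors T v)"
proof -
  let ?T = "add_leaf w v T" and ?N = "nonroots T"
  have fin: "finite ?N" and wN: "w \<notin> ?N" using grown_tree_basic(1)[OF T] w by auto
  have finA: "finite (ancestors T x)" for x using finite_ancestors[OF T] .
  have wA: "w \<notin> ancestors T x" for x using ancestors_subset[of T x] w by auto
  have anc: "ancestors ?T x = ancestors T x" if "x \<in> ?N" for x
    using that by (auto simp: ancestors_add_leaf(2)[OF T v w])
  note ancw = ancestors_add_leaf(1)[OF T v w]
  have c1: "card (insert w (ancestors T v)) = Suc (card (ancestors T v))"
    using finA wA by (subst card_insert_disjoint) auto
  have c2: "card (insert w (ancestors T v) - ancestors T x) = Suc (card (ancestors T v - ancestors T x))" for x
    using finA wA[of x] wA[of v] by (simp add: insert_Diff_if)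
  have c3: "ancestors T x - insert w (ancestors T v) = ancestors T x - ancestors T v" for x
    using wA[of x] by auto
  let ?f = "\<lambda>T u v. y ^ card (ancestors T u - ancestors T v) * z ^ card (ancestors T v)"
  have "pair_gf y z ?T = (\<Sum>a\<in>insert w ?N. \<Sum>b\<in>insert w ?N. ?f ?T a b)"
    unfolding pair_gf_def nonroots_add_leaf[OF T w] ..
  also have "\<dots> = ?f ?T w w + (\<Sum>b\<in>?N. ?f ?T w b) + ((\<Sum>a\<in>?N. ?f ?T a w) + (\<Sum>a\<in>?N. \<Sum>b\<in>?N. ?f ?T a b))"
    using fin wN by (simp add: sum.distrib)
  also have "(\<Sum>a\<in>?N. \<Sum>b\<in>?N. ?f ?T a b) = pair_gf y z T"
    unfolding pair_gf_def by (intro sum.cong refl) (simp add: anc)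
  also have "(\<Sum>b\<in>?N. ?f ?T w b) = (\<Sum>x\<in>?N. y * ?f T v x)"
    by (intro sum.cong refl) (simp add: anc ancw c2)
  also have "(\<Sum>a\<in>?N. ?f ?T a w) = (\<Sum>x\<in>?N. z * ?f T x v)"
    by (intro sum.cong refl) (simp add: anc ancw c1 c3)
  also have "?f ?T w w = z * z ^ card (ancestors T v)"
    by (simp add: ancw c1)
  finally show ?thesis
    by (simp add: sum_distrib_left)
qed

text \<open>
  An edge from a parent to its child \<open>c\<close> contributes the weight of a new leaf at \<open>c\<close>, which is \<open>z\<close> times the
  weight of \<open>c\<close>, and that of a new leaf at the parent, which equals the weight of \<open>c\<close>.
\<close>

lemma depth_gf_degree_average:
  assumes T: "grown_tree T"
  shows "(\<Sum>v\<in>verts T. real (degree T v) * (z * z ^ card (ancestors T v))) = (1 + z) * depth_gf z T"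
proof -
  obtain par where par: "\<And>c. c \<in> nonroots T \<Longrightarrow>
       par c \<in> verts T \<and> c \<notin> ancestors T (par c) \<and> ancestors T c = insert c (ancestors T (par c))"
    and deg: "\<And>g. (\<Sum>x\<in>verts T. real (degree T x) * g x) = (\<Sum>c\<in>nonroots T. g c + g (par c))"
    using degree_sum_by_parent[OF T] by blast
  have "z * z ^ card (ancestors T (par c)) = z ^ card (ancestors T c)" if "c \<in> nonroots T" for c
    using par[OF that] finite_ancestors[OF T, of "par c"] by simp
  then show ?thesis
    unfolding deg depth_gf_def sum_distrib_left
    by (intro sum.cong refl) (simp add: algebra_simps)
qed

text \<open>
  A leaf attached to the parent of \<open>c\<close> is a sibling of \<open>c\<close>, so its pair weights are at most those
  of \<open>c\<close>: replacing \<open>c\<close> by a sibling only moves vertices below \<open>c\<close> further apart from it, and \<open>y \<le> 1\<close>. A leaf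
  attached to \<open>c\<close> gains a factor \<open>y\<close> or \<open>z\<close>, according to its position in the pair. The pair
  of the new leaf with itself has weight at most one, which gives the last summand.
\<close>

lemma pair_gf_degree_average:
  assumes T: "grown_tree T" and w: "w \<notin> verts T"
    and y: "0 \<le> y" "y \<le> 1" and z: "0 \<le> z" "z \<le> 1"
  shows "(\<Sum>v\<in>verts T. real (degree T v) * (pair_gf y z (add_leaf w v T) - pair_gf y z T))
    \<le> (2 + y + z) * pair_gf y z T + 2 * real (card (nonroots T))"
proof -
  obtain par where par: "\<And>c. c \<in> nonroots T \<Longrightarrow>
       par c \<in> verts T \<and> c \<notin> ancestors T (par c) \<and> ancestors T c = insert c (ancestors T (par c))"
    and deg: "\<And>g. (\<Sum>x\<in>verts T. real (degree T x) * g x) = (\<Sum>c\<in>nonroots T. g c + g (par c))"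
    using degree_sum_by_parent[OF T] by blast
  let ?N = "nonroots T"
  let ?f = "\<lambda>u v. y ^ card (ancestors T u - ancestors T v) * z ^ card (ancestors T v)"
  let ?g1 = "\<lambda>v. \<Sum>x\<in>?N. ?f v x" and ?g2 = "\<lambda>v. \<Sum>x\<in>?N. ?f x v"
  have finA: "finite (ancestors T x)" for x using finite_ancestors[OF T] .
  have par1: "y * ?f (par c) x \<le> ?f c x" if c: "c \<in> ?N" for c x
  proof -
    have "card (ancestors T c - ancestors T x) \<le> card (insert c (ancestors T (par c) - ancestors T x))"
      using par[OF c] finA by (intro card_mono) auto
    also have "\<dots> \<le> Suc (card (ancestors T (par c) - ancestors T x))"
      by (rule card_insert_le_m1) auto
    finally have "y ^ Suc (card (ancestors T (par c) - ancestors T x)) \<le> y ^ card (ancestors T c - ancestors T x)"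
      using y by (intro power_decreasing) auto
    then have "y ^ Suc (card (ancestors T (par c) - ancestors T x)) * z ^ card (ancestors T x) \<le> ?f c x"
      using z by (intro mult_right_mono) auto
    then show ?thesis by simp
  qed
  have par2: "z * ?f x (par c) \<le> ?f x c" if c: "c \<in> ?N" for c x
  proof -
    have "z * z ^ card (ancestors T (par c)) = z ^ card (ancestors T c)"
      using par[OF c] finA by simp
    moreover have "y ^ card (ancestors T x - ancestors T (par c)) \<le> y ^ card (ancestors T x - ancestors T c)"
      using par[OF c] finA y by (intro power_decreasing card_mono) auto
    then have "y ^ card (ancestors T x - ancestors T (par c)) * z ^ card (ancestors T c) \<le> ?f x c"
      using z by (intro mult_right_mono) auto
    moreover have "z * ?f x (par c) =
        y ^ card (ancestors T x - ancestors T (par c)) * (z * z ^ card (ancestors T (par c)))"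
      by (simp add: mult_ac)
    ultimately show ?thesis by (simp only:)
  qed
  have pow: "z * z ^ m \<le> 1" for m
    using power_le_one[OF z, of "Suc m"] by simp
  let ?inc = "\<lambda>v. y * ?g1 v + z * ?g2 v + z * z ^ card (ancestors T v)"
  have "(\<Sum>v\<in>verts T. real (degree T v) * (pair_gf y z (add_leaf w v T) - pair_gf y z T)) =
      (\<Sum>v\<in>verts T. real (degree T v) * ?inc v)"
    by (intro sum.cong refl) (simp add: pair_gf_add_leaf[OF T _ w])
  also have "\<dots> = (\<Sum>c\<in>?N. ?inc c + ?inc (par c))"
    by (rule deg)
  also have "\<dots> \<le> (\<Sum>c\<in>?N. (y * ?g1 c + z * ?g2 c + 1) + (?g1 c + ?g2 c + 1))"
  proof (intro sum_mono add_mono order_refl pow)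
    fix c assume c: "c \<in> ?N"
    show "y * ?g1 (par c) \<le> ?g1 c" "z * ?g2 (par c) \<le> ?g2 c"
      unfolding sum_distrib_left by (intro sum_mono par1[OF c] par2[OF c])+
  qed
  also have "\<dots> = (1 + y) * (\<Sum>c\<in>?N. ?g1 c) + (1 + z) * (\<Sum>c\<in>?N. ?g2 c) + 2 * real (card ?N)"
    by (simp add: sum.distrib algebra_simps flip: sum_distrib_left)
  also have "(\<Sum>c\<in>?N. ?g1 c) = pair_gf y z T"
    unfolding pair_gf_def ..
  also have "(\<Sum>c\<in>?N. ?g2 c) = pair_gf y z T"
    unfolding pair_gf_def by (rule sum.swap)
  finally show ?thesis by (simp add: algebra_simps)
qed

lemma scale_free_tree_grown:
  assumes "n \<ge> 1" "T \<in> set_pmf (scale_free_tree n)"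
  shows "grown_tree T \<and> root_vertex T = 1"
  using assms
proof (induction n arbitrary: T rule: scale_free_tree.induct)
  case 2
  have "grown_tree (add_leaf 2 1 \<lparr>verts = {1}, edges = {}, root_vertex = 1 :: nat\<rparr>)"
    by (intro grown_tree.intros) auto
  moreover have "T = add_leaf 2 1 \<lparr>verts = {1}, edges = {}, root_vertex = 1 :: nat\<rparr>"
    using 2 by (auto simp: add_leaf_def insert_commute)
  ultimately show ?case by auto
next
  case (3 m)
  define n where "n = Suc m"
  obtain S v where S: "S \<in> set_pmf (scale_free_tree n)" and v: "v \<in> set_pmf (attachment_pmf n S)"
    and T: "T = add_leaf (n + 2) v S"
    using 3 by (auto simp: n_def Let_def)
  have IH: "grown_tree S" "root_vertex S = 1"
    using 3(1)[of n S] S by (auto simp: n_def)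
  have V: "verts S = {1..n+1}"
    using scale_free_tree_well_formed[of n S] S by (simp add: n_def)
  have "pmf (attachment_pmf n S) v \<noteq> 0"
    using v by (simp add: set_pmf_iff)
  then have "v \<in> verts S"
    unfolding V using pmf_attachment_pmf[of n S v] S by (simp add: n_def split: if_splits)
  then have "grown_tree T"
    unfolding T using IH(1) by (intro grown_tree.leaf) (simp_all add: V)
  then show ?case
    using IH(2) by (simp add: T)
qed simp

lemma scale_free_tree_verts:
  "n \<ge> 1 \<Longrightarrow> T \<in> set_pmf (scale_free_tree n) \<Longrightarrow> verts T = {1..n+1}"
  using scale_free_tree_well_formed by blast

lemma set_attachment_pmf_subset:
  assumes "n \<ge> 1" "T \<in> set_pmf (scale_free_tree n)"
  shows "set_pmf (attachment_pmf n T) \<subseteq> verts T"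
  using pmf_attachment_pmf[OF assms] scale_free_tree_verts[OF assms]
  by (auto simp: set_pmf_iff split: if_splits)

lemma finite_set_scale_free_tree: "finite (set_pmf (scale_free_tree n))"
proof (induction n rule: scale_free_tree.induct)
  case (3 m)
  have "finite (set_pmf (attachment_pmf (Suc m) T))" if "T \<in> set_pmf (scale_free_tree (Suc m))" for T
    using set_attachment_pmf_subset[of "Suc m" T] scale_free_tree_verts[of "Suc m" T] that
      finite_subset[of _ "verts T"] by auto
  then show ?case
    using 3 by (simp add: Let_def)
qed auto

abbreviation sf_expectation :: "nat \<Rightarrow> (nat rooted_graph \<Rightarrow> real) \<Rightarrow> real" where
  "sf_expectation n \<equiv> measure_pmf.expectation (scale_free_tree n)"

lemma integrable_scale_free [simp]:
  fixes f :: "nat rooted_graph \<Rightarrow> real"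
  shows "integrable (measure_pmf (scale_free_tree n)) f"
  by (rule integrable_measure_pmf_finite[OF finite_set_scale_free_tree])

lemma sf_expectation_mono:
  assumes "\<And>T. T \<in> set_pmf (scale_free_tree n) \<Longrightarrow> f T \<le> g T"
  shows "sf_expectation n f \<le> sf_expectation n g"
  using assms by (intro integral_mono_AE) (auto simp: AE_measure_pmf_iff)

lemma sf_expectation_cong:
  assumes "\<And>T. T \<in> set_pmf (scale_free_tree n) \<Longrightarrow> f T = g T"
  shows "sf_expectation n f = sf_expectation n g"
  using assms by (intro integral_cong_AE) (auto simp: AE_measure_pmf_iff)

lemma sf_expectation_Suc:
  assumes n: "n \<ge> 1"
  shows "sf_expectation (Suc n) f = sf_expectation n (\<lambda>T. f T +
    (\<Sum>v\<in>verts T. real (degree T v) * (f (add_leaf (n + 2) v T) - f T)) / (2 * real n))"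
proof -
  obtain m where m: "n = Suc m" using n by (cases n) auto
  let ?p = "scale_free_tree n"
  let ?q = "\<lambda>T. map_pmf (\<lambda>v. add_leaf (n + 2) v T) (attachment_pmf n T)"
  have eq: "scale_free_tree (Suc n) = ?p \<bind> ?q"
    by (simp add: m Let_def map_pmf_def)
  have inner: "measure_pmf.expectation (?q T) f = f T +
      (\<Sum>v\<in>verts T. real (degree T v) * (f (add_leaf (n + 2) v T) - f T)) / (2 * real n)"
    if T: "T \<in> set_pmf ?p" for T
  proof -
    note V = scale_free_tree_verts[OF n T]
    have p: "pmf (attachment_pmf n T) v = real (degree T v) / (2 * real n)" if "v \<in> verts T" for v
      using pmf_attachment_pmf[OF n T, of v] that V by auto
    have ex: "measure_pmf.expectation (attachment_pmf n T) g =
        (\<Sum>v\<in>verts T. pmf (attachment_pmf n T) v * g v)" for g :: "nat \<Rightarrow> real"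
      using set_attachment_pmf_subset[OF n T] V
      by (subst integral_measure_pmf[of "verts T"]) (auto simp: mult.commute)
    have "measure_pmf.expectation (?q T) f = measure_pmf.expectation (attachment_pmf n T) (\<lambda>v. f (add_leaf (n + 2) v T))"
      by simp
    also have "\<dots> = (\<Sum>v\<in>verts T. pmf (attachment_pmf n T) v * f T)
        + (\<Sum>v\<in>verts T. pmf (attachment_pmf n T) v * (f (add_leaf (n + 2) v T) - f T))"
      unfolding ex by (simp add: algebra_simps flip: sum.distrib)
    also have "(\<Sum>v\<in>verts T. pmf (attachment_pmf n T) v * f T) = f T"
      using ex[of "\<lambda>_. f T"] by simp
    also have "(\<Sum>v\<in>verts T. pmf (attachment_pmf n T) v * (f (add_leaf (n + 2) v T) - f T)) =
        (\<Sum>v\<in>verts T. real (degree T v) * (f (add_leaf (n + 2) v T) - f T)) / (2 * real n)"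
      unfolding sum_divide_distrib by (intro sum.cong refl) (simp add: p)
    finally show ?thesis .
  qed
  have finq: "finite (set_pmf (attachment_pmf n T))" if "T \<in> set_pmf ?p" for T
    using finite_subset[OF set_attachment_pmf_subset[OF n that]] scale_free_tree_verts[OF n that] by simp
  have "sf_expectation (Suc n) f = (\<Sum>T\<in>set_pmf ?p. pmf ?p T *\<^sub>R measure_pmf.expectation (?q T) f)"
    unfolding eq by (rule pmf_expectation_bind) (simp_all add: finite_set_scale_free_tree finq)
  also have "\<dots> = (\<Sum>T\<in>set_pmf ?p. pmf ?p T *\<^sub>R (f T +
      (\<Sum>v\<in>verts T. real (degree T v) * (f (add_leaf (n + 2) v T) - f T)) / (2 * real n)))"
    by (intro sum.cong refl) (simp only: inner)
  also have "\<dots> = sf_expectation n (\<lambda>T. f T +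
      (\<Sum>v\<in>verts T. real (degree T v) * (f (add_leaf (n + 2) v T) - f T)) / (2 * real n))"
    by (rule integral_measure_pmf[symmetric]) (auto simp: finite_set_scale_free_tree)
  finally show ?thesis .
qed

lemma single_edge_gf:
  fixes T :: "nat rooted_graph"
  assumes "T \<in> set_pmf (scale_free_tree 1)"
  shows "depth_gf z T = z\<^sup>2" "pair_gf y z T = z\<^sup>2"
proof -
  have T: "grown_tree T" "root_vertex T = 1" and V: "verts T = {1, 2}"
    using scale_free_tree_grown[of 1 T] assms by auto
  have N: "nonroots T = {2}" using T V by auto
  have "1 \<in> ancestors T 2" "2 \<in> ancestors T 2"
    using root_ancestor[OF T(1), of 2] self_in_ancestors[of 2 T] T V by auto
  then have "ancestors T 2 = {1, 2}"
    using ancestors_subset[of T 2] V by auto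
  then show "depth_gf z T = z\<^sup>2" "pair_gf y z T = z\<^sup>2"
    by (auto simp: depth_gf_def pair_gf_def N power2_eq_square)
qed

lemma expectation_depth_gf:
  assumes n: "n \<ge> 1"
  shows "sf_expectation n (depth_gf z) = z\<^sup>2 * (\<Prod>j\<in>{1..<n}. 1 + (1 + z) / (2 * real j))"
  using n
proof (induction n rule: dec_induct)
  case base
  have "sf_expectation 1 (depth_gf z) = sf_expectation 1 (\<lambda>_. z\<^sup>2)"
    by (rule sf_expectation_cong) (rule single_edge_gf)
  then show ?case by simp
next
  case (step n)
  have "sf_expectation (Suc n) (depth_gf z) = sf_expectation n (\<lambda>T. (1 + (1 + z) / (2 * real n)) * depth_gf z T)"
    unfolding sf_expectation_Suc[OF step(1)]
  proof (rule sf_expectation_cong)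
    fix T assume T: "T \<in> set_pmf (scale_free_tree n)"
    have g: "grown_tree T" and V: "n + 2 \<notin> verts T"
      using scale_free_tree_grown[OF step(1) T] scale_free_tree_verts[OF step(1) T] by auto
    have "(\<Sum>v\<in>verts T. real (degree T v) * (depth_gf z (add_leaf (n + 2) v T) - depth_gf z T)) =
        (\<Sum>v\<in>verts T. real (degree T v) * (z * z ^ card (ancestors T v)))"
      by (intro sum.cong refl) (simp only: depth_gf_add_leaf[OF g _ V] add_diff_cancel_left')
    also have "\<dots> = (1 + z) * depth_gf z T"
      by (rule depth_gf_degree_average[OF g])
    finally have "(\<Sum>v\<in>verts T. real (degree T v) * (depth_gf z (add_leaf (n + 2) v T) - depth_gf z T)) =
        (1 + z) * depth_gf z T" .
    then show "depth_gf z T + (\<Sum>v\<in>verts T. real (degree T v) *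
        (depth_gf z (add_leaf (n + 2) v T) - depth_gf z T)) / (2 * real n) =
        (1 + (1 + z) / (2 * real n)) * depth_gf z T"
      by (simp only:) (simp add: algebra_simps)
  qed
  then show ?case
    using step by (simp add: mult_ac)
qed

text \<open>
  The right-hand side is the exact solution of \<open>D (n + 1) = (1 + b / n) D n + 1\<close> with \<open>D 1 = 1\<close>. The
  additive term contributes to the leading order: for \<open>y = z = 1\<close>, where \<open>b = 2\<close>, the bound is the number
  \<open>n\<^sup>2\<close> of pairs.
\<close>

lemma expectation_pair_gf_le:
  assumes n: "n \<ge> 1" and y: "0 \<le> y" "y \<le> 1" and z: "0 \<le> z" "z \<le> 1" and b: "b = (2 + y + z) / 2" "1 < b"
  shows "sf_expectation n (pair_gf y z) \<le> (b * (\<Prod>j\<in>{1..<n}. 1 + b / real j) - real n) / (b - 1)"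
  using n
proof (induction n rule: dec_induct)
  case base
  have "sf_expectation 1 (pair_gf y z) = sf_expectation 1 (\<lambda>_. z\<^sup>2)"
    by (rule sf_expectation_cong) (rule single_edge_gf)
  also have "\<dots> \<le> 1" using z by (simp add: power_le_one)
  finally show ?case using b by simp
next
  case (step n)
  have "sf_expectation (Suc n) (pair_gf y z) \<le> sf_expectation n (\<lambda>T. (1 + b / real n) * pair_gf y z T + 1)"
    unfolding sf_expectation_Suc[OF step(1)]
  proof (rule sf_expectation_mono)
    fix T assume T: "T \<in> set_pmf (scale_free_tree n)"
    have g: "grown_tree T" and V: "n + 2 \<notin> verts T" and N: "card (nonroots T) = n"
      using scale_free_tree_grown[OF step(1) T] scale_free_tree_verts[OF step(1) T] by auto
    have "(\<Sum>v\<in>verts T. real (degree T v) * (pair_gf y z (add_leaf (n + 2) v T) - pair_gf y z T)) / (2 * real n)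
        \<le> ((2 + y + z) * pair_gf y z T + 2 * real n) / (2 * real n)"
      using pair_gf_degree_average[OF g V y z] step(1) unfolding N by (intro divide_right_mono) auto
    also have "\<dots> = b / real n * pair_gf y z T + 1"
      using step(1) by (simp add: b field_simps)
    finally show "pair_gf y z T + (\<Sum>v\<in>verts T. real (degree T v) *
        (pair_gf y z (add_leaf (n + 2) v T) - pair_gf y z T)) / (2 * real n)
        \<le> (1 + b / real n) * pair_gf y z T + 1"
      by (simp add: algebra_simps)
  qed
  also have "\<dots> = (1 + b / real n) * sf_expectation n (pair_gf y z) + 1"
    by simp
  also have "\<dots> \<le> (1 + b / real n) * ((b * (\<Prod>j\<in>{1..<n}. 1 + b / real j) - real n) / (b - 1)) + 1"
    using b(2) by (intro add_mono mult_left_mono step.IH order_refl) simp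
  also have "\<dots> = (b * (\<Prod>j\<in>{1..<Suc n}. 1 + b / real j) - real (Suc n)) / (b - 1)"
  proof -
    define P where "P = (\<Prod>j\<in>{1..<n}. 1 + b / real j)"
    have "(\<Prod>j\<in>{1..<Suc n}. 1 + b / real j) = P * (1 + b / real n)"
      using step(1) by (simp add: P_def)
    then show ?thesis
      using b(2) step(1) unfolding P_def[symmetric] by (simp add: field_simps)
  qed
  finally show ?case .
qed

text \<open>
  Compared with the telescoping product for \<open>b = 2\<close>, the \<open>j\<close>-th factor shrinks by
  \<open>1 - (2 - b) / (j + 2)\<close>.
\<close>

lemma growth_product_upper:
  assumes b: "0 \<le> b" "b \<le> 2" and n: "n \<ge> 1"
  shows "(\<Prod>j\<in>{1..<n}. 1 + b / real j) \<le>
    real n * (real n + 1) / 2 * exp (- (2 - b) * ln ((real n + 2) / 3))"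
  using n
proof (induction n rule: dec_induct)
  case (step n)
  have n: "real n \<ge> 1" using step by simp
  have "ln ((real n + 3) / (real n + 2)) \<le> (real n + 3) / (real n + 2) - 1"
    using n by (intro ln_le_minus_one) auto
  also have "\<dots> = 1 / (real n + 2)" using n by (simp add: field_simps)
  finally have ln: "ln ((real n + 3) / (real n + 2)) \<le> 1 / (real n + 2)" .
  have "1 + b / real n = (real n + 2) / real n * (1 - (2 - b) / (real n + 2))"
  proof -
    have "m / real n * (1 - (2 - b) / m) = (m - (2 - b)) / real n" if "m > 0" for m :: real
      using that n by (simp add: field_simps)
    from this[of "real n + 2"] show ?thesis
      using n by (simp add: field_simps)
  qed
  also have "1 - (2 - b) / (real n + 2) \<le> exp (- ((2 - b) / (real n + 2)))"
    using exp_ge_add_one_self[of "- ((2 - b) / (real n + 2))"] by simp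
  also have "\<dots> \<le> exp (- (2 - b) * ln ((real n + 3) / (real n + 2)))"
    unfolding exp_le_cancel_iff mult_minus_left neg_le_iff_le
    using mult_left_mono[OF ln, of "2 - b"] b by simp
  finally have factor: "1 + b / real n \<le> (real n + 2) / real n * exp (- (2 - b) * ln ((real n + 3) / (real n + 2)))"
    using n by (simp add: mult_left_mono divide_right_mono)
  have "(\<Prod>j\<in>{1..<Suc n}. 1 + b / real j) = (\<Prod>j\<in>{1..<n}. 1 + b / real j) * (1 + b / real n)"
    using step(1) by simp
  also have "\<dots> \<le> (real n * (real n + 1) / 2 * exp (- (2 - b) * ln ((real n + 2) / 3))) *
      ((real n + 2) / real n * exp (- (2 - b) * ln ((real n + 3) / (real n + 2))))"
    using step factor b n by (intro mult_mono) (auto intro!: prod_nonneg)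
  also have "\<dots> = (real n + 1) * (real n + 2) / 2 *
      exp (- (2 - b) * (ln ((real n + 2) / 3) + ln ((real n + 3) / (real n + 2))))"
  proof -
    have "N * (N + 1) / 2 * e * ((N + 2) / N * f) = (N + 1) * (N + 2) / 2 * (e * f)"
      if "N > 0" for N e f :: real
      using that by (simp add: field_simps)
    then show ?thesis
      unfolding distrib_left exp_add using n by simp
  qed
  also have "ln ((real n + 2) / 3) + ln ((real n + 3) / (real n + 2)) = ln ((real n + 3) / 3)"
  proof -
    have "m / 3 * ((m + 1) / m) = (m + 1) / 3" if "m > 0" for m :: real
      using that by simp
    from this[of "real n + 2"] have "(real n + 2) / 3 * ((real n + 3) / (real n + 2)) = (real n + 3) / 3"
      using n by (simp only: add.assoc) simp
    then show ?thesis using n by (simp flip: ln_mult_pos)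
  qed
  finally show ?case by (simp add: algebra_simps)
qed simp

text \<open>
  Compared with the telescoping product for \<open>z = 1\<close>, the \<open>j\<close>-th factor shrinks by \<open>1 - x / (j + 1)\<close>, and
  \<open>1 - u \<ge> exp (- u / (1 - u))\<close>.
\<close>

lemma growth_product_lower:
  fixes z :: real
  assumes z: "0 \<le> z" "z \<le> 1" and x: "x = (1 - z) / 2" and n: "n \<ge> 1"
  shows "real n * exp (- (x / (1 - x)) * ln (real n)) \<le> (\<Prod>j\<in>{1..<n}. 1 + (1 + z) / (2 * real j))"
  using n
proof (induction n rule: dec_induct)
  case (step n)
  have n: "real n \<ge> 1" using step by simp
  have x01: "0 \<le> x" "x \<le> 1 / 2" using z x by auto
  define u where "u = x / (real n + 1)"
  have u: "0 \<le> u" "u \<le> x" using x01 n by (auto simp: u_def field_simps mult_left_mono)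
  have ln1: "1 / (real n + 1) \<le> ln ((real n + 1) / real n)"
  proof -
    have "ln (real n / (real n + 1)) \<le> real n / (real n + 1) - 1"
      using n by (intro ln_le_minus_one) auto
    also have "\<dots> = - (1 / (real n + 1))" using n by (simp add: field_simps)
    finally show ?thesis using n by (simp add: ln_div)
  qed
  have "x / (1 - x) * (1 / (real n + 1)) \<le> x / (1 - x) * ln ((real n + 1) / real n)"
    using x01 by (intro mult_left_mono ln1) auto
  moreover have "u / (1 - u) \<le> x / (1 - x) * (1 / (real n + 1))"
  proof -
    have "u / (1 - u) \<le> u / (1 - x)"
      using u x01 by (intro divide_left_mono) auto
    also have "\<dots> = x / (1 - x) * (1 / (real n + 1))" by (simp add: u_def)
    finally show ?thesis .
  qed
  ultimately have "exp (- (x / (1 - x)) * ln ((real n + 1) / real n)) \<le> exp (- (u / (1 - u)))"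
    by simp
  also have "\<dots> \<le> 1 - u"
  proof -
    have "1 / (1 - u) = 1 + u / (1 - u)"
      using u x01 by (simp add: field_simps)
    also have "\<dots> \<le> exp (u / (1 - u))" by (rule exp_ge_add_one_self)
    finally show ?thesis
      using u x01 by (simp add: exp_minus field_simps)
  qed
  finally have factor: "(real n + 1) / real n * exp (- (x / (1 - x)) * ln ((real n + 1) / real n))
      \<le> (real n + 1) / real n * (1 - u)"
    using n by (intro mult_left_mono) auto
  also have "\<dots> = 1 + (1 + z) / (2 * real n)"
  proof -
    have "m / real n * (1 - x / m) = (m - x) / real n" if "m > 0" for m :: real
      using that n by (simp add: field_simps)
    from this[of "real n + 1"] show ?thesis
      using n by (simp add: u_def x field_simps)
  qed
  finally have factor: "(real n + 1) / real n * exp (- (x / (1 - x)) * ln ((real n + 1) / real n))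
      \<le> 1 + (1 + z) / (2 * real n)" .
  have "ln (real n + 1) = ln (real n) + ln ((real n + 1) / real n)"
    using n by (simp add: ln_div)
  then have ln: "ln (real (Suc n)) = ln (real n) + ln ((real n + 1) / real n)"
    by (simp add: add.commute)
  have "real (Suc n) * (e * f) = (real n * e) * ((real n + 1) / real n * f)" for e f
    using n by simp
  then have "real (Suc n) * exp (- (x / (1 - x)) * ln (real (Suc n))) =
      (real n * exp (- (x / (1 - x)) * ln (real n))) *
      ((real n + 1) / real n * exp (- (x / (1 - x)) * ln ((real n + 1) / real n)))"
    unfolding ln distrib_left exp_add .
  also have "\<dots> \<le> (\<Prod>j\<in>{1..<n}. 1 + (1 + z) / (2 * real j)) * (1 + (1 + z) / (2 * real n))"
    using step factor n z by (intro mult_mono) (auto intro!: prod_nonneg)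
  finally show ?case using step(1) by simp
qed simp

section \<open>Moments for the scale-free tree\<close>

text \<open>
  Finite support replaces joint measurability in Tonelli's theorem.
\<close>

lemma nn_integral_finite_pmf_swap:
  fixes f :: "'a \<Rightarrow> 'b \<Rightarrow> ennreal"
  assumes fin: "finite (set_pmf p)" and meas: "\<And>x. x \<in> set_pmf p \<Longrightarrow> f x \<in> borel_measurable M"
  shows "(\<integral>\<^sup>+x. (\<integral>\<^sup>+t. f x t \<partial>M) \<partial>measure_pmf p) = (\<integral>\<^sup>+t. (\<integral>\<^sup>+x. f x t \<partial>measure_pmf p) \<partial>M)"
  using meas by (simp add: nn_integral_measure_pmf_finite[OF fin] nn_integral_sum nn_integral_multc)

lemma nn_integral_scale_free:
  assumes "\<And>T. T \<in> set_pmf (scale_free_tree n) \<Longrightarrow> 0 \<le> f T"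
  shows "(\<integral>\<^sup>+T. ennreal (f T) * c \<partial>measure_pmf (scale_free_tree n)) = ennreal (sf_expectation n f) * c"
proof -
  have "(\<integral>\<^sup>+T. ennreal (f T) * c \<partial>measure_pmf (scale_free_tree n)) =
      (\<integral>\<^sup>+T. ennreal (f T) \<partial>measure_pmf (scale_free_tree n)) * c"
    by (simp add: nn_integral_multc)
  also have "(\<integral>\<^sup>+T. ennreal (f T) \<partial>measure_pmf (scale_free_tree n)) = ennreal (sf_expectation n f)"
    using assms by (intro nn_integral_eq_integral) (auto simp: AE_measure_pmf_iff)
  finally show ?thesis .
qed

lemma survival_mass_nonneg: "0 \<le> t \<Longrightarrow> 0 \<le> survival_mass k T c t"
  unfolding survival_mass_def by (intro sum_nonneg prod_nonneg) (auto intro!: surv_nonneg)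

lemma pair_survival_mass_nonneg: "0 \<le> s \<Longrightarrow> 0 \<le> t \<Longrightarrow> 0 \<le> pair_survival_mass k T c s t"
  unfolding pair_survival_mass_def
  by (intro sum_nonneg) (auto intro!: prod_nonneg mult_nonneg_nonneg surv_nonneg)

lemma k_cut_number_conv:
  assumes "k \<ge> 1"
  shows "k_cut_number k T = k_cuts_from k (delete_vertices {u \<in> verts T. k \<le> (\<lambda>_. 0) u} T) (\<lambda>_. 0)"
  using assms by (simp add: k_cut_number_def)

lemma scale_free_cuts_mean:
  assumes k: "k \<ge> 1" and n: "n \<ge> 1"
  shows "(\<integral>\<^sup>+m. of_nat m \<partial>measure_pmf (k_cut_number_scale_free k n)) =
    (\<integral>\<^sup>+t\<in>{0..}. ennreal (sf_expectation n (\<lambda>T. survival_mass k T (\<lambda>_. 0) t)) \<partial>lborel)"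
proof -
  have "(\<integral>\<^sup>+m. of_nat m \<partial>measure_pmf (k_cut_number_scale_free k n)) =
      (\<integral>\<^sup>+T. (\<integral>\<^sup>+m. of_nat m \<partial>measure_pmf (k_cut_number k T)) \<partial>measure_pmf (scale_free_tree n))"
    by (simp add: k_cut_number_scale_free_def)
  also have "\<dots> = (\<integral>\<^sup>+T. (\<integral>\<^sup>+t\<in>{0..}. ennreal (survival_mass k T (\<lambda>_. 0) t) \<partial>lborel) \<partial>measure_pmf (scale_free_tree n))"
    using scale_free_tree_grown[OF n]
    by (intro nn_integral_cong_AE)
      (auto simp: AE_measure_pmf_iff k_cut_number_conv[OF k] k_cuts_mean[where c = "\<lambda>_. 0", simplified])
  also have "\<dots> = (\<integral>\<^sup>+t. (\<integral>\<^sup>+T. ennreal (survival_mass k T (\<lambda>_. 0) t) * indicator {0..} t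
      \<partial>measure_pmf (scale_free_tree n)) \<partial>lborel)"
  proof (rule nn_integral_finite_pmf_swap[OF finite_set_scale_free_tree])
    fix T :: "nat rooted_graph"
    have "survival_mass k T (\<lambda>_. 0) \<in> borel_measurable borel"
      unfolding survival_mass_def by (intro borel_measurable_continuous_onI continuous_intros)
    then show "(\<lambda>t. ennreal (survival_mass k T (\<lambda>_. 0) t) * indicator {0..} t) \<in> borel_measurable lborel"
      by measurable
  qed
  also have "\<dots> = (\<integral>\<^sup>+t\<in>{0..}. ennreal (sf_expectation n (\<lambda>T. survival_mass k T (\<lambda>_. 0) t)) \<partial>lborel)"
  proof (rule nn_integral_cong)
    fix t :: real
    show "(\<integral>\<^sup>+T. ennreal (survival_mass k T (\<lambda>_. 0) t) * indicator {0..} t \<partial>measure_pmf (scale_free_tree n)) =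
        ennreal (sf_expectation n (\<lambda>T. survival_mass k T (\<lambda>_. 0) t)) * indicator {0..} t"
      by (cases "t \<ge> 0") (simp_all add: nn_integral_scale_free survival_mass_nonneg
          nn_integral_scale_free[where c = 1, simplified])
  qed
  finally show ?thesis .
qed

lemma scale_free_cuts_second_moment:
  assumes k: "k \<ge> 1" and n: "n \<ge> 1"
  shows "(\<integral>\<^sup>+m. of_nat (m * Suc m) \<partial>measure_pmf (k_cut_number_scale_free k n)) =
    2 * (\<integral>\<^sup>+r\<in>{0..}. (\<integral>\<^sup>+s\<in>{0..}. ennreal (sf_expectation n
      (\<lambda>T. pair_survival_mass k T (\<lambda>_. 0) s (s + r))) \<partial>lborel) \<partial>lborel)"
proof -
  let ?p = "scale_free_tree n" and ?Q = "\<lambda>T r s. pair_survival_mass k T (\<lambda>_. 0) s (s + r)"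
  have meas1 [measurable]: "(\<lambda>r. \<integral>\<^sup>+s\<in>{0..}. ennreal (?Q T r s) \<partial>lborel) \<in> borel_measurable lborel"
    for T :: "nat rooted_graph" by measurable
  have meas2: "(\<lambda>s. ennreal (?Q T r s) * indicator {0..} s) \<in> borel_measurable lborel"
    for T :: "nat rooted_graph" and r
  proof -
    have "?Q T r \<in> borel_measurable borel"
      by (intro borel_measurable_continuous_onI continuous_pair_survival_mass continuous_intros)
    then show ?thesis by measurable
  qed
  have "(\<integral>\<^sup>+m. of_nat (m * Suc m) \<partial>measure_pmf (k_cut_number_scale_free k n)) =
      (\<integral>\<^sup>+T. (\<integral>\<^sup>+m. of_nat (m * Suc m) \<partial>measure_pmf (k_cut_number k T)) \<partial>measure_pmf ?p)"
    unfolding k_cut_number_scale_free_def by (rule nn_integral_bind_pmf)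
  also have "\<dots> = (\<integral>\<^sup>+T. 2 * (\<integral>\<^sup>+r\<in>{0..}. (\<integral>\<^sup>+s\<in>{0..}. ennreal (?Q T r s) \<partial>lborel) \<partial>lborel) \<partial>measure_pmf ?p)"
  proof (intro nn_integral_cong_AE, unfold AE_measure_pmf_iff, intro ballI)
    fix T assume "T \<in> set_pmf ?p"
    then have "grown_tree T" using scale_free_tree_grown[OF n] by blast
    then show "(\<integral>\<^sup>+m. of_nat (m * Suc m) \<partial>measure_pmf (k_cut_number k T)) =
        2 * (\<integral>\<^sup>+r\<in>{0..}. (\<integral>\<^sup>+s\<in>{0..}. ennreal (?Q T r s) \<partial>lborel) \<partial>lborel)"
      unfolding k_cut_number_conv[OF k] by (rule k_cuts_second_moment)
  qed
  also have "\<dots> = 2 * (\<integral>\<^sup>+T. (\<integral>\<^sup>+r\<in>{0..}. (\<integral>\<^sup>+s\<in>{0..}. ennreal (?Q T r s) \<partial>lborel) \<partial>lborel) \<partial>measure_pmf ?p)"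
    by (simp add: nn_integral_cmult)
  also have "(\<integral>\<^sup>+T. (\<integral>\<^sup>+r\<in>{0..}. (\<integral>\<^sup>+s\<in>{0..}. ennreal (?Q T r s) \<partial>lborel) \<partial>lborel) \<partial>measure_pmf ?p) =
      (\<integral>\<^sup>+r. (\<integral>\<^sup>+T. (\<integral>\<^sup>+s\<in>{0..}. ennreal (?Q T r s) \<partial>lborel) * indicator {0..} r \<partial>measure_pmf ?p) \<partial>lborel)"
    by (rule nn_integral_finite_pmf_swap[OF finite_set_scale_free_tree]) measurable
  also have "\<dots> = (\<integral>\<^sup>+r\<in>{0..}. (\<integral>\<^sup>+s\<in>{0..}. ennreal (sf_expectation n (\<lambda>T. ?Q T r s)) \<partial>lborel) \<partial>lborel)"
  proof (rule nn_integral_cong)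
    fix r :: real
    show "(\<integral>\<^sup>+T. (\<integral>\<^sup>+s\<in>{0..}. ennreal (?Q T r s) \<partial>lborel) * indicator {0..} r \<partial>measure_pmf ?p) =
        (\<integral>\<^sup>+s\<in>{0..}. ennreal (sf_expectation n (\<lambda>T. ?Q T r s)) \<partial>lborel) * indicator {0..} r"
    proof (cases "r \<ge> 0")
      case True
      have "(\<integral>\<^sup>+T. (\<integral>\<^sup>+s\<in>{0..}. ennreal (?Q T r s) \<partial>lborel) \<partial>measure_pmf ?p) =
          (\<integral>\<^sup>+s. (\<integral>\<^sup>+T. ennreal (?Q T r s) * indicator {0..} s \<partial>measure_pmf ?p) \<partial>lborel)"
        by (rule nn_integral_finite_pmf_swap[OF finite_set_scale_free_tree]) (rule meas2)
      also have "\<dots> = (\<integral>\<^sup>+s\<in>{0..}. ennreal (sf_expectation n (\<lambda>T. ?Q T r s)) \<partial>lborel)"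
      proof (rule nn_integral_cong)
        fix s :: real
        show "(\<integral>\<^sup>+T. ennreal (?Q T r s) * indicator {0..} s \<partial>measure_pmf ?p) =
            ennreal (sf_expectation n (\<lambda>T. ?Q T r s)) * indicator {0..} s"
          using True by (cases "s \<ge> 0") (simp_all add: pair_survival_mass_nonneg
              nn_integral_scale_free[where c = 1, simplified])
      qed
      finally show ?thesis using True by simp
    qed simp
  qed
  finally show ?thesis .
qed

lemma survival_mass_fresh:
  assumes T: "grown_tree T"
  shows "survival_mass k T (\<lambda>_. 0) t = surv k t + depth_gf (surv k t) T"
proof -
  have "survival_mass k T (\<lambda>_. 0) t = (\<Sum>v\<in>verts T. surv k t ^ card (ancestors T v))"
    by (simp add: survival_mass_def)
  also have "\<dots> = surv k t ^ card (ancestors T (root_vertex T)) + depth_gf (surv k t) T"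
    using grown_tree_basic[OF T] unfolding depth_gf_def by (intro sum.remove)
  finally show ?thesis by (simp add: ancestors_root[OF T])
qed

text \<open>
  Beside \<open>n\<close> other vertices, the root is involved in \<open>2 n + 1\<close> pairs, and \<open>v\<close> alone already contributes a factor \<open>surv k t\<close>.
\<close>

lemma pair_survival_mass_fresh_le:
  assumes T: "grown_tree T" and s: "0 \<le> s" and t: "0 \<le> t"
  shows "pair_survival_mass k T (\<lambda>_. 0) s t \<le>
    pair_gf (surv k s) (surv k t) T + (2 * real (card (nonroots T)) + 1) * surv k t"
proof -
  let ?r = "root_vertex T" and ?N = "nonroots T" and ?y = "surv k s" and ?z = "surv k t"
  let ?f = "\<lambda>u v. ?y ^ card (ancestors T u - ancestors T v) * ?z ^ card (ancestors T v)"
  have z: "0 \<le> ?z" "?z \<le> 1" and y: "0 \<le> ?y" "?y \<le> 1"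
    using s t by (auto intro: surv_nonneg surv_le_1)
  have le: "?f u v \<le> ?z" if v: "v \<in> verts T" for u v
  proof -
    have "card (ancestors T v) \<ge> 1"
      using root_ancestor[OF T v] finite_ancestors[OF T, of v] by (simp add: Suc_le_eq card_gt_0_iff) blast
    then have "?z ^ card (ancestors T v) \<le> ?z ^ 1"
      using z by (intro power_decreasing)
    moreover have "?y ^ card (ancestors T u - ancestors T v) \<le> 1"
      using y by (intro power_le_one)
    ultimately show ?thesis
      using mult_mono[of "?y ^ card (ancestors T u - ancestors T v)" 1 "?z ^ card (ancestors T v)" ?z] y z
      by simp
  qed
  have V: "verts T = insert ?r ?N" "?r \<notin> ?N" "finite ?N" "?r \<in> verts T"
    using grown_tree_basic[OF T] by auto
  have "pair_survival_mass k T (\<lambda>_. 0) s t = (\<Sum>u\<in>verts T. \<Sum>v\<in>verts T. ?f u v)"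
    by (simp add: pair_survival_mass_def sum.cartesian_product mult.commute)
  also have "\<dots> = (\<Sum>u\<in>insert ?r ?N. \<Sum>v\<in>insert ?r ?N. ?f u v)"
    using V by simp
  also have "\<dots> = ?f ?r ?r + (\<Sum>v\<in>?N. ?f ?r v) + ((\<Sum>u\<in>?N. ?f u ?r) + (\<Sum>u\<in>?N. \<Sum>v\<in>?N. ?f u v))"
    by (simp only: sum.insert[OF V(3,2)] sum.distrib)
  also have "\<dots> \<le> ?z + (\<Sum>v\<in>?N. ?z) + ((\<Sum>u\<in>?N. ?z) + (\<Sum>u\<in>?N. \<Sum>v\<in>?N. ?f u v))"
    using V(4) by (intro add_mono sum_mono le order_refl) auto
  also have "(\<Sum>u\<in>?N. \<Sum>v\<in>?N. ?f u v) = pair_gf ?y ?z T"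
    by (simp add: pair_gf_def)
  finally show ?thesis by (simp add: algebra_simps)
qed

lemma pair_gf_scale:
  assumes T: "grown_tree T" and y: "0 \<le> y" "y \<le> 1" and z: "0 \<le> z" "z \<le> x" and x: "0 < x"
  shows "pair_gf y z T \<le> z / x * pair_gf 1 x T"
  unfolding pair_gf_def sum_distrib_left
proof (intro sum_mono)
  fix u v assume v: "v \<in> nonroots T"
  have "card (ancestors T v) \<noteq> 0"
    using root_ancestor[OF T, of v] v finite_ancestors[OF T, of v] by auto
  then obtain m where m: "card (ancestors T v) = Suc m"
    using not0_implies_Suc by blast
  have "z ^ card (ancestors T v) \<le> z * x ^ m"
    using z by (simp add: m mult_left_mono power_mono)
  also have "\<dots> = z / x * x ^ card (ancestors T v)"
    using x by (simp add: m)
  finally have "z ^ card (ancestors T v) \<le> z / x * x ^ card (ancestors T v)" .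
  moreover have "y ^ card (ancestors T u - ancestors T v) \<le> 1"
    using y by (intro power_le_one)
  ultimately have "y ^ card (ancestors T u - ancestors T v) * z ^ card (ancestors T v) \<le>
      1 * (z / x * x ^ card (ancestors T v))"
    using y z by (intro mult_mono) auto
  then show "y ^ card (ancestors T u - ancestors T v) * z ^ card (ancestors T v) \<le>
      z / x * (1 ^ card (ancestors T u - ancestors T v) * x ^ card (ancestors T v))"
    by simp
qed

lemma expectation_pair_gf_bound:
  assumes n: "n \<ge> 1" and y: "0 \<le> y" "y \<le> 1" and z: "0 \<le> z" "z \<le> 1" and d: "0 < d" "2 * d \<le> y + z"
  shows "sf_expectation n (pair_gf y z) \<le> (1 + d) / d * (real n * (real n + 1) / 2) *
    exp (- ((1 - y) + (1 - z)) / 2 * ln ((real n + 2) / 3))"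
proof -
  define b where "b = (2 + y + z) / 2"
  have b: "1 + d \<le> b" "b \<le> 2" using d y z by (auto simp: b_def)
  let ?P = "\<Prod>j\<in>{1..<n}. 1 + b / real j"
  have P0: "0 \<le> ?P" using b d by (intro prod_nonneg) auto
  have "sf_expectation n (pair_gf y z) \<le> (b * ?P - real n) / (b - 1)"
    using b d by (intro expectation_pair_gf_le n y z b_def) auto
  also have "\<dots> \<le> (b * ?P) / (b - 1)"
    using b d by (intro divide_right_mono) auto
  also have "\<dots> = b / (b - 1) * ?P" by simp
  also have "\<dots> \<le> (1 + d) / d * ?P"
    using b d by (intro mult_right_mono P0) (simp add: field_simps)
  also have "\<dots> \<le> (1 + d) / d * (real n * (real n + 1) / 2 * exp (- (2 - b) * ln ((real n + 2) / 3)))"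
    using b d by (intro mult_left_mono growth_product_upper n) auto
  also have "- (2 - b) = - ((1 - y) + (1 - z)) / 2"
    by (simp add: b_def field_simps)
  finally show ?thesis by (simp only: mult.assoc)
qed

text \<open>
  Up to time \<open>tau\<close>, \<open>1 - surv k\<close> is bounded below by a multiple of the \<open>k\<close>-th power, which gives the first
  summand. Beyond \<open>tau\<close> one factor \<open>surv k t\<close> is kept for integrability, and the other factors
  \<open>surv k t\<close> are estimated by their value \<open>x\<close> at time \<open>tau\<close>; this saves a positive power of \<open>n\<close>.
\<close>

lemma expectation_pair_survival_le:
  assumes k: "k \<ge> 1" and n: "n \<ge> 1" and tau: "0 < tau" and s: "0 \<le> s" and st: "s \<le> t"
  defines "x \<equiv> surv k tau" and "l \<equiv> ln ((real n + 2) / 3)"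
  shows "sf_expectation n (\<lambda>T. pair_survival_mass k T (\<lambda>_. 0) s t) \<le>
    (1 + x) / x * (real n * (real n + 1) / 2) *
      (exp (- (exp (- tau) / (2 * fact k) * l) * s ^ k) * exp (- (exp (- tau) / (2 * fact k) * l) * t ^ k))
    + (2 * real n + 1 + 3 / x * (real n * (real n + 1) / 2) * exp (- (1 - x) / 2 * l)) * surv k t"
proof -
  let ?y = "surv k s" and ?z = "surv k t"
  let ?M = "real n * (real n + 1) / 2"
  have t: "0 \<le> t" using s st by simp
  have l: "0 \<le> l" using n by (simp add: l_def)
  have x: "0 < x" "x \<le> 1"
    using surv_pos[of tau k] surv_le_1[of tau k] tau k less_le_trans[OF exp_gt_zero] by (auto simp: x_def)
  have y: "0 \<le> ?y" "?y \<le> 1" and z: "0 \<le> ?z" "?z \<le> 1"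
    using s t by (auto intro: surv_nonneg surv_le_1)
  have "sf_expectation n (\<lambda>T. pair_survival_mass k T (\<lambda>_. 0) s t) \<le>
      sf_expectation n (\<lambda>T. pair_gf ?y ?z T + (2 * real n + 1) * ?z)"
  proof (rule sf_expectation_mono)
    fix T assume T: "T \<in> set_pmf (scale_free_tree n)"
    have g: "grown_tree T" and N: "card (nonroots T) = n"
      using scale_free_tree_grown[OF n T] scale_free_tree_verts[OF n T] by auto
    show "pair_survival_mass k T (\<lambda>_. 0) s t \<le> pair_gf ?y ?z T + (2 * real n + 1) * ?z"
      using pair_survival_mass_fresh_le[OF g s t, of k] by (simp add: N)
  qed
  also have "\<dots> = sf_expectation n (pair_gf ?y ?z) + (2 * real n + 1) * ?z"
    by simp
  finally have main: "sf_expectation n (\<lambda>T. pair_survival_mass k T (\<lambda>_. 0) s t) \<le>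
      sf_expectation n (pair_gf ?y ?z) + (2 * real n + 1) * ?z" .
  let ?c = "exp (- tau) / (2 * fact k)"
  let ?B1 = "(1 + x) / x * ?M * (exp (- (?c * l) * s ^ k) * exp (- (?c * l) * t ^ k))"
  let ?B2 = "3 / x * ?M * exp (- (1 - x) / 2 * l)"
  have B1: "0 \<le> ?B1" and B2: "0 \<le> ?B2 * ?z"
    using x z by (auto intro!: mult_nonneg_nonneg)
  have "sf_expectation n (pair_gf ?y ?z) \<le> ?B1 + ?B2 * ?z"
  proof (cases "t \<le> tau")
    case True
    have yx: "x \<le> ?y" and zx: "x \<le> ?z"
      using True st s t by (auto simp: x_def intro!: surv_antimono)
    have low: "exp (- tau) * (r ^ k / fact k) \<le> 1 - surv k r" if "0 \<le> r" "r \<le> tau" for r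
    proof -
      have "exp (- tau) * (r ^ k / fact k) \<le> exp (- r) * (r ^ k / fact k)"
        using that by (intro mult_right_mono) auto
      then show ?thesis using one_minus_surv_ge[of r k] that by simp
    qed
    have "sf_expectation n (pair_gf ?y ?z) \<le> (1 + x) / x * ?M * exp (- ((1 - ?y) + (1 - ?z)) / 2 * l)"
      unfolding l_def using yx zx x by (intro expectation_pair_gf_bound n y z) auto
    also have "\<dots> \<le> (1 + x) / x * ?M * exp (- (?c * l) * s ^ k + - (?c * l) * t ^ k)"
    proof (rule mult_left_mono)
      have "?c * s ^ k + ?c * t ^ k \<le> ((1 - ?y) + (1 - ?z)) / 2"
        using low[of s] low[of t] True st s t by (simp add: field_simps)
      then have "(?c * s ^ k + ?c * t ^ k) * l \<le> ((1 - ?y) + (1 - ?z)) / 2 * l"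
        by (rule mult_right_mono[OF _ l])
      moreover have "- (?c * l) * s ^ k + - (?c * l) * t ^ k = - ((?c * s ^ k + ?c * t ^ k) * l)"
        by (simp add: algebra_simps)
      moreover have "- ((1 - ?y) + (1 - ?z)) / 2 * l = - (((1 - ?y) + (1 - ?z)) / 2 * l)"
        by (simp only: minus_divide_left[symmetric] mult_minus_left)
      ultimately show "exp (- ((1 - ?y) + (1 - ?z)) / 2 * l) \<le> exp (- (?c * l) * s ^ k + - (?c * l) * t ^ k)"
        by (simp only: exp_le_cancel_iff neg_le_iff_le)
      show "0 \<le> (1 + x) / x * ?M" using x by simp
    qed
    also have "exp (- (?c * l) * s ^ k + - (?c * l) * t ^ k) =
        exp (- (?c * l) * s ^ k) * exp (- (?c * l) * t ^ k)"
      by (rule exp_add)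
    finally have "sf_expectation n (pair_gf ?y ?z) \<le> ?B1" .
    then show ?thesis using B2 by simp
  next
    case False
    have zx: "?z \<le> x"
      using False tau by (auto simp: x_def intro!: surv_antimono)
    \<comment> \<open>Nothing is gained from the earlier time \<open>s\<close>, hence the weight \<open>1\<close> and the exponent \<open>(1 - x) / 2\<close>.\<close>
    have "sf_expectation n (pair_gf ?y ?z) \<le> sf_expectation n (\<lambda>T. ?z / x * pair_gf 1 x T)"
      using scale_free_tree_grown[OF n]
      by (intro sf_expectation_mono pair_gf_scale y z zx x) blast
    also have "\<dots> = ?z / x * sf_expectation n (pair_gf 1 x)"
      by simp
    also have "\<dots> \<le> ?z / x * ((1 + 1/2) / (1/2) * ?M * exp (- ((1 - 1) + (1 - x)) / 2 * ln ((real n + 2) / 3)))"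
      using x z by (intro mult_left_mono expectation_pair_gf_bound n) auto
    also have "\<dots> = ?B2 * ?z"
      by (simp add: l_def)
    finally show ?thesis using B1 by simp
  qed
  then show ?thesis using main by (simp add: algebra_simps)
qed

section \<open>Integrals over the time variables\<close>

lemma nn_integral_atLeast_LIMSEQ:
  fixes f :: "real \<Rightarrow> real" and a :: "nat \<Rightarrow> real"
  assumes f: "f \<in> borel_measurable borel" and a: "mono a" "filterlim a at_top sequentially"
  shows "(\<lambda>n. \<integral>\<^sup>+t. ennreal (f t * indicator {0..a n} t) \<partial>lborel) \<longlonglongrightarrow>
    (\<integral>\<^sup>+t. ennreal (f t * indicator {0..} t) \<partial>lborel)"
proof (rule nn_integral_LIMSEQ)
  show "incseq (\<lambda>n t. ennreal (f t * indicator {0..a n} t))"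
    using a(1) by (fastforce simp: incseq_def le_fun_def mono_def split: split_indicator)
  show "(\<lambda>t. ennreal (f t * indicator {0..a n} t)) \<in> borel_measurable lborel" for n
    using f by measurable
  show "(\<lambda>n. ennreal (f t * indicator {0..a n} t)) \<longlonglongrightarrow> ennreal (f t * indicator {0..} t)" for t
  proof (rule tendsto_eventually)
    have "\<forall>\<^sub>F n in sequentially. t \<le> a n"
      using a(2) by (simp add: filterlim_at_top)
    then show "\<forall>\<^sub>F n in sequentially. ennreal (f t * indicator {0..a n} t) = ennreal (f t * indicator {0..} t)"
      by eventually_elim (auto split: split_indicator)
  qed
qed

text \<open>
  The substitution \<open>u = t ^ k\<close> in the Gamma integral at \<open>1 / k\<close>.
\<close>

lemma nn_integral_exp_power:
  assumes k: "k \<ge> 1"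
  shows "(\<integral>\<^sup>+t\<in>{0..}. ennreal (exp (- (t ^ k))) \<partial>lborel) = ennreal (Gamma (1 + 1 / real k))"
proof -
  define f where "f = (\<lambda>u::real. u powr (1 / real k - 1) / exp u)"
  define h where "h = (\<lambda>t::real. f (t ^ k) * (real k * t ^ (k - 1)))"
  have [measurable]: "f \<in> borel_measurable borel" "h \<in> borel_measurable borel"
    unfolding h_def f_def by measurable
  have subst: "(\<integral>\<^sup>+x. ennreal (f x * indicator {0..real n ^ k} x) \<partial>lborel) =
      (\<integral>\<^sup>+t. ennreal (h t * indicator {0..real n} t) \<partial>lborel)" for n
  proof -
    have "((\<lambda>t. t ^ k) has_real_derivative (real k * t ^ (k - 1))) (at t)" for t :: real
      using DERIV_pow[of k t] by simp
    then have "(\<integral>\<^sup>+x. ennreal (f x * indicator {0 ^ k..real n ^ k} x) \<partial>lborel) =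
        (\<integral>\<^sup>+t. ennreal (f (t ^ k) * (real k * t ^ (k - 1)) * indicator {0..real n} t) \<partial>lborel)"
      by (intro nn_integral_substitution)
        (auto simp: set_borel_measurable_def intro!: continuous_intros)
    moreover have "(0::real) ^ k = 0" using k by simp
    ultimately show ?thesis by (simp only: h_def)
  qed
  have "(\<lambda>n. \<integral>\<^sup>+x. ennreal (f x * indicator {0..real n ^ k} x) \<partial>lborel) \<longlonglongrightarrow>
      (\<integral>\<^sup>+x. ennreal (f x * indicator {0..} x) \<partial>lborel)"
    using k by (intro nn_integral_atLeast_LIMSEQ)
      (auto intro!: monoI power_mono filterlim_pow_at_top[OF _ filterlim_real_sequentially])
  moreover have "(\<lambda>n. \<integral>\<^sup>+t. ennreal (h t * indicator {0..real n} t) \<partial>lborel) \<longlonglongrightarrow>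
      (\<integral>\<^sup>+t. ennreal (h t * indicator {0..} t) \<partial>lborel)"
    by (intro nn_integral_atLeast_LIMSEQ) (auto intro!: monoI filterlim_real_sequentially)
  ultimately have eq: "(\<integral>\<^sup>+x. ennreal (f x * indicator {0..} x) \<partial>lborel) = (\<integral>\<^sup>+t. ennreal (h t * indicator {0..} t) \<partial>lborel)"
    unfolding subst using LIMSEQ_unique by blast
  have h: "h t = real k * exp (- (t ^ k))" if "t > 0" for t
  proof -
    have "(t ^ k) powr (1 / real k - 1) * t ^ (k - 1) = t powr (real k * (1 / real k - 1)) * t powr (real k - 1)"
      using that k by (simp add: powr_powr of_nat_diff flip: powr_realpow)
    also have "\<dots> = 1"
      using that k by (simp add: right_diff_distrib flip: powr_add)
    finally show ?thesis
      by (simp add: h_def f_def exp_minus field_simps)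
  qed
  have "ennreal (Gamma (1 / real k)) = (\<integral>\<^sup>+t. ennreal (h t * indicator {0..} t) \<partial>lborel)"
    using k eq by (simp add: Gamma_conv_nn_integral_real f_def mult_ac)
  also have "\<dots> = (\<integral>\<^sup>+t. ennreal (real k) * (ennreal (exp (- (t ^ k))) * indicator {0..} t) \<partial>lborel)"
  proof (rule nn_integral_cong_AE)
    show "AE t in lborel. ennreal (h t * indicator {0..} t) =
        ennreal (real k) * (ennreal (exp (- (t ^ k))) * indicator {0..} t)"
      using AE_lborel_singleton[of 0]
      by eventually_elim (auto simp: h ennreal_mult' split: split_indicator)
  qed
  also have "\<dots> = ennreal (real k) * (\<integral>\<^sup>+t\<in>{0..}. ennreal (exp (- (t ^ k))) \<partial>lborel)"
    by (rule nn_integral_cmult) measurable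
  finally have G: "ennreal (Gamma (1 / real k)) = ennreal (real k) * (\<integral>\<^sup>+t\<in>{0..}. ennreal (exp (- (t ^ k))) \<partial>lborel)" .
  have "1 / real k \<notin> \<int>\<^sub>\<le>\<^sub>0"
    using k by (auto dest: nonpos_Ints_nonpos)
  then have "Gamma (1 + 1 / real k) = 1 / real k * Gamma (1 / real k)"
    using Gamma_plus1[of "1 / real k"] by (simp add: add.commute)
  then have "ennreal (Gamma (1 + 1 / real k)) = ennreal (1 / real k) * ennreal (Gamma (1 / real k))"
    by (simp only: ennreal_mult' divide_nonneg_nonneg of_nat_0_le_iff zero_le_one)
  also have "\<dots> = ennreal (1 / real k) * ennreal (real k) * (\<integral>\<^sup>+t\<in>{0..}. ennreal (exp (- (t ^ k))) \<partial>lborel)"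
    unfolding G by (simp add: mult.assoc)
  also have "ennreal (1 / real k) * ennreal (real k) = 1"
    using k by (simp flip: ennreal_mult)
  finally show ?thesis by simp
qed

lemma nn_integral_exp_scaled_power:
  assumes k: "k \<ge> 1" and a: "a > 0"
  shows "(\<integral>\<^sup>+t\<in>{0..}. ennreal (exp (- a * t ^ k)) \<partial>lborel) =
    ennreal (a powr (- 1 / real k) * Gamma (1 + 1 / real k))"
proof -
  define c where "c = a powr (- 1 / real k)"
  have c: "c > 0" using a by (simp add: c_def)
  have ck: "a * (c * x) ^ k = x ^ k" for x
  proof -
    have "c ^ k = a powr (- 1)"
      using a k by (simp add: c_def powr_powr flip: powr_realpow)
    then show ?thesis using a by (simp add: power_mult_distrib powr_minus)
  qed
  have "(\<integral>\<^sup>+t\<in>{0..}. ennreal (exp (- a * t ^ k)) \<partial>lborel) =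
      ennreal \<bar>c\<bar> * (\<integral>\<^sup>+x. ennreal (exp (- a * (0 + c * x) ^ k)) * indicator {0..} (0 + c * x) \<partial>lborel)"
    using c by (intro nn_integral_real_affine) auto
  also have "(\<integral>\<^sup>+x. ennreal (exp (- a * (0 + c * x) ^ k)) * indicator {0..} (0 + c * x) \<partial>lborel) =
      (\<integral>\<^sup>+x\<in>{0..}. ennreal (exp (- (x ^ k))) \<partial>lborel)"
    using c by (intro nn_integral_cong) (auto simp: ck zero_le_mult_iff split: split_indicator)
  also have "\<dots> = ennreal (Gamma (1 + 1 / real k))"
    by (rule nn_integral_exp_power[OF k])
  also have "ennreal \<bar>c\<bar> * \<dots> = ennreal (c * Gamma (1 + 1 / real k))"
    using c by (simp add: ennreal_mult')
  finally show ?thesis by (simp add: c_def)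
qed

text \<open>
  With \<open>t = s + r\<close> the left-hand side is twice the integral of \<open>g s * g t\<close> over \<open>0 \<le> s \<le> t\<close>, which is half of a
  symmetric integral over the quadrant.
\<close>

lemma nn_integral_triangle:
  fixes g :: "real \<Rightarrow> real"
  assumes [measurable]: "g \<in> borel_measurable borel" and g: "\<And>x. 0 \<le> g x"
  shows "2 * (\<integral>\<^sup>+r\<in>{0..}. (\<integral>\<^sup>+s\<in>{0..}. ennreal (g s * g (s + r)) \<partial>lborel) \<partial>lborel) =
    (\<integral>\<^sup>+s\<in>{0..}. ennreal (g s) \<partial>lborel)\<^sup>2"
proof -
  define G where "G = (\<lambda>x. ennreal (g x) * indicator {0..} x)"
  have [measurable]: "G \<in> borel_measurable borel" unfolding G_def by measurable
  let ?I = "\<integral>\<^sup>+s. (\<integral>\<^sup>+t. G s * G t * indicator {s..} t \<partial>lborel) \<partial>lborel"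
  have "(\<integral>\<^sup>+r\<in>{0..}. (\<integral>\<^sup>+s\<in>{0..}. ennreal (g s * g (s + r)) \<partial>lborel) \<partial>lborel) =
      (\<integral>\<^sup>+r. (\<integral>\<^sup>+s. G s * (G (s + r) * indicator {0..} r) \<partial>lborel) \<partial>lborel)"
  proof (intro nn_integral_cong)
    fix r :: real
    have "(\<integral>\<^sup>+s\<in>{0..}. ennreal (g s * g (s + r)) \<partial>lborel) * indicator {0..} r =
        (\<integral>\<^sup>+s. ennreal (g s * g (s + r)) * indicator {0..} s * indicator {0..} r \<partial>lborel)"
      by (rule nn_integral_multc[symmetric]) measurable
    also have "\<dots> = (\<integral>\<^sup>+s. G s * (G (s + r) * indicator {0..} r) \<partial>lborel)"
      by (intro nn_integral_cong) (auto simp: G_def ennreal_mult g split: split_indicator)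
    finally show "(\<integral>\<^sup>+s\<in>{0..}. ennreal (g s * g (s + r)) \<partial>lborel) * indicator {0..} r =
        (\<integral>\<^sup>+s. G s * (G (s + r) * indicator {0..} r) \<partial>lborel)" .
  qed
  also have "\<dots> = (\<integral>\<^sup>+s. (\<integral>\<^sup>+r. G s * (G (s + r) * indicator {0..} r) \<partial>lborel) \<partial>lborel)"
    by (rule lborel_pair.Fubini'[symmetric]) measurable
  also have "\<dots> = ?I"
  proof (rule nn_integral_cong)
    fix s :: real
    have "(\<integral>\<^sup>+t. G s * G t * indicator {s..} t \<partial>lborel) =
        ennreal \<bar>1\<bar> * (\<integral>\<^sup>+r. G s * G (s + 1 * r) * indicator {s..} (s + 1 * r) \<partial>lborel)"
      by (rule nn_integral_real_affine) auto
    also have "\<dots> = (\<integral>\<^sup>+r. G s * (G (s + r) * indicator {0..} r) \<partial>lborel)"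
      by (auto intro!: nn_integral_cong split: split_indicator)
    finally show "(\<integral>\<^sup>+r. G s * (G (s + r) * indicator {0..} r) \<partial>lborel) =
        (\<integral>\<^sup>+t. G s * G t * indicator {s..} t \<partial>lborel)" ..
  qed
  finally have I: "(\<integral>\<^sup>+r\<in>{0..}. (\<integral>\<^sup>+s\<in>{0..}. ennreal (g s * g (s + r)) \<partial>lborel) \<partial>lborel) = ?I" .
  have ind: "(indicator {s..} t :: ennreal) = (if s \<le> t then 1 else 0)" for s t :: real
    by simp
  \<comment> \<open>Exchanging the order of integration reflects the triangle at the diagonal.\<close>
  have "?I = (\<integral>\<^sup>+t. (\<integral>\<^sup>+s. G s * G t * indicator {s..} t \<partial>lborel) \<partial>lborel)"
    unfolding ind by (rule lborel_pair.Fubini'[symmetric]) measurable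
  then have "2 * ?I = (\<integral>\<^sup>+s. (\<integral>\<^sup>+t. G s * G t * indicator {s..} t \<partial>lborel) \<partial>lborel) +
      (\<integral>\<^sup>+s. (\<integral>\<^sup>+t. G t * G s * indicator {t..} s \<partial>lborel) \<partial>lborel)"
    by (simp add: mult_2)
  also have "\<dots> = (\<integral>\<^sup>+s. (\<integral>\<^sup>+t. G s * G t * indicator {s..} t + G t * G s * indicator {t..} s \<partial>lborel) \<partial>lborel)"
    unfolding ind by (subst nn_integral_add[symmetric]) (auto simp: nn_integral_add)
  also have "\<dots> = (\<integral>\<^sup>+s. (\<integral>\<^sup>+t. G s * G t \<partial>lborel) \<partial>lborel)"
  proof (rule nn_integral_cong, rule nn_integral_cong_AE)
    fix s :: real
    show "AE t in lborel. G s * G t * indicator {s..} t + G t * G s * indicator {t..} s = G s * G t"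
      using AE_lborel_singleton[of s] by eventually_elim (auto simp: mult.commute split: split_indicator)
  qed
  also have "\<dots> = (\<integral>\<^sup>+s\<in>{0..}. ennreal (g s) \<partial>lborel)\<^sup>2"
    by (simp add: nn_integral_cmult nn_integral_multc power2_eq_square G_def)
  finally show ?thesis unfolding I .
qed

lemma nn_integral_exp_half: "(\<integral>\<^sup>+t\<in>{0..}. ennreal (exp (- (t / 2))) \<partial>lborel) = 2"
proof -
  have "((\<lambda>t. - 2 * exp (- (t / 2))) \<longlongrightarrow> - 2 * (0::real)) at_top"
    by (intro tendsto_mult tendsto_const) real_asymp
  then have lim: "((\<lambda>t. - 2 * exp (- (t / 2))) \<longlongrightarrow> (0::real)) at_top" by simp
  have "(\<integral>\<^sup>+t\<in>{0..}. ennreal (exp (- (t / 2))) \<partial>lborel) = ennreal (0 - (- 2 * exp (- (0 / 2))))"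
    by (rule nn_integral_FTC_atLeast[OF _ _ _ lim]) (auto intro!: derivative_eq_intros)
  then show ?thesis by simp
qed

lemma nn_integral_surv_shift_le:
  "(\<integral>\<^sup>+r\<in>{0..}. (\<integral>\<^sup>+s\<in>{0..}. ennreal (surv k (s + r)) \<partial>lborel) \<partial>lborel) \<le> ennreal (4 * 2 ^ k)"
proof -
  have "(\<integral>\<^sup>+r\<in>{0..}. (\<integral>\<^sup>+s\<in>{0..}. ennreal (surv k (s + r)) \<partial>lborel) \<partial>lborel) \<le>
      (\<integral>\<^sup>+r\<in>{0..}. (\<integral>\<^sup>+s\<in>{0..}. ennreal (2 ^ k * exp (- (r / 2))) * ennreal (exp (- (s / 2))) \<partial>lborel) \<partial>lborel)"
  proof (intro nn_integral_mono)
    fix r :: real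
    have *: "ennreal (surv k (s + r)) \<le> ennreal (2 ^ k * exp (- (r / 2))) * ennreal (exp (- (s / 2)))"
      if "0 \<le> r" "0 \<le> s" for s
    proof -
      have "surv k (s + r) \<le> 2 ^ k * exp (- ((s + r) / 2))"
        using that by (intro surv_exp_bound) simp
      also have "exp (- ((s + r) / 2)) = exp (- (r / 2)) * exp (- (s / 2))"
        by (simp add: add_divide_distrib flip: exp_add)
      finally show ?thesis by (simp add: mult.assoc ennreal_leI flip: ennreal_mult)
    qed
    show "(\<integral>\<^sup>+s\<in>{0..}. ennreal (surv k (s + r)) \<partial>lborel) * indicator {0..} r \<le>
        (\<integral>\<^sup>+s\<in>{0..}. ennreal (2 ^ k * exp (- (r / 2))) * ennreal (exp (- (s / 2))) \<partial>lborel) * indicator {0..} r"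
      by (auto intro!: nn_integral_mono * split: split_indicator)
  qed
  also have "\<dots> = (\<integral>\<^sup>+r. (ennreal (2 ^ k) * 2) * (ennreal (exp (- (r / 2))) * indicator {0..} r) \<partial>lborel)"
  proof (intro nn_integral_cong)
    fix r :: real
    have "(\<integral>\<^sup>+s\<in>{0..}. C * ennreal (exp (- (s / 2))) \<partial>lborel) = C * 2" for C :: ennreal
      by (simp add: nn_integral_cmult nn_integral_exp_half mult.assoc)
    then show "(\<integral>\<^sup>+s\<in>{0..}. ennreal (2 ^ k * exp (- (r / 2))) * ennreal (exp (- (s / 2))) \<partial>lborel) *
        indicator {0..} r = (ennreal (2 ^ k) * 2) * (ennreal (exp (- (r / 2))) * indicator {0..} r)"
      by (simp only: ennreal_mult'' exp_ge_zero) (simp add: mult_ac)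
  qed
  also have "\<dots> = ennreal (2 ^ k) * 2 * 2"
    by (simp add: nn_integral_cmult nn_integral_exp_half)
  also have "\<dots> = ennreal (4 * 2 ^ k)"
    by (simp add: ennreal_mult' mult_ac flip: mult.assoc)
  finally show ?thesis .
qed

section \<open>Asymptotics\<close>

text \<open>
  The estimate \<open>expectation_pair_survival_le\<close>, integrated over \<open>s\<close> and \<open>r\<close> with \<open>t = s + r\<close>.
\<close>

definition second_moment_bound :: "nat \<Rightarrow> real \<Rightarrow> nat \<Rightarrow> real" where
  "second_moment_bound k tau n =
    (let x = surv k tau; l = ln ((real n + 2) / 3); N = real n * (real n + 1) / 2 in
      (1 + x) / x * N * ((exp (- tau) / (2 * fact k) * l) powr (- 1 / real k) * Gamma (1 + 1 / real k))\<^sup>2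
      + (2 * real n + 1 + 3 / x * N * exp (- (1 - x) / 2 * l)) * (8 * 2 ^ k))"

text \<open>
  The mean, restricted to times up to \<open>tau\<close>, where \<open>1 - surv k t \<le> t ^ k / k!\<close> is sharp enough. The subtracted
  term dominates the part of the integral of \<open>exp (- a * t ^ k)\<close> beyond \<open>tau\<close>.
\<close>

definition mean_bound :: "nat \<Rightarrow> real \<Rightarrow> nat \<Rightarrow> real" where
  "mean_bound k tau n =
    (let a = ln (real n) / (2 * fact k * (1 - (1 - surv k tau) / 2)) in
      exp (- 2 * tau) * real n * (a powr (- 1 / real k) * Gamma (1 + 1 / real k)
        - exp (- (a / 2) * tau ^ k) * ((a / 2) powr (- 1 / real k) * Gamma (1 + 1 / real k))))"

lemma second_moment_le:
  assumes k: "k \<ge> 1" and n: "n \<ge> 2" and tau: "0 < tau"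
  shows "(\<integral>\<^sup>+m. of_nat (m * Suc m) \<partial>measure_pmf (k_cut_number_scale_free k n)) \<le>
    ennreal (second_moment_bound k tau n)"
proof -
  define x where "x = surv k tau"
  define l where "l = ln ((real n + 2) / 3)"
  define a where "a = exp (- tau) / (2 * fact k) * l"
  define g where "g = (\<lambda>s. exp (- a * s ^ k))"
  define B1 where "B1 = (1 + x) / x * (real n * (real n + 1) / 2)"
  define B2 where "B2 = 2 * real n + 1 + 3 / x * (real n * (real n + 1) / 2) * exp (- (1 - x) / 2 * l)"
  let ?E = "\<lambda>r s. sf_expectation n (\<lambda>T. pair_survival_mass k T (\<lambda>_. 0) s (s + r))"
  let ?gam = "Gamma (1 + 1 / real k)"
  have l: "l > 0" using n by (simp add: l_def)
  have a: "a > 0" using l by (simp add: a_def)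
  have x: "x > 0"
    using surv_pos[of tau k] tau k less_le_trans[OF exp_gt_zero] by (auto simp: x_def)
  have B: "0 \<le> B1" "0 \<le> B2" using x by (auto simp: B1_def B2_def intro!: add_nonneg_nonneg)
  have [measurable]: "g \<in> borel_measurable borel" "surv k \<in> borel_measurable borel"
    unfolding g_def by (intro borel_measurable_continuous_onI continuous_intros)+
  have g0: "0 \<le> g s" for s by (simp add: g_def)
  have pt: "ennreal (?E r s) \<le> ennreal B1 * ennreal (g s * g (s + r)) + ennreal B2 * ennreal (surv k (s + r))"
    if "0 \<le> r" "0 \<le> s" for r s
  proof -
    have "?E r s \<le> B1 * (g s * g (s + r)) + B2 * surv k (s + r)"
      using expectation_pair_survival_le[of k n tau s "s + r"] k n tau that
      unfolding B1_def B2_def g_def a_def l_def x_def by simp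
    then have "ennreal (?E r s) \<le> ennreal (B1 * (g s * g (s + r)) + B2 * surv k (s + r))"
      by (rule ennreal_leI)
    also have "\<dots> = ennreal B1 * ennreal (g s * g (s + r)) + ennreal B2 * ennreal (surv k (s + r))"
      using B g0 that surv_nonneg[of "s + r" k] by (simp add: ennreal_mult)
    finally show ?thesis .
  qed
  have "(\<integral>\<^sup>+m. of_nat (m * Suc m) \<partial>measure_pmf (k_cut_number_scale_free k n)) =
      2 * (\<integral>\<^sup>+r\<in>{0..}. (\<integral>\<^sup>+s\<in>{0..}. ennreal (?E r s) \<partial>lborel) \<partial>lborel)"
    using scale_free_cuts_second_moment[of k n] k n by simp
  also have "\<dots> \<le> 2 * (\<integral>\<^sup>+r\<in>{0..}. (\<integral>\<^sup>+s\<in>{0..}. (ennreal B1 * ennreal (g s * g (s + r)) +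
      ennreal B2 * ennreal (surv k (s + r))) \<partial>lborel) \<partial>lborel)"
    by (intro mult_left_mono nn_integral_mono) (auto intro!: nn_integral_mono pt split: split_indicator)
  also have "(\<integral>\<^sup>+r\<in>{0..}. (\<integral>\<^sup>+s\<in>{0..}. (ennreal B1 * ennreal (g s * g (s + r)) +
      ennreal B2 * ennreal (surv k (s + r))) \<partial>lborel) \<partial>lborel) =
      ennreal B1 * (\<integral>\<^sup>+r\<in>{0..}. (\<integral>\<^sup>+s\<in>{0..}. ennreal (g s * g (s + r)) \<partial>lborel) \<partial>lborel) +
      ennreal B2 * (\<integral>\<^sup>+r\<in>{0..}. (\<integral>\<^sup>+s\<in>{0..}. ennreal (surv k (s + r)) \<partial>lborel) \<partial>lborel)"
    by (simp add: distrib_right mult.assoc nn_integral_add nn_integral_cmult)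
  also have "2 * \<dots> = ennreal B1 * (2 * (\<integral>\<^sup>+r\<in>{0..}. (\<integral>\<^sup>+s\<in>{0..}. ennreal (g s * g (s + r)) \<partial>lborel) \<partial>lborel)) +
      ennreal B2 * (2 * (\<integral>\<^sup>+r\<in>{0..}. (\<integral>\<^sup>+s\<in>{0..}. ennreal (surv k (s + r)) \<partial>lborel) \<partial>lborel))"
    by (simp only: distrib_left mult.left_commute)
  also have "2 * (\<integral>\<^sup>+r\<in>{0..}. (\<integral>\<^sup>+s\<in>{0..}. ennreal (g s * g (s + r)) \<partial>lborel) \<partial>lborel) =
      ennreal ((a powr (- 1 / real k) * ?gam)\<^sup>2)"
  proof -
    have "(\<integral>\<^sup>+s\<in>{0..}. ennreal (g s) \<partial>lborel) = ennreal (a powr (- 1 / real k) * ?gam)"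
      unfolding g_def by (rule nn_integral_exp_scaled_power[OF k a])
    moreover have "?gam > 0" by (simp add: Gamma_real_pos add_pos_nonneg)
    ultimately show ?thesis
      using nn_integral_triangle[of g] g0 by (simp add: ennreal_power less_imp_le)
  qed
  also have "ennreal B1 * ennreal ((a powr (- 1 / real k) * ?gam)\<^sup>2) +
      ennreal B2 * (2 * (\<integral>\<^sup>+r\<in>{0..}. (\<integral>\<^sup>+s\<in>{0..}. ennreal (surv k (s + r)) \<partial>lborel) \<partial>lborel)) \<le>
      ennreal B1 * ennreal ((a powr (- 1 / real k) * ?gam)\<^sup>2) + ennreal B2 * (2 * ennreal (4 * 2 ^ k))"
    by (intro add_left_mono mult_left_mono nn_integral_surv_shift_le) auto
  also have "\<dots> = ennreal (B1 * (a powr (- 1 / real k) * ?gam)\<^sup>2 + B2 * (8 * 2 ^ k))"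
  proof -
    have "2 * ennreal (4 * 2 ^ k) = ennreal (8 * 2 ^ k)"
      by (subst ennreal_numeral[symmetric], subst ennreal_mult[symmetric]) auto
    then show ?thesis using B by (simp add: ennreal_mult)
  qed
  also have "B1 * (a powr (- 1 / real k) * ?gam)\<^sup>2 + B2 * (8 * 2 ^ k) = second_moment_bound k tau n"
    by (simp only: second_moment_bound_def Let_def B1_def B2_def a_def l_def x_def)
  finally show ?thesis .
qed

lemma mean_ge:
  assumes k: "k \<ge> 1" and n: "n \<ge> 2" and tau: "0 < tau"
    and m: "(\<integral>\<^sup>+m. of_nat m \<partial>measure_pmf (k_cut_number_scale_free k n)) = ennreal m1" and m1: "0 \<le> m1"
  shows "mean_bound k tau n \<le> m1"
proof -
  define x where "x = surv k tau"
  define q where "q = (1 - x) / 2"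
  define a where "a = ln (real n) / (2 * fact k * (1 - q))"
  define C where "C = exp (- 2 * tau) * real n"
  let ?gam = "Gamma (1 + 1 / real k)"
  have x: "0 < x" "x \<le> 1"
    using surv_pos[of tau k] surv_le_1[of tau k] tau k less_le_trans[OF exp_gt_zero] by (auto simp: x_def)
  have q: "0 \<le> q" "q < 1" using x by (auto simp: q_def)
  have L: "ln (real n) > 0" using n by simp
  have a: "a > 0" using L q by (simp add: a_def)
  have C: "0 \<le> C" by (simp add: C_def)
  have gam: "?gam > 0" by (simp add: Gamma_real_pos add_pos_nonneg)
  have pt: "C * exp (- a * t ^ k) \<le> sf_expectation n (\<lambda>T. survival_mass k T (\<lambda>_. 0) t)"
    if t: "0 \<le> t" "t \<le> tau" for t
  proof -
    define z where "z = surv k t"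
    define w where "w = (1 - z) / 2"
    have z: "0 \<le> z" "z \<le> 1" "x \<le> z"
      using t by (auto simp: z_def x_def intro!: surv_nonneg surv_le_1 surv_antimono)
    have w: "0 \<le> w" "w \<le> q" using z by (auto simp: w_def q_def)
    have "w / (1 - w) \<le> w / (1 - q)"
      using w q by (intro divide_left_mono) auto
    also have "\<dots> \<le> (t ^ k / (2 * fact k)) / (1 - q)"
      using one_minus_surv_le[of t k] t q by (intro divide_right_mono) (auto simp: w_def z_def field_simps)
    finally have "w / (1 - w) * ln (real n) \<le> (t ^ k / (2 * fact k)) / (1 - q) * ln (real n)"
      using L by (intro mult_right_mono) auto
    also have "\<dots> = a * t ^ k" by (simp add: a_def)
    finally have e: "exp (- a * t ^ k) \<le> exp (- (w / (1 - w)) * ln (real n))" by simp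
    have "exp (- t) \<le> z" using surv_pos[of t k] t k by (simp add: z_def)
    then have "exp (- tau) \<le> z" using t order_trans[of "exp (- tau)" "exp (- t)" z] by simp
    then have "(exp (- tau))\<^sup>2 \<le> z\<^sup>2" by (intro power_mono) auto
    then have z2: "exp (- 2 * tau) \<le> z\<^sup>2" by (simp add: exp_double[symmetric])
    have "C * exp (- a * t ^ k) = exp (- 2 * tau) * (real n * exp (- a * t ^ k))"
      by (simp add: C_def)
    also have "\<dots> \<le> z\<^sup>2 * (real n * exp (- (w / (1 - w)) * ln (real n)))"
      using z2 e by (intro mult_mono) auto
    also have "\<dots> \<le> z\<^sup>2 * (\<Prod>j\<in>{1..<n}. 1 + (1 + z) / (2 * real j))"
      using n z by (intro mult_left_mono growth_product_lower w_def) auto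
    also have "\<dots> = sf_expectation n (depth_gf z)"
      using n by (simp add: expectation_depth_gf)
    also have "\<dots> \<le> sf_expectation n (\<lambda>T. survival_mass k T (\<lambda>_. 0) t)"
      using n z scale_free_tree_grown[of n]
      by (intro sf_expectation_mono) (auto simp: survival_mass_fresh z_def)
    finally show ?thesis .
  qed
  \<comment> \<open>Half of the exponent provides smallness, the other half integrability.\<close>
  have tail: "exp (- a * t ^ k) \<le> exp (- (a / 2) * tau ^ k) * exp (- (a / 2) * t ^ k)" if "tau \<le> t" for t
  proof -
    have "a / 2 * tau ^ k \<le> a / 2 * t ^ k"
      using that tau a by (intro mult_left_mono power_mono) auto
    then show ?thesis by (simp flip: exp_add)
  qed
  let ?D = "C * exp (- (a / 2) * tau ^ k)"
  have "ennreal (C * (a powr (- 1 / real k) * ?gam)) = ennreal C * (\<integral>\<^sup>+t\<in>{0..}. ennreal (exp (- a * t ^ k)) \<partial>lborel)"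
    using C by (simp only: nn_integral_exp_scaled_power[OF k a] ennreal_mult')
  also have "\<dots> = (\<integral>\<^sup>+t. ennreal C * (ennreal (exp (- a * t ^ k)) * indicator {0..} t) \<partial>lborel)"
    by (rule nn_integral_cmult[symmetric]) measurable
  also have "\<dots> \<le> (\<integral>\<^sup>+t. ennreal (sf_expectation n (\<lambda>T. survival_mass k T (\<lambda>_. 0) t)) * indicator {0..} t +
      ennreal ?D * (ennreal (exp (- (a / 2) * t ^ k)) * indicator {0..} t) \<partial>lborel)"
  proof (rule nn_integral_mono)
    fix t :: real
    consider "t < 0" | "0 \<le> t" "t \<le> tau" | "tau < t" by linarith
    then show "ennreal C * (ennreal (exp (- a * t ^ k)) * indicator {0..} t) \<le>
      ennreal (sf_expectation n (\<lambda>T. survival_mass k T (\<lambda>_. 0) t)) * indicator {0..} t +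
      ennreal ?D * (ennreal (exp (- (a / 2) * t ^ k)) * indicator {0..} t)"
    proof cases
      case 2
      have "ennreal C * ennreal (exp (- a * t ^ k)) = ennreal (C * exp (- a * t ^ k))"
        using C by (simp add: ennreal_mult')
      also have "\<dots> \<le> ennreal (sf_expectation n (\<lambda>T. survival_mass k T (\<lambda>_. 0) t))"
        by (intro ennreal_leI pt 2)
      finally show ?thesis using 2 by (simp add: add_increasing2)
    next
      case 3
      have "ennreal C * ennreal (exp (- a * t ^ k)) = ennreal (C * exp (- a * t ^ k))"
        using C by (simp add: ennreal_mult')
      also have "\<dots> \<le> ennreal (C * (exp (- (a / 2) * tau ^ k) * exp (- (a / 2) * t ^ k)))"
        using C 3 by (intro ennreal_leI mult_left_mono tail) auto
      also have "\<dots> = ennreal ?D * ennreal (exp (- (a / 2) * t ^ k))"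
        using C by (simp add: mult.assoc flip: ennreal_mult)
      finally show ?thesis using 3 tau by (simp add: add_increasing)
    qed simp
  qed
  also have "\<dots> = (\<integral>\<^sup>+t\<in>{0..}. ennreal (sf_expectation n (\<lambda>T. survival_mass k T (\<lambda>_. 0) t)) \<partial>lborel) +
      (\<integral>\<^sup>+t. ennreal ?D * (ennreal (exp (- (a / 2) * t ^ k)) * indicator {0..} t) \<partial>lborel)"
  proof (rule nn_integral_add)
    have "(\<lambda>t. sf_expectation n (\<lambda>T. survival_mass k T (\<lambda>_. 0) t)) =
        (\<lambda>t. \<Sum>T\<in>set_pmf (scale_free_tree n). pmf (scale_free_tree n) T *\<^sub>R survival_mass k T (\<lambda>_. 0) t)"
      by (intro ext integral_measure_pmf) (auto simp: finite_set_scale_free_tree)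
    also have "\<dots> \<in> borel_measurable borel"
      unfolding survival_mass_def by (intro borel_measurable_continuous_onI continuous_intros)
    finally show "(\<lambda>t. ennreal (sf_expectation n (\<lambda>T. survival_mass k T (\<lambda>_. 0) t)) * indicator {0..} t)
        \<in> borel_measurable lborel" by measurable
  qed measurable
  also have "(\<integral>\<^sup>+t\<in>{0..}. ennreal (sf_expectation n (\<lambda>T. survival_mass k T (\<lambda>_. 0) t)) \<partial>lborel) = ennreal m1"
    using scale_free_cuts_mean[of k n] k n m by simp
  also have "(\<integral>\<^sup>+t. ennreal ?D * (ennreal (exp (- (a / 2) * t ^ k)) * indicator {0..} t) \<partial>lborel) =
      ennreal ?D * (\<integral>\<^sup>+t\<in>{0..}. ennreal (exp (- (a / 2) * t ^ k)) \<partial>lborel)"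
    by (rule nn_integral_cmult) measurable
  also have "(\<integral>\<^sup>+t\<in>{0..}. ennreal (exp (- (a / 2) * t ^ k)) \<partial>lborel) = ennreal ((a / 2) powr (- 1 / real k) * ?gam)"
    using a by (intro nn_integral_exp_scaled_power k) simp
  also have "ennreal m1 + ennreal ?D * \<dots> = ennreal (m1 + ?D * ((a / 2) powr (- 1 / real k) * ?gam))"
    using m1 C gam by (simp add: ennreal_mult)
  finally have "C * (a powr (- 1 / real k) * ?gam) \<le> m1 + ?D * ((a / 2) powr (- 1 / real k) * ?gam)"
    using m1 C gam by (subst (asm) ennreal_le_iff) auto
  moreover have "mean_bound k tau n = C * (a powr (- 1 / real k) * ?gam
      - exp (- (a / 2) * tau ^ k) * ((a / 2) powr (- 1 / real k) * ?gam))"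
    unfolding mean_bound_def Let_def C_def a_def q_def x_def ..
  ultimately show ?thesis
    by (simp only: right_diff_distrib mult.assoc)
qed

lemma moments_real:
  assumes k: "k \<ge> 1" and n: "n \<ge> 2" and tau: "0 < tau"
  defines "p \<equiv> measure_pmf (k_cut_number_scale_free k n)"
  shows "integrable p (\<lambda>m. real m)" "integrable p (\<lambda>m. (real m)\<^sup>2)"
    "mean_bound k tau n \<le> (\<integral>m. real m \<partial>p)" "(\<integral>m. (real m)\<^sup>2 \<partial>p) \<le> second_moment_bound k tau n"
proof -
  have fin: "(\<integral>\<^sup>+m. ennreal (real (m * Suc m)) \<partial>p) \<le> ennreal (second_moment_bound k tau n)"
    using second_moment_le[OF k n tau] unfolding p_def ennreal_of_nat_eq_real_of_nat .
  have int: "integrable p (\<lambda>m. real (m * Suc m))"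
  proof (rule integrableI_bounded)
    show "(\<integral>\<^sup>+m. ennreal (norm (real (m * Suc m))) \<partial>p) < \<infinity>"
      using le_less_trans[OF fin] by (simp del: of_nat_mult)
  qed (simp add: p_def)
  show int1: "integrable p (\<lambda>m. real m)"
    by (rule Bochner_Integration.integrable_bound[OF int]) (auto simp: p_def)
  show int2: "integrable p (\<lambda>m. (real m)\<^sup>2)"
    by (rule Bochner_Integration.integrable_bound[OF int]) (auto simp: p_def power2_eq_square algebra_simps)
  have "(\<integral>\<^sup>+m. of_nat m \<partial>measure_pmf (k_cut_number_scale_free k n)) = ennreal (\<integral>m. real m \<partial>p)"
    using nn_integral_eq_integral[OF int1] by (simp add: p_def ennreal_of_nat_eq_real_of_nat)
  then show "mean_bound k tau n \<le> (\<integral>m. real m \<partial>p)"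
    by (rule mean_ge[OF k n tau]) simp
  have "(\<integral>m. (real m)\<^sup>2 \<partial>p) \<le> (\<integral>m. real (m * Suc m) \<partial>p)"
    by (intro integral_mono int int2) (simp add: power2_eq_square algebra_simps)
  also have "\<dots> \<le> second_moment_bound k tau n"
  proof -
    have "0 < second_moment_bound k tau n"
    proof -
      have x: "surv k tau > 0"
        using surv_pos[of tau k] tau k less_le_trans[OF exp_gt_zero] by auto
      show ?thesis
        unfolding second_moment_bound_def Let_def using x
        by (intro add_nonneg_pos mult_pos_pos add_pos_nonneg mult_nonneg_nonneg) auto
    qed
    then show ?thesis
      using fin nn_integral_eq_integral[OF int] by (simp del: of_nat_mult)
  qed
  finally show "(\<integral>m. (real m)\<^sup>2 \<partial>p) \<le> second_moment_bound k tau n" .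
qed

definition cut_scale :: "nat \<Rightarrow> nat \<Rightarrow> real" where
  "cut_scale k n = 2 powr (- 1 / real k) * inverse (real n) * (ln (real n)) powr (1 / real k)"

lemma cut_scale_mult: "n \<ge> 1 \<Longrightarrow> cut_scale k n * real n = 2 powr (- 1 / real k) * ln (real n) powr (1 / real k)"
  by (simp add: cut_scale_def)

lemma scale_powr:
  fixes c L :: real
  assumes "c > 0" "L > 0"
  shows "2 powr (- 1 / k) * L powr (1 / k) * c powr (- 1 / k) = (2 * (c / L)) powr (- 1 / k)"
  using assms by (simp add: powr_mult powr_divide powr_minus_divide field_simps)

lemma scaled_second_moment_tendsto:
  assumes k: "k \<ge> 2" and tau: "0 < tau"
  shows "(\<lambda>n. (cut_scale k n)\<^sup>2 * second_moment_bound k tau n) \<longlonglongrightarrow>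
    (1 + surv k tau) / (2 * surv k tau) * ((exp (- tau) / fact k) powr (- 1 / real k) * Gamma (1 + 1 / real k))\<^sup>2"
proof -
  define x where "x = surv k tau"
  define c where "c = exp (- tau) / (2 * fact k)"
  define l where "l = (\<lambda>n. ln ((real n + 2) / 3))"
  define del where "del = (1 - x) / 2"
  let ?gam = "Gamma (1 + 1 / real k)"
  let ?B2 = "\<lambda>n. 2 * real n + 1 + 3 / x * (real n * (real n + 1) / 2) * exp (- (1 - x) / 2 * l n)"
  have c: "c > 0" by (simp add: c_def)
  have x: "x > 0"
    using surv_pos[of tau k] tau k less_le_trans[OF exp_gt_zero] by (auto simp: x_def)
  have "0 < 1 - surv k tau"
    by (rule less_le_trans[OF _ one_minus_surv_ge]) (use tau in auto)
  then have del: "del > 0" by (simp add: del_def x_def)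
  have main: "(cut_scale k n)\<^sup>2 * second_moment_bound k tau n =
      (1 + x) / (2 * x) * ((real n + 1) / real n) *
        ((2 * (c * l n / ln (real n))) powr (- 1 / real k) * ?gam)\<^sup>2 +
      (cut_scale k n)\<^sup>2 * ?B2 n * (8 * 2 ^ k)" if n: "n \<ge> 2" for n
  proof -
    have l: "l n > 0" and L: "ln (real n) > 0" using n by (simp_all add: l_def)
    have s: "cut_scale k n * real n * (c * l n) powr (- 1 / real k) = (2 * (c * l n / ln (real n))) powr (- 1 / real k)"
    proof -
      have "cut_scale k n * real n = 2 powr (- 1 / real k) * ln (real n) powr (1 / real k)"
        using n by (intro cut_scale_mult) simp
      then show ?thesis
        using scale_powr[of "c * l n" "ln (real n)" "real k"] l L c by (simp only: mult_pos_pos)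
    qed
    have "(cut_scale k n)\<^sup>2 * ((1 + x) / x * (real n * (real n + 1) / 2) * ((c * l n) powr (- 1 / real k) * ?gam)\<^sup>2)
        = (1 + x) / (2 * x) * ((real n + 1) / real n) *
          (cut_scale k n * real n * (c * l n) powr (- 1 / real k) * ?gam)\<^sup>2"
    proof -
      have "A\<^sup>2 * ((1 + x) / x * (N * (N + 1) / 2) * (P * ?gam)\<^sup>2)
          = (1 + x) / (2 * x) * ((N + 1) / N) * (A * N * P * ?gam)\<^sup>2" if "N \<noteq> 0" for A N P
        using that x by (simp add: power2_eq_square field_simps)
      then show ?thesis using n by simp
    qed
    moreover have "\<alpha> * (X + Y * Z) = W + \<alpha> * Y * Z" if "\<alpha> * X = W" for \<alpha> X Y Z W :: real
      using that by (simp add: distrib_left)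
    ultimately show ?thesis
      unfolding s unfolding second_moment_bound_def Let_def x_def[symmetric] c_def[symmetric] l_def
      by blast
  qed
  have lim1: "(\<lambda>n. (1 + x) / (2 * x) * ((real n + 1) / real n) *
        ((2 * (c * l n / ln (real n))) powr (- 1 / real k) * ?gam)\<^sup>2) \<longlonglongrightarrow>
      (1 + x) / (2 * x) * 1 * ((2 * c) powr (- 1 / real k) * ?gam)\<^sup>2"
  proof -
    have "(\<lambda>n. l n / ln (real n)) \<longlonglongrightarrow> 1"
      unfolding l_def by real_asymp
    then have "(\<lambda>n. 2 * (c * (l n / ln (real n)))) \<longlonglongrightarrow> 2 * (c * 1)"
      by (intro tendsto_intros)
    then have "(\<lambda>n. (2 * (c * l n / ln (real n))) powr (- 1 / real k)) \<longlonglongrightarrow> (2 * c) powr (- 1 / real k)"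
      using c by (intro tendsto_powr tendsto_const) auto
    moreover have "(\<lambda>n. (real n + 1) / real n) \<longlonglongrightarrow> 1"
      by real_asymp
    ultimately show ?thesis
      by (intro tendsto_mult tendsto_power tendsto_const) assumption+
  qed
  have lim2: "(\<lambda>n. (cut_scale k n)\<^sup>2 * ?B2 n) \<longlonglongrightarrow> 0"
  proof (rule tendsto_sandwich[of "\<lambda>_. 0" _ _ "\<lambda>n. inverse ((real n)\<^sup>2) * ln (real n) * ?B2 n"])
    show "\<forall>\<^sub>F n in sequentially. 0 \<le> (cut_scale k n)\<^sup>2 * ?B2 n"
      using x by (auto intro!: always_eventually mult_nonneg_nonneg add_nonneg_nonneg)
    have "\<forall>\<^sub>F n in sequentially. 1 \<le> ln (real n)" by real_asymp
    then show "\<forall>\<^sub>F n in sequentially. (cut_scale k n)\<^sup>2 * ?B2 n \<le> inverse ((real n)\<^sup>2) * ln (real n) * ?B2 n"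
    proof eventually_elim
      case (elim n)
      \<comment> \<open>Since \<open>k \<ge> 2\<close>, the squared scale is at most \<open>ln n / n\<^sup>2\<close>.\<close>
      have "(ln (real n) powr (1 / real k))\<^sup>2 = ln (real n) powr (2 / real k)"
        using elim by (simp add: powr_power)
      also have "\<dots> \<le> ln (real n) powr 1"
        using elim k by (intro powr_mono) auto
      finally have 1: "(ln (real n) powr (1 / real k))\<^sup>2 \<le> ln (real n)"
        using elim by simp
      have "(2::real) powr (- 1 / real k) \<le> 2 powr 0"
        by (intro powr_mono) auto
      then have 2: "((2::real) powr (- 1 / real k))\<^sup>2 \<le> 1"
        by (simp add: power_le_one)
      have "(cut_scale k n)\<^sup>2 = (2 powr (- 1 / real k))\<^sup>2 * (inverse ((real n)\<^sup>2) * (ln (real n) powr (1 / real k))\<^sup>2)"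
        by (simp add: cut_scale_def power_mult_distrib power_inverse)
      also have "\<dots> \<le> 1 * (inverse ((real n)\<^sup>2) * ln (real n))"
        using 1 2 by (intro mult_mono) auto
      finally show ?case
        using x by (intro mult_right_mono) (auto intro!: add_nonneg_nonneg)
    qed
    show "(\<lambda>n. inverse ((real n)\<^sup>2) * ln (real n) * ?B2 n) \<longlonglongrightarrow> 0"
    proof -
      have "(\<lambda>n. inverse ((real n)\<^sup>2) * ln (real n) * (2 * real n + 1)) \<longlonglongrightarrow> 0"
        by real_asymp
      moreover have "(\<lambda>n. (real n + 1) / (2 * real n)) \<longlonglongrightarrow> 1 / 2"
        by real_asymp
      moreover have "(\<lambda>n. ln (real n) * exp (- del * ln ((real n + 2) / 3))) \<longlonglongrightarrow> 0"
        using del by real_asymp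
      ultimately have "(\<lambda>n. inverse ((real n)\<^sup>2) * ln (real n) * (2 * real n + 1)
          + 3 / x * ((real n + 1) / (2 * real n) * (ln (real n) * exp (- del * ln ((real n + 2) / 3))))) \<longlonglongrightarrow> 0 + 3 / x * (1 / 2 * 0)"
        by (intro tendsto_add tendsto_mult[OF tendsto_const] tendsto_mult)
      moreover have "\<forall>\<^sub>F n in sequentially. inverse ((real n)\<^sup>2) * ln (real n) * (2 * real n + 1)
          + 3 / x * ((real n + 1) / (2 * real n) * (ln (real n) * exp (- del * ln ((real n + 2) / 3)))) =
          inverse ((real n)\<^sup>2) * ln (real n) * ?B2 n"
        using eventually_gt_at_top[of 0]
      proof eventually_elim
        case (elim n)
        have "- (1 - x) / 2 = - del" by (simp only: del_def minus_divide_left)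
        have "inverse ((real n)\<^sup>2) * ln (real n) * (A + 3 / x * (real n * (real n + 1) / 2) * e) =
            inverse ((real n)\<^sup>2) * ln (real n) * A + 3 / x * ((real n + 1) / (2 * real n) * (ln (real n) * e))" for A e
          using elim x by (simp add: field_simps power2_eq_square)
        then show ?case
          unfolding \<open>- (1 - x) / 2 = - del\<close> l_def by simp
      qed
      ultimately show ?thesis
        by (simp add: Lim_transform_eventually)
    qed
  qed auto
  have "(\<lambda>n. (1 + x) / (2 * x) * ((real n + 1) / real n) *
        ((2 * (c * l n / ln (real n))) powr (- 1 / real k) * ?gam)\<^sup>2 +
      (cut_scale k n)\<^sup>2 * ?B2 n * (8 * 2 ^ k)) \<longlonglongrightarrow>
      (1 + x) / (2 * x) * 1 * ((2 * c) powr (- 1 / real k) * ?gam)\<^sup>2 + 0 * (8 * 2 ^ k)"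
    by (intro tendsto_add tendsto_mult lim1 lim2 tendsto_const)
  moreover have "\<forall>\<^sub>F n in sequentially. (1 + x) / (2 * x) * ((real n + 1) / real n) *
        ((2 * (c * l n / ln (real n))) powr (- 1 / real k) * ?gam)\<^sup>2 +
      (cut_scale k n)\<^sup>2 * ?B2 n * (8 * 2 ^ k) = (cut_scale k n)\<^sup>2 * second_moment_bound k tau n"
    using eventually_ge_at_top[of 2] by eventually_elim (rule main[symmetric])
  ultimately have "(\<lambda>n. (cut_scale k n)\<^sup>2 * second_moment_bound k tau n) \<longlonglongrightarrow>
      (1 + x) / (2 * x) * 1 * ((2 * c) powr (- 1 / real k) * ?gam)\<^sup>2 + 0 * (8 * 2 ^ k)"
    by (rule Lim_transform_eventually)
  then show ?thesis by (simp add: x_def c_def)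
qed

lemma scaled_mean_tendsto:
  assumes k: "k \<ge> 2" and tau: "0 < tau"
  shows "(\<lambda>n. cut_scale k n * mean_bound k tau n) \<longlonglongrightarrow>
    exp (- 2 * tau) * ((1 / (fact k * (1 - (1 - surv k tau) / 2))) powr (- 1 / real k) * Gamma (1 + 1 / real k))"
proof -
  define q where "q = (1 - surv k tau) / 2"
  define c where "c = 1 / (2 * fact k * (1 - q))"
  let ?gam = "Gamma (1 + 1 / real k)"
  have "q < 1"
    using surv_nonneg[of tau k] tau by (simp add: q_def)
  then have c: "c > 0" by (simp add: c_def)
  have s: "cut_scale k n * real n * (b * ln (real n)) powr (- 1 / real k) = (2 * b) powr (- 1 / real k)"
    if n: "n \<ge> 2" and b: "b > 0" for n b
  proof -
    have L: "ln (real n) > 0" using n by simp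
    have "cut_scale k n * real n = 2 powr (- 1 / real k) * ln (real n) powr (1 / real k)"
      using n by (intro cut_scale_mult) simp
    moreover have "b * ln (real n) / ln (real n) = b" using L by simp
    ultimately show ?thesis
      using scale_powr[of "b * ln (real n)" "ln (real n)" "real k"] L b by (simp only: mult_pos_pos)
  qed
  have main: "cut_scale k n * mean_bound k tau n = exp (- 2 * tau) * ((2 * c) powr (- 1 / real k) * ?gam
      - exp (- (c * tau ^ k / 2) * ln (real n)) * (c powr (- 1 / real k) * ?gam))" if n: "n \<ge> 2" for n
  proof -
    have "cut_scale k n * mean_bound k tau n = exp (- 2 * tau) *
        (cut_scale k n * real n * (c * ln (real n)) powr (- 1 / real k) * ?gam
        - exp (- (c * tau ^ k / 2) * ln (real n)) * (cut_scale k n * real n * (c / 2 * ln (real n)) powr (- 1 / real k) * ?gam))"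
      unfolding mean_bound_def Let_def q_def[symmetric]
      by (simp add: c_def algebra_simps)
    then show ?thesis
      using s[OF n c] s[OF n, of "c / 2"] c by simp
  qed
  have pos: "c * tau ^ k / 2 > 0" using c tau by simp
  have "(\<lambda>n. exp (- b * ln (real n))) \<longlonglongrightarrow> 0" if "b > 0" for b :: real
    using that by real_asymp
  from this[OF pos] have "(\<lambda>n. exp (- 2 * tau) * ((2 * c) powr (- 1 / real k) * ?gam
      - exp (- (c * tau ^ k / 2) * ln (real n)) * (c powr (- 1 / real k) * ?gam))) \<longlonglongrightarrow>
      exp (- 2 * tau) * ((2 * c) powr (- 1 / real k) * ?gam - 0 * (c powr (- 1 / real k) * ?gam))"
    by (intro tendsto_intros)
  moreover have "\<forall>\<^sub>F n in sequentially. exp (- 2 * tau) * ((2 * c) powr (- 1 / real k) * ?gam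
      - exp (- (c * tau ^ k / 2) * ln (real n)) * (c powr (- 1 / real k) * ?gam)) = cut_scale k n * mean_bound k tau n"
    using eventually_ge_at_top[of 2] by eventually_elim (rule main[symmetric])
  ultimately have "(\<lambda>n. cut_scale k n * mean_bound k tau n) \<longlonglongrightarrow>
      exp (- 2 * tau) * ((2 * c) powr (- 1 / real k) * ?gam - 0 * (c powr (- 1 / real k) * ?gam))"
    by (rule Lim_transform_eventually)
  then show ?thesis by (simp add: c_def q_def)
qed

text \<open>
  The mean square deviation from \<open>mu\<close> expands into the second moment minus \<open>2 mu\<close> times the first plus
  \<open>mu\<^sup>2\<close>, so an upper bound on the second moment and a lower bound on the first suffice. For each cut-off
  \<open>tau\<close> the resulting bound converges to some \<open>F tau\<close> as \<open>n\<close> grows, and \<open>F\<close> vanishes at \<open>0\<close>.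
\<close>

lemma mean_square_deviation_tendsto_0:
  assumes k: "k \<ge> 2"
  defines "mu \<equiv> (fact k) powr (1 / real k) * Gamma (1 + 1 / real k)"
  shows "(\<lambda>n. \<integral>m. (cut_scale k n * real m - mu)\<^sup>2 \<partial>measure_pmf (k_cut_number_scale_free k n)) \<longlonglongrightarrow> 0"
proof -
  let ?gam = "Gamma (1 + 1 / real k)"
  let ?p = "\<lambda>n. measure_pmf (k_cut_number_scale_free k n)"
  let ?V = "\<lambda>n. \<integral>m. (cut_scale k n * real m - mu)\<^sup>2 \<partial>?p n"
  have "?gam > 0" by (simp add: Gamma_real_pos add_pos_nonneg)
  then have mu: "mu \<ge> 0" by (simp add: mu_def)
  define F where "F = (\<lambda>tau.
    (1 + surv k tau) / (2 * surv k tau) * ((exp (- tau) / fact k) powr (- 1 / real k) * ?gam)\<^sup>2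
    - 2 * mu * (exp (- 2 * tau) * ((1 / (fact k * (1 - (1 - surv k tau) / 2))) powr (- 1 / real k) * ?gam))
    + mu\<^sup>2)"
  have V_le: "?V n \<le> (cut_scale k n)\<^sup>2 * second_moment_bound k tau n - 2 * mu * (cut_scale k n * mean_bound k tau n) + mu\<^sup>2"
    if n: "n \<ge> 2" and tau: "tau > 0" for n tau
  proof -
    have k1: "k \<ge> 1" using k by simp
    note M = moments_real[OF k1 n tau]
    let ?a = "cut_scale k n"
    have a: "?a \<ge> 0" by (simp add: cut_scale_def)
    have "?V n = (\<integral>m. ?a\<^sup>2 * (real m)\<^sup>2 - 2 * mu * ?a * real m + mu\<^sup>2 \<partial>?p n)"
      by (intro Bochner_Integration.integral_cong refl) (simp add: power2_eq_square algebra_simps)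
    also have "\<dots> = ?a\<^sup>2 * (\<integral>m. (real m)\<^sup>2 \<partial>?p n) - 2 * mu * ?a * (\<integral>m. real m \<partial>?p n) + mu\<^sup>2"
      using M(1,2) by simp
    also have "\<dots> \<le> ?a\<^sup>2 * second_moment_bound k tau n - 2 * mu * ?a * mean_bound k tau n + mu\<^sup>2"
      using M(3,4) mu a by (intro add_mono diff_mono mult_left_mono order_refl) auto
    finally show ?thesis by (simp add: mult.assoc)
  qed
  have "(F \<longlongrightarrow> F 0) (at_right 0)"
  proof -
    have s: "(surv k \<longlongrightarrow> surv k 0) (at_right 0)"
      using DERIV_isCont[OF surv_has_derivative] by (simp add: isCont_def filterlim_at_split)
    have s0: "surv k 0 = 1" using k by (simp add: surv_at_0)
    show ?thesis
      unfolding F_def by (intro tendsto_intros s) (auto simp: s0)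
  qed
  moreover have "F 0 = 0"
  proof -
    have "surv k 0 = 1" using k by (simp add: surv_at_0)
    moreover have "(1 / fact k) powr (- 1 / real k) = (fact k :: real) powr (1 / real k)"
      by (simp add: powr_divide powr_minus_divide)
    ultimately show ?thesis
      by (simp add: F_def mu_def power2_eq_square)
  qed
  ultimately have F0: "(F \<longlongrightarrow> 0) (at_right 0)" by simp
  show ?thesis
  proof (rule LIMSEQ_I)
    fix e :: real assume e: "0 < e"
    have "\<forall>\<^sub>F tau in at_right 0. F tau < e"
      using order_tendstoD(2)[OF F0 e] .
    moreover have "\<forall>\<^sub>F tau in at_right (0::real). 0 < tau"
      by (rule eventually_at_right_less)
    ultimately have "\<forall>\<^sub>F tau in at_right (0::real). 0 < tau \<and> F tau < e"
      by eventually_elim simp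
    then obtain tau where tau: "0 < tau" "F tau < e"
      using eventually_happens'[OF trivial_limit_at_right_real] by blast
    have "(\<lambda>n. (cut_scale k n)\<^sup>2 * second_moment_bound k tau n - 2 * mu * (cut_scale k n * mean_bound k tau n) + mu\<^sup>2) \<longlonglongrightarrow> F tau"
      unfolding F_def
      by (intro tendsto_intros scaled_second_moment_tendsto scaled_mean_tendsto k tau)
    then have "\<forall>\<^sub>F n in sequentially. (cut_scale k n)\<^sup>2 * second_moment_bound k tau n - 2 * mu * (cut_scale k n * mean_bound k tau n) + mu\<^sup>2 < e"
      using order_tendstoD(2) tau(2) by blast
    then have "\<forall>\<^sub>F n in sequentially. ?V n < e"
      using eventually_ge_at_top[of 2]
      by eventually_elim (use V_le[OF _ tau(1)] in \<open>force intro: le_less_trans\<close>)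
    then show "\<exists>no. \<forall>n\<ge>no. norm (?V n - 0) < e"
      by (auto simp: eventually_sequentially)
  qed
qed

text \<open>
  Away from its only jump at \<open>c\<close>, the limit distribution function is compared with the others
  by means of Markov's inequality for the squared deviation.
\<close>

lemma weak_conv_m_const:
  fixes X :: "nat \<Rightarrow> 'a \<Rightarrow> real" and p :: "nat \<Rightarrow> 'a pmf"
  assumes int: "\<forall>\<^sub>F n in sequentially. integrable (measure_pmf (p n)) (\<lambda>m. (X n m - c)\<^sup>2)"
    and lim: "(\<lambda>n. \<integral>m. (X n m - c)\<^sup>2 \<partial>measure_pmf (p n)) \<longlonglongrightarrow> 0"
  shows "weak_conv_m (\<lambda>n. distr (measure_pmf (p n)) borel (X n)) (return borel c)"
  unfolding weak_conv_m_def weak_conv_def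
proof (intro allI impI)
  fix x assume cont: "isCont (cdf (return borel c)) x"
  interpret R: real_distribution "return borel c"
    by (intro real_distribution.intro prob_space_return real_distribution_axioms.intro) auto
  have "x \<noteq> c"
    using cont by (auto simp: R.isCont_cdf measure_return)
  have cdf: "cdf (distr (measure_pmf (p n)) borel (X n)) x = measure (measure_pmf (p n)) {m. X n m \<le> x}" for n
    by (simp add: cdf_def measure_distr vimage_def)
  have cdf_c: "cdf (return borel c) x = (if c \<le> x then 1 else 0)"
    by (simp add: cdf_def measure_return)
  define d where "d = (x - c)\<^sup>2"
  have d: "d > 0" using \<open>x \<noteq> c\<close> by (simp add: d_def)
  let ?V = "\<lambda>n. \<integral>m. (X n m - c)\<^sup>2 \<partial>measure_pmf (p n)"
  have markov: "\<forall>\<^sub>F n in sequentially. measure (measure_pmf (p n)) {m. d \<le> (X n m - c)\<^sup>2} \<le> ?V n / d"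
    using int
  proof eventually_elim
    case (elim n)
    then show ?case
      using integral_Markov_inequality_measure[OF elim, of UNIV d] d by simp
  qed
  have "\<forall>\<^sub>F n in sequentially. norm (cdf (distr (measure_pmf (p n)) borel (X n)) x - cdf (return borel c) x) \<le> ?V n / d"
    using markov
  proof eventually_elim
    case (elim n)
    show ?case
    proof (cases "c < x")
      case True
      have "1 - measure (measure_pmf (p n)) {m. X n m \<le> x} = measure (measure_pmf (p n)) (- {m. X n m \<le> x})"
        using measure_pmf.prob_compl[of "{m. X n m \<le> x}" "p n"] by (simp add: Compl_eq_Diff_UNIV)
      also have "\<dots> \<le> measure (measure_pmf (p n)) {m. d \<le> (X n m - c)\<^sup>2}"
        using True by (intro measure_pmf.finite_measure_mono) (auto simp: d_def intro!: power_mono)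
      finally show ?thesis
        using elim True measure_pmf.prob_le_1[of "p n" "{m. X n m \<le> x}"] by (simp add: cdf cdf_c)
    next
      case False
      then have "x < c" using \<open>x \<noteq> c\<close> by simp
      have "d \<le> (X n m - c)\<^sup>2" if "X n m \<le> x" for m
      proof -
        have "(c - x)\<^sup>2 \<le> (c - X n m)\<^sup>2" using that \<open>x < c\<close> by (intro power_mono) auto
        then show ?thesis by (simp add: d_def power2_commute)
      qed
      then have "measure (measure_pmf (p n)) {m. X n m \<le> x} \<le> measure (measure_pmf (p n)) {m. d \<le> (X n m - c)\<^sup>2}"
        by (intro measure_pmf.finite_measure_mono) auto
      then show ?thesis using elim \<open>x < c\<close> by (simp add: cdf cdf_c)
    qed
  qed
  moreover have "(\<lambda>n. ?V n / d) \<longlonglongrightarrow> 0"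
    using tendsto_divide[OF lim tendsto_const[of d]] d by simp
  ultimately have "(\<lambda>n. cdf (distr (measure_pmf (p n)) borel (X n)) x - cdf (return borel c) x) \<longlonglongrightarrow> 0"
    by (rule Lim_null_comparison)
  then show "(\<lambda>n. cdf (distr (measure_pmf (p n)) borel (X n)) x) \<longlonglongrightarrow> cdf (return borel c) x"
    by (rule LIM_zero_cancel)
qed

theorem mainTheorem5:
  fixes k :: nat
  assumes "k \<ge> 2"
  shows "weak_conv_m
    (\<lambda>n. distr (measure_pmf (k_cut_number_scale_free k n)) borel
       (\<lambda>K. 2 powr (- 1 / real k) * inverse (real n) * (ln (real n)) powr (1 / real k) * real K))
    (return borel ((fact k) powr (1 / real k) * Gamma (1 + 1 / real k)))"
proof -
  let ?mu = "(fact k) powr (1 / real k) * Gamma (1 + 1 / real k)"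
  have int: "integrable (measure_pmf (k_cut_number_scale_free k n)) (\<lambda>m. (cut_scale k n * real m - ?mu)\<^sup>2)"
    if "n \<ge> 2" for n
  proof -
    have "integrable (measure_pmf (k_cut_number_scale_free k n))
        (\<lambda>m. (cut_scale k n)\<^sup>2 * (real m)\<^sup>2 - 2 * ?mu * cut_scale k n * real m + ?mu\<^sup>2)"
      using moments_real(1,2)[of k n 1] assms that by simp
    moreover have "(cut_scale k n * real m - ?mu)\<^sup>2 =
        (cut_scale k n)\<^sup>2 * (real m)\<^sup>2 - 2 * ?mu * cut_scale k n * real m + ?mu\<^sup>2" for m
      by (simp only: power2_diff power_mult_distrib) (simp add: mult_ac)
    ultimately show ?thesis by (simp only:)
  qed
  have "\<forall>\<^sub>F n in sequentially. integrable (measure_pmf (k_cut_number_scale_free k n))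
      (\<lambda>m. (cut_scale k n * real m - ?mu)\<^sup>2)"
    using eventually_ge_at_top[of 2] by eventually_elim (rule int)
  from weak_conv_m_const[OF this mean_square_deviation_tendsto_0[OF assms]]
  show ?thesis unfolding cut_scale_def .
qed

end
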